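(* Let $\Sigma=(\mathbf x,\mathbf y,B)$ be an acyclic seed with $\mathbf x=(x_1,\ldots,x_n)$ and $\mathbf y=(x_{n+1},\ldots,x_{n+m})$, having no isolated exchangeable indices if the base ring $K$ is a field, and let $A=A(\Sigma)$ be the associated cluster algebra over $K$. Then the following statements are equivalent: (a) $A$ is factorial (a unique factorization domain); (b) the exchange polynomials $f_1,\ldots,f_n$ are prime elements of $K[\mathbf x,\mathbf y]$ and pairwise distinct.
   Context: The base ring $K$ is either $\mathbb Z$ or a field of characteristic $0$; $[a,b]$ denotes the set of integers between $a$ and $b$. An exchange matrix is an $(n+m)\times n$ integer matrix $B=(b_{ij})$ ($n,m\ge 0$) whose principal part (the top $n\times n$ submatrix) is skew-symmetrizable, i.e. there are positive integers $d_1,\ldots,d_n$ with $d_ib_{ij}=-d_jb_{ji}$ for all $i,j\in[1,n]$. A seed is a triple $\Sigma=(\mathbf x,\mathbf y,B)$ with $\mathbf x=(x_1,\ldots,x_n)$ (exchangeable variables) and $\mathbf y=(x_{n+1},\ldots,x_{n+m})$ (frozen variables) together algebraically independent over $K$, and $B$ an $(n+m)\times n$ exchange matrix; its ambient field is $\mathcal F=\mathbf q(K)(x_1,\ldots,x_{n+m})$, where $\mathbf q$ denotes the quotient field. For $i\in[1,n]$ the exchange polynomial is $f_i=\prod_{j:\,b_{ji}>0}x_j^{b_{ji}}+\prod_{j:\,b_{ji}<0}x_j^{-b_{ji}}\in K[\mathbf x,\mathbf y]$, with $j$ ranging over $[1,n+m]$. The mutation $\mu_i(\Sigma)$ is the seed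 obtained by replacing $x_i$ by $x_i'=f_i/x_i\in\mathcal F$, keeping $\mathbf y$ and the other $x_j$, and replacing $B$ by $B'=(b'_{kl})$, where $b'_{kl}=-b_{kl}$ if $k=i$ or $l=i$, and $b'_{kl}=b_{kl}+\tfrac12(|b_{ki}|b_{il}+b_{ki}|b_{il}|)$ otherwise. Let $\mathcal X$ be the set of all exchangeable variables of seeds obtained from $\Sigma$ by finite sequences of mutations (the cluster variables). The cluster algebra (with all frozen variables invertible) is $A(\Sigma)=K[x,\,y,\,y^{-1}\mid x\in\mathcal X,\ y\in\mathbf y]\subseteq\mathcal F$. The seed is acyclic if the directed graph on $[1,n]$ with an edge $i\to j$ whenever $b_{ij}>0$ has no oriented cycle. An exchangeable index $i\in[1,n]$ is isolated if $b_{ji}=0$ for all $j\in[1,n+m]$. *)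

theory Defs
  imports
    "HOL-Algebra.Algebraic_Closure_Type"
    "HOL-Algebra.Generated_Fields"
    "HOL-Algebra.Ring_Divisibility"
    "HOL-Library.Poly_Mapping"
begin

text \<open>
  Conventions. The ambient field is a type \<open>'f\<close> of characteristic 0, and the base ring is a
  subset \<open>K\<close> of it. A seed of rank \<open>n\<close> with \<open>m\<close> frozen variables is given by a family
  \<open>x\<close> of field elements and an integer matrix \<open>b\<close>, where only the values \<open>x i\<close> for
  \<open>i \<in> {1..n+m}\<close> and \<open>b i j\<close> for \<open>i \<in> {1..n+m}\<close>, \<open>j \<in> {1..n}\<close> are meaningful.
  The exchangeable variables are \<open>x 1, \<dots>, x n\<close>, the frozen ones \<open>x (n+1), \<dots>, x (n+m)\<close>.
\<close>

abbreviation ring_on :: "'f::ring_1 set \<Rightarrow> 'f ring" where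
  "ring_on S \<equiv> ring_of_type_algebra\<lparr>carrier := S\<rparr>"

definition base_ring :: "'f::field_char_0 set \<Rightarrow> bool" where
  "base_ring K \<longleftrightarrow> K = \<int> \<or> subfield K (ring_of_type_algebra :: 'f ring)"

text \<open>
  A polynomial in variables indexed by natural numbers is a finitely supported map from
  exponent vectors to coefficients.
\<close>

definition mpoly_eval :: "(nat \<Rightarrow> 'f::comm_ring_1) \<Rightarrow> ((nat \<Rightarrow>\<^sub>0 nat) \<Rightarrow>\<^sub>0 'f) \<Rightarrow> 'f" where
  "mpoly_eval x p =
     (\<Sum>e \<in> Poly_Mapping.keys p. Poly_Mapping.lookup p e *
        (\<Prod>i \<in> Poly_Mapping.keys e. x i ^ Poly_Mapping.lookup e i))"

definition alg_independent :: "'f::comm_ring_1 set \<Rightarrow> nat set \<Rightarrow> (nat \<Rightarrow> 'f) \<Rightarrow> bool" where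
  "alg_independent K I x \<longleftrightarrow>
     (\<forall>p. (\<forall>e \<in> Poly_Mapping.keys p. Poly_Mapping.lookup p e \<in> K \<and> Poly_Mapping.keys e \<subseteq> I)
        \<longrightarrow> mpoly_eval x p = 0 \<longrightarrow> p = 0)"

definition exchange_matrix :: "nat \<Rightarrow> (nat \<Rightarrow> nat \<Rightarrow> int) \<Rightarrow> bool" where
  "exchange_matrix n b \<longleftrightarrow>
     (\<exists>d :: nat \<Rightarrow> int. (\<forall>i \<in> {1..n}. d i > 0) \<and>
        (\<forall>i \<in> {1..n}. \<forall>j \<in> {1..n}. d i * b i j = - (d j * b j i)))"

definition is_seed ::
  "'f::field_char_0 set \<Rightarrow> nat \<Rightarrow> nat \<Rightarrow> (nat \<Rightarrow> 'f) \<Rightarrow> (nat \<Rightarrow> nat \<Rightarrow> int) \<Rightarrow> bool" where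
  "is_seed K n m x b \<longleftrightarrow> alg_independent K {1..n+m} x \<and> exchange_matrix n b"

text \<open>The field of fractions of \<open>K[x\<^sub>1, \<dots>, x\<^sub>n\<^sub>+\<^sub>m]\<close> inside \<open>'f\<close>.\<close>

definition ambient_field ::
  "'f::field_char_0 set \<Rightarrow> nat \<Rightarrow> nat \<Rightarrow> (nat \<Rightarrow> 'f) \<Rightarrow> 'f set" where
  "ambient_field K n m x = generate_field ring_of_type_algebra (K \<union> x ` {1..n+m})"

text \<open>
  \<open>K[x\<^sub>1, \<dots>, x\<^sub>n\<^sub>+\<^sub>m]\<close>; for a seed this subring of \<open>'f\<close> is a polynomial ring, by
  algebraic independence.
\<close>

definition seed_polynomials ::
  "'f::field_char_0 set \<Rightarrow> nat \<Rightarrow> nat \<Rightarrow> (nat \<Rightarrow> 'f) \<Rightarrow> 'f set" where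
  "seed_polynomials K n m x = generate_ring ring_of_type_algebra (K \<union> x ` {1..n+m})"

definition exchange_poly ::
  "nat \<Rightarrow> nat \<Rightarrow> (nat \<Rightarrow> 'f::field_char_0) \<Rightarrow> (nat \<Rightarrow> nat \<Rightarrow> int) \<Rightarrow> nat \<Rightarrow> 'f" where
  "exchange_poly n m x b i =
     (\<Prod>j \<in> {j \<in> {1..n+m}. b j i > 0}. x j ^ nat (b j i)) +
     (\<Prod>j \<in> {j \<in> {1..n+m}. b j i < 0}. x j ^ nat (- b j i))"

definition mutate_vars ::
  "nat \<Rightarrow> nat \<Rightarrow> nat \<Rightarrow> (nat \<Rightarrow> 'f::field_char_0) \<Rightarrow> (nat \<Rightarrow> nat \<Rightarrow> int) \<Rightarrow> (nat \<Rightarrow> 'f)" where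
  "mutate_vars n m i x b = x(i := exchange_poly n m x b i / x i)"

text \<open>The division by 2 is exact: the dividend is \<open>0\<close> or \<open>\<plusminus> 2 * b k i * b i l\<close>.\<close>

definition mutate_matrix :: "nat \<Rightarrow> (nat \<Rightarrow> nat \<Rightarrow> int) \<Rightarrow> (nat \<Rightarrow> nat \<Rightarrow> int)" where
  "mutate_matrix i b = (\<lambda>k l.
     if k = i \<or> l = i then - b k l
     else b k l + (\<bar>b k i\<bar> * b i l + b k i * \<bar>b i l\<bar>) div 2)"

inductive mutation_reachable ::
  "nat \<Rightarrow> nat \<Rightarrow> (nat \<Rightarrow> 'f::field_char_0) \<Rightarrow> (nat \<Rightarrow> nat \<Rightarrow> int) \<Rightarrow>
   (nat \<Rightarrow> 'f) \<Rightarrow> (nat \<Rightarrow> nat \<Rightarrow> int) \<Rightarrow> bool"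
  for n m x b where
  refl: "mutation_reachable n m x b x b"
| step: "mutation_reachable n m x b x' b' \<Longrightarrow> i \<in> {1..n} \<Longrightarrow>
         mutation_reachable n m x b (mutate_vars n m i x' b') (mutate_matrix i b')"

definition cluster_variables ::
  "nat \<Rightarrow> nat \<Rightarrow> (nat \<Rightarrow> 'f::field_char_0) \<Rightarrow> (nat \<Rightarrow> nat \<Rightarrow> int) \<Rightarrow> 'f set" where
  "cluster_variables n m x b = {x' i | x' b' i. mutation_reachable n m x b x' b' \<and> i \<in> {1..n}}"

definition cluster_algebra ::
  "'f::field_char_0 set \<Rightarrow> nat \<Rightarrow> nat \<Rightarrow> (nat \<Rightarrow> 'f) \<Rightarrow> (nat \<Rightarrow> nat \<Rightarrow> int) \<Rightarrow> 'f set" where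
  "cluster_algebra K n m x b =
     generate_ring ring_of_type_algebra
       (K \<union> cluster_variables n m x b \<union> x ` {n+1..n+m} \<union> (\<lambda>j. inverse (x j)) ` {n+1..n+m})"

definition acyclic_seed :: "nat \<Rightarrow> (nat \<Rightarrow> nat \<Rightarrow> int) \<Rightarrow> bool" where
  "acyclic_seed n b \<longleftrightarrow> acyclic {(i, j). i \<in> {1..n} \<and> j \<in> {1..n} \<and> b i j > 0}"

definition isolated_index :: "nat \<Rightarrow> nat \<Rightarrow> (nat \<Rightarrow> nat \<Rightarrow> int) \<Rightarrow> nat \<Rightarrow> bool" where
  "isolated_index n m b i \<longleftrightarrow> (\<forall>j \<in> {1..n+m}. b j i = 0)"

end

theory Submission
  imports Defs
begin

text \<open>
  Everything takes place in the ring of Laurent polynomials in the seed variables, which is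
  factorial, and in its subring of elements that are also Laurent in every seed adjacent to the
  given one, the upper bound. The Laurent phenomenon is a rank-two statement about upper bounds
  when the exchange polynomials are pairwise coprime. Coprimality is forced by adjoining one
  frozen variable for each exchangeable index, and the general case follows by specialising these
  extra variables to 1. So the cluster algebra lies in the upper bound.

  For an acyclic seed with coprime exchange polynomials, removing one source after the other shows
  that the upper bound is generated by the \<open>x\<^sub>i\<close>, the \<open>f\<^sub>i / x\<^sub>i\<close> and the frozen variables; so it
  is the cluster algebra. If all \<open>f\<^sub>i\<close> are prime, comparing lowest terms in \<open>x\<^sub>i\<close> modulo powers of
  \<open>f\<^sub>i\<close> shows that \<open>x\<^sub>i\<close> is a prime of the upper bound, and the primes of the Laurent ring remain
  prime there after division by the largest possible monomial, which gives factoriality.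

  Conversely \<open>x\<^sub>i\<close> is always irreducible, hence prime in a factorial cluster algebra. Clearing
  denominators in a divisibility \<open>f\<^sub>i dvd p * q\<close> turns primality of \<open>x\<^sub>i\<close> into primality of \<open>f\<^sub>i\<close>, and
  \<open>f\<^sub>i = f\<^sub>j\<close> would put \<open>f\<^sub>i / (x\<^sub>i x\<^sub>j)\<close> into the cluster algebra, which is excluded by its poles.
\<close>

text \<open>The obstacle is that the exchange polynomials of the given seed may have common factors.
  If \<open>f_i = f_j\<close>, then \<open>f_i / (x_i x_j)\<close> lies in the upper bound, so the
  upper bound alone is too large to refute this case. What survives specialisation is membership in
  the algebras \<open>lower_alg K I {i, j} f\<close> of pairs: the rank-two theorem is applied to
  the generic seed, where full rank of the extended matrix gives coprimality, and its conclusion is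
  a spanning statement, which a substitution preserves. The generic seed lives over the integers,
  since the exchange relations involve no other constants. An isolated index has
  \<open>f_i = 2\<close>. Over a field this is a unit, so \<open>x_i\<close> is invertible in the
  cluster algebra and carries no information; over the integers 2 is prime and fits the general
  argument. Hence the condition on isolated indices.\<close>

type_synonym 'a laurent = "(nat \<Rightarrow>\<^sub>0 int) \<Rightarrow>\<^sub>0 'a"

abbreviation "lookup \<equiv> Poly_Mapping.lookup"
abbreviation "keys \<equiv> Poly_Mapping.keys"
abbreviation "single \<equiv> Poly_Mapping.single"

section \<open>Subrings and divisibility inside them\<close>

definition is_subring :: "'a::comm_ring_1 set \<Rightarrow> bool" where
  "is_subring S \<longleftrightarrow> 1 \<in> S \<and> (\<forall>a\<in>S. \<forall>b\<in>S. a - b \<in> S \<and> a * b \<in> S)"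

lemma is_subringD:
  assumes "is_subring S"
  shows "1 \<in> S" "0 \<in> S" "a \<in> S \<Longrightarrow> b \<in> S \<Longrightarrow> a - b \<in> S" "a \<in> S \<Longrightarrow> - a \<in> S"
    "a \<in> S \<Longrightarrow> b \<in> S \<Longrightarrow> a + b \<in> S" "a \<in> S \<Longrightarrow> b \<in> S \<Longrightarrow> a * b \<in> S"
proof -
  show one: "1 \<in> S" and minus: "\<And>a b. a \<in> S \<Longrightarrow> b \<in> S \<Longrightarrow> a - b \<in> S" 
    and "a \<in> S \<Longrightarrow> b \<in> S \<Longrightarrow> a * b \<in> S"
    using assms by (auto simp: is_subring_def)
  show zero: "0 \<in> S" using minus[OF one one] by simp
  show um: "a \<in> S \<Longrightarrow> - a \<in> S" for a using minus[OF zero] by fastforce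
  show "a \<in> S \<Longrightarrow> b \<in> S \<Longrightarrow> a + b \<in> S" using minus[of a "- b"] um by fastforce
qed

lemma is_subring_power: "is_subring S \<Longrightarrow> a \<in> S \<Longrightarrow> a ^ k \<in> S"
  by (induction k) (auto simp: is_subringD)

lemma is_subring_sum: "is_subring S \<Longrightarrow> (\<And>i. i \<in> Z \<Longrightarrow> f i \<in> S) \<Longrightarrow> sum f Z \<in> S"
  by (induction Z rule: infinite_finite_induct) (auto simp: is_subringD)

lemma is_subring_prod: "is_subring S \<Longrightarrow> (\<And>i. i \<in> Z \<Longrightarrow> f i \<in> S) \<Longrightarrow> prod f Z \<in> S"
  by (induction Z rule: infinite_finite_induct) (auto simp: is_subringD)

lemma is_subring_prod_list: "is_subring S \<Longrightarrow> set xs \<subseteq> S \<Longrightarrow> prod_list xs \<in> S"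
  by (induction xs) (auto simp: is_subringD)

text \<open>The quotient is taken from the set \<open>S\<close>, because the same two elements are
  compared in the Laurent ring, in the upper bound and in the polynomial ring, all subsets of one
  type.\<close>

definition dvd_in :: "'a::comm_ring_1 set \<Rightarrow> 'a \<Rightarrow> 'a \<Rightarrow> bool" where
  "dvd_in S a b \<longleftrightarrow> (\<exists>c\<in>S. b = a * c)"

lemma dvd_inI: "c \<in> S \<Longrightarrow> b = a * c \<Longrightarrow> dvd_in S a b"
  by (auto simp: dvd_in_def)

lemma dvd_in_0: "is_subring S \<Longrightarrow> dvd_in S a 0"
  by (rule dvd_inI[of 0]) (auto simp: is_subringD)

lemma dvd_in_refl: "is_subring S \<Longrightarrow> dvd_in S a a"
  by (rule dvd_inI[of 1]) (auto simp: is_subringD)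

lemma dvd_in_add: "is_subring S \<Longrightarrow> dvd_in S a b \<Longrightarrow> dvd_in S a c \<Longrightarrow> dvd_in S a (b + c)"
  unfolding dvd_in_def by (metis distrib_left is_subringD(5))

lemma dvd_in_diff: "is_subring S \<Longrightarrow> dvd_in S a b \<Longrightarrow> dvd_in S a c \<Longrightarrow> dvd_in S a (b - c)"
  unfolding dvd_in_def by (metis right_diff_distrib is_subringD(3))

lemma dvd_in_sum:
  "is_subring S \<Longrightarrow> (\<And>i. i \<in> Z \<Longrightarrow> dvd_in S a (f i)) \<Longrightarrow> dvd_in S a (sum f Z)"
  by (induction Z rule: infinite_finite_induct) (auto simp: dvd_in_0 dvd_in_add)

lemma dvd_in_mult: "is_subring S \<Longrightarrow> dvd_in S a b \<Longrightarrow> c \<in> S \<Longrightarrow> dvd_in S a (b * c)"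
  unfolding dvd_in_def by (metis is_subringD(6) mult.assoc)

lemma dvd_in_mult2: "is_subring S \<Longrightarrow> dvd_in S a b \<Longrightarrow> c \<in> S \<Longrightarrow> dvd_in S a (c * b)"
  using dvd_in_mult[of S a b c] by (simp add: mult.commute)

lemma dvd_in_trans: "is_subring S \<Longrightarrow> dvd_in S a b \<Longrightarrow> dvd_in S b c \<Longrightarrow> dvd_in S a c"
  unfolding dvd_in_def by (metis is_subringD(6) mult.assoc)

lemma dvd_in_mult_mono:
  "is_subring S \<Longrightarrow> dvd_in S a b \<Longrightarrow> dvd_in S c d \<Longrightarrow> dvd_in S (a * c) (b * d)"
  unfolding dvd_in_def by (metis is_subringD(6) mult.assoc mult.left_commute)

lemma dvd_in_power_le:
  "is_subring S \<Longrightarrow> a \<in> S \<Longrightarrow> k \<le> l \<Longrightarrow> dvd_in S (a ^ k) (a ^ l)"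
  by (rule dvd_inI[of "a ^ (l - k)"]) (auto simp: is_subring_power simp flip: power_add)

lemma dvd_in_cancel:
  fixes a b c :: "'a::idom"
  shows "dvd_in S (a * b) (a * c) \<Longrightarrow> a \<noteq> 0 \<Longrightarrow> dvd_in S b c"
  unfolding dvd_in_def by (auto simp: mult.assoc)

section \<open>Laurent polynomials and their graded parts\<close>

lemma laurent_sum_single:
  fixes p :: "_ \<Rightarrow>\<^sub>0 'a::comm_monoid_add"
  shows "p = (\<Sum>e\<in>keys p. single e (lookup p e))"
  by (rule poly_mapping_eqI)
    (auto simp: lookup_sum lookup_single when_def in_keys_iff)

lemma laurent_induct [case_names zero add]:
  fixes q :: "_ \<Rightarrow>\<^sub>0 'a::comm_monoid_add"
  assumes "P 0"
    and "\<And>e p. e \<in> keys q \<Longrightarrow> P p \<Longrightarrow> P (single e (lookup q e) + p)"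
  shows "P q"
proof -
  have "P (\<Sum>e\<in>Z. single e (lookup q e))" if "finite Z" "Z \<subseteq> keys q" for Z
    using that by (induction Z rule: finite_induct) (auto intro: assms)
  then show ?thesis
    using laurent_sum_single[of q] by (metis finite_keys order_refl)
qed

text \<open>The degree function is a parameter: besides the exponent of one variable, its negative
  (for top degrees) and a weight built from two rows of the matrix are used.\<close>

lift_definition part :: "('e \<Rightarrow> int) \<Rightarrow> int \<Rightarrow> ('e \<Rightarrow>\<^sub>0 'a::zero) \<Rightarrow> ('e \<Rightarrow>\<^sub>0 'a)" is
  "\<lambda>d k p e. if d e = k then p e else 0"
  by (rule finite_subset) auto

abbreviation deg :: "nat \<Rightarrow> (nat \<Rightarrow>\<^sub>0 int) \<Rightarrow> int" where
  "deg i \<equiv> (\<lambda>e. lookup e i)"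

lemma lookup_part: "lookup (part d k p) e = (if d e = k then lookup p e else 0)"
  by transfer simp

lemma keys_part: "keys (part d k p) = {e \<in> keys p. d e = k}"
  by (auto simp: in_keys_iff lookup_part split: if_splits)

lemma part_zero [simp]: "part d k 0 = 0"
  by (rule poly_mapping_eqI) (simp add: lookup_part)

lemma part_add: "part d k (p + q) = part d k p + part d k (q :: _ \<Rightarrow>\<^sub>0 'a::comm_monoid_add)"
  by (rule poly_mapping_eqI) (simp add: lookup_part lookup_add)

lemma part_diff: "part d k (p - q) = part d k p - part d k (q :: _ \<Rightarrow>\<^sub>0 'a::ab_group_add)"
  by (rule poly_mapping_eqI) (simp add: lookup_part lookup_minus)

lemma part_sum: "part d k (sum f Z) = (\<Sum>x\<in>Z. part d k (f x :: _ \<Rightarrow>\<^sub>0 'a::comm_monoid_add))"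
  by (induction Z rule: infinite_finite_induct) (auto simp: part_add)

lemma part_single: "part d k (single e c) = (if d e = k then single e c else 0)"
  by (rule poly_mapping_eqI) (auto simp: lookup_part lookup_single when_def)

lemma part_part: "part d k (part d l p) = (if k = l then part d k p else 0)"
  by (rule poly_mapping_eqI) (auto simp: lookup_part)

lemma part_eq_0_iff: "part d k p = 0 \<longleftrightarrow> (\<forall>e\<in>keys p. d e \<noteq> k)"
  by (auto simp: keys_part simp flip: keys_eq_empty)

lemma sum_parts:
  fixes p :: "_ \<Rightarrow>\<^sub>0 'a::comm_monoid_add"
  shows "p = (\<Sum>k\<in>d ` keys p. part d k p)"
  by (rule poly_mapping_eqI) (auto simp: lookup_sum lookup_part in_keys_iff)

definition additive_fun :: "('e::plus \<Rightarrow> int) \<Rightarrow> bool" where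
  "additive_fun d \<longleftrightarrow> (\<forall>a b. d (a + b) = d a + d b)"

lemma additive_deg [simp]: "additive_fun (deg i)"
  by (simp add: additive_fun_def lookup_add)

lemma part_single_mult:
  fixes p :: "'a::comm_ring_1 laurent"
  assumes "additive_fun d"
  shows "part d k (single e c * p) = single e c * part d (k - d e) p"
proof (induction p rule: laurent_induct)
  case (add e' p)
  then show ?case
    using assms by (auto simp: part_add distrib_left mult_single part_single additive_fun_def)
qed simp

lemma part_homogeneous_mult:
  fixes p q :: "'a::comm_ring_1 laurent"
  assumes "additive_fun d" "\<And>e. e \<in> keys q \<Longrightarrow> d e = l"
  shows "part d k (q * p) = q * part d (k - l) p"
proof -
  have "part d k (q * p) = (\<Sum>e\<in>keys q. part d k (single e (lookup q e) * p))"
    by (subst laurent_sum_single[of q]) (simp add: sum_distrib_right part_sum)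
  also have "\<dots> = (\<Sum>e\<in>keys q. single e (lookup q e) * part d (k - l) p)"
  proof (rule sum.cong)
    fix e assume "e \<in> keys q"
    then show "part d k (single e (lookup q e) * p) = single e (lookup q e) * part d (k - l) p"
      using part_single_mult[OF assms(1), of k e "lookup q e" p] assms(2)[of e] by simp
  qed simp
  also have "\<dots> = q * part d (k - l) p"
    by (subst (2) laurent_sum_single[of q]) (simp add: sum_distrib_right)
  finally show ?thesis .
qed

text \<open>The grading makes this a convolution. \<open>Z\<close> may exceed the degrees that occur
  in \<open>p\<close>, so that a distinguished degree can be split off from the sum.\<close>

lemma part_mult:
  fixes p q :: "'a::comm_ring_1 laurent"
  assumes "additive_fun d" "finite Z" "d ` keys p \<subseteq> Z"
  shows "part d k (p * q) = (\<Sum>a\<in>Z. part d a p * part d (k - a) q)"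
proof -
  have "part d k (p * q) = (\<Sum>a\<in>d ` keys p. part d k (part d a p * q))"
    by (subst sum_parts[of p d]) (simp add: sum_distrib_right part_sum)
  also have "\<dots> = (\<Sum>a\<in>d ` keys p. part d a p * part d (k - a) q)"
    using assms by (intro sum.cong refl part_homogeneous_mult) (auto simp: keys_part)
  also have "\<dots> = (\<Sum>a\<in>Z. part d a p * part d (k - a) q)"
  proof (rule sum.mono_neutral_left)
    show "\<forall>a\<in>Z - d ` keys p. part d a p * part d (k - a) q = 0"
    proof
      fix a assume "a \<in> Z - d ` keys p"
      then have "part d a p = 0" by (auto simp: part_eq_0_iff)
      then show "part d a p * part d (k - a) q = 0" by simp
    qed
  qed (use assms in auto)
  finally show ?thesis .
qed

text \<open>In any other splitting of the degree \<open>a + b\<close> one factor lies below its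
  bound. The bounds need not be attained.\<close>

lemma part_mult_lowest:
  fixes p q :: "'a::comm_ring_1 laurent"
  assumes "additive_fun d" "\<And>e. e \<in> keys p \<Longrightarrow> a \<le> d e" "\<And>e. e \<in> keys q \<Longrightarrow> b \<le> d e"
  shows "part d (a + b) (p * q) = part d a p * part d b q"
proof -
  let ?Z = "insert a (d ` keys p)"
  have "part d (a + b) (p * q) = (\<Sum>c\<in>?Z. part d c p * part d (a + b - c) q)"
    using assms by (intro part_mult) auto
  also have "\<dots> = (\<Sum>c\<in>{a}. part d c p * part d (a + b - c) q)"
  proof (rule sum.mono_neutral_right)
    show "\<forall>c\<in>?Z - {a}. part d c p * part d (a + b - c) q = 0"
    proof
      fix c assume c: "c \<in> ?Z - {a}"
      then have "a < c" using assms(2) by force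
      then have "part d (a + b - c) q = 0"
        using assms(3) by (force simp: part_eq_0_iff)
      then show "part d c p * part d (a + b - c) q = 0" by simp
    qed
  qed auto
  finally show ?thesis by simp
qed

lemma keys_mult_ge:
  fixes p q :: "'a::comm_ring_1 laurent"
  assumes "additive_fun d" "\<And>e. e \<in> keys p \<Longrightarrow> a \<le> d e" "\<And>e. e \<in> keys q \<Longrightarrow> b \<le> d e"
    "e \<in> keys (p * q)"
  shows "a + b \<le> d e"
proof -
  have "e \<in> {u + v | u v. u \<in> keys p \<and> v \<in> keys q}"
    using keys_mult assms(4) by blast
  then show ?thesis using assms(1-3) by (force simp: additive_fun_def)
qed

definition lau :: "'a::comm_ring_1 set \<Rightarrow> nat set \<Rightarrow> 'a laurent set" where
  "lau K I = {p. (\<forall>e. lookup p e \<in> K) \<and> (\<forall>e\<in>keys p. keys e \<subseteq> I)}"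

lemma lau_single: "is_subring K \<Longrightarrow> c \<in> K \<Longrightarrow> keys e \<subseteq> I \<Longrightarrow> single e c \<in> lau K I"
  by (auto simp: lau_def lookup_single when_def is_subringD)

lemma lau_coeff: "p \<in> lau K I \<Longrightarrow> lookup p e \<in> K"
  by (auto simp: lau_def)

lemma lau_keys: "p \<in> lau K I \<Longrightarrow> e \<in> keys p \<Longrightarrow> keys e \<subseteq> I"
  by (auto simp: lau_def)

lemma lau_add:
  assumes "is_subring K" "p \<in> lau K I" "q \<in> lau K I"
  shows "p + q \<in> lau K I"
  using assms keys_add[of p q] by (fastforce simp: lau_def lookup_add is_subringD)

lemma lau_uminus: "is_subring K \<Longrightarrow> p \<in> lau K I \<Longrightarrow> - p \<in> lau K I"
  by (auto simp: lau_def is_subringD in_keys_iff)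

lemma lau_sum:
  assumes "is_subring K" "\<And>x. x \<in> Z \<Longrightarrow> f x \<in> lau K I"
  shows "sum f Z \<in> lau K I"
  using assms(2)
proof (induction Z rule: infinite_finite_induct)
  case (insert x F)
  then show ?case by (simp add: lau_add assms(1))
qed (auto simp: lau_def is_subringD assms(1))

lemma keys_plus_subset: "keys e \<subseteq> I \<Longrightarrow> keys e' \<subseteq> I \<Longrightarrow> keys (e + e' :: 'b \<Rightarrow>\<^sub>0 'c::monoid_add) \<subseteq> I"
  using keys_add[of e e'] by blast

lemma is_subring_lau:
  assumes K: "is_subring K"
  shows "is_subring (lau K I)"
  unfolding is_subring_def
proof (intro conjI ballI)
  show "1 \<in> lau K I" using lau_single[OF K, of 1 0] by (auto simp: K is_subringD)
  fix p q assume pq: "p \<in> lau K I" "q \<in> lau K I"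
  show "p - q \<in> lau K I" using lau_add[OF K pq(1) lau_uminus[OF K pq(2)]] by simp
  have "p * q = (\<Sum>e\<in>keys p. \<Sum>e'\<in>keys q. single e (lookup p e) * single e' (lookup q e'))"
    by (subst laurent_sum_single[of p], subst laurent_sum_single[of q])
      (simp add: sum_product)
  also have "\<dots> \<in> lau K I"
    unfolding mult_single using pq
    by (intro lau_sum lau_single K keys_plus_subset is_subringD(6)[OF K])
      (simp_all add: lau_coeff lau_keys)
  finally show "p * q \<in> lau K I" .
qed

lemma lau_part: "is_subring K \<Longrightarrow> p \<in> lau K I \<Longrightarrow> part d k p \<in> lau K I"
  by (auto simp: lau_def lookup_part keys_part is_subringD)

lemma lau_mono: "I \<subseteq> J \<Longrightarrow> lau K I \<subseteq> lau K J"
  by (auto simp: lau_def)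

lemma lau_induct [consumes 2, case_names zero add]:
  assumes "q \<in> lau K I" "is_subring K" "P 0"
    and "\<And>e c p. c \<in> K \<Longrightarrow> keys e \<subseteq> I \<Longrightarrow> P p \<Longrightarrow> P (single e c + p)"
  shows "P q"
  by (rule laurent_induct) (use assms in \<open>auto simp: lau_def\<close>)

abbreviation mon :: "(nat \<Rightarrow>\<^sub>0 int) \<Rightarrow> 'a::comm_ring_1 laurent" where
  "mon e \<equiv> single e 1"

lemma mon_mult: "mon a * mon b = mon (a + b)"
  by (simp add: mult_single)

lemma mon_mult_uminus [simp]: "mon a * mon (- a) = 1" "mon (- a) * mon a = 1"
  by (simp_all add: mult_single)

lemma mon_mult_left_cancel [simp]: "mon a * (mon (- a) * p) = p" "mon (- a) * (mon a * p) = p"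
  by (simp_all flip: mult.assoc)

lemma mon_neq_0 [simp]: "(mon e :: 'a::idom laurent) \<noteq> 0"
  by (metis lookup_single_eq lookup_zero zero_neq_one)


lemma mon_lau [simp]: "is_subring K \<Longrightarrow> keys e \<subseteq> I \<Longrightarrow> mon e \<in> lau K I"
  by (simp add: lau_single is_subringD)

section \<open>Spans of standard elements\<close>

text \<open>For \<open>E\<close> the exchangeable indices and \<open>g\<close> the exchange polynomials this is the lower bound
  algebra, in which \<open>x\<^sub>j\<close> and \<open>g\<^sub>j / x\<^sub>j\<close> (\<open>j \<in> E\<close>) are adjoined and the other variables
  are invertible; the span form makes both closure under products and specialisation immediate.\<close>

inductive_set lower_alg ::
  "'a::comm_ring_1 set \<Rightarrow> nat set \<Rightarrow> nat set \<Rightarrow> (nat \<Rightarrow> 'a laurent) \<Rightarrow> 'a laurent set"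
  for K I E g where
  zero: "0 \<in> lower_alg K I E g"
| step: "p \<in> lower_alg K I E g \<Longrightarrow> c \<in> K \<Longrightarrow> keys s \<subseteq> I \<Longrightarrow> (\<And>j. j \<in> E \<Longrightarrow> nat (- lookup s j) \<le> w j)
    \<Longrightarrow> single s c * (\<Prod>j\<in>E. g j ^ w j) + p \<in> lower_alg K I E g"

lemma lower_alg_term:
  "c \<in> K \<Longrightarrow> keys s \<subseteq> I \<Longrightarrow> (\<And>j. j \<in> E \<Longrightarrow> nat (- lookup s j) \<le> w j)
    \<Longrightarrow> single s c * (\<Prod>j\<in>E. g j ^ w j) \<in> lower_alg K I E g"
  using lower_alg.step[OF lower_alg.zero, of c K s I E w g] by simp

lemma lower_alg_add:
  "p \<in> lower_alg K I E g \<Longrightarrow> q \<in> lower_alg K I E g \<Longrightarrow> p + q \<in> lower_alg K I E g"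
  by (induction rule: lower_alg.induct) (auto simp: add.assoc intro: lower_alg.step)

text \<open>This is why the exponents \<open>w j\<close> are only bounded from below: where
  \<open>s\<close> and \<open>s'\<close> have opposite signs at \<open>j\<close>, the sum of the two
  exponents exceeds what \<open>s + s'\<close> requires.\<close>

lemma lower_alg_mult:
  assumes K: "is_subring K"
    and p: "p \<in> lower_alg K I E g" and q: "q \<in> lower_alg K I E g"
  shows "p * q \<in> lower_alg K I E g"
proof -
  have term_mult: "single s c * (\<Prod>j\<in>E. g j ^ w j) * q \<in> lower_alg K I E g"
    if s: "c \<in> K" "keys s \<subseteq> I" "\<And>j. j \<in> E \<Longrightarrow> nat (- lookup s j) \<le> w j" for s c w
    using q
  proof (induction rule: lower_alg.induct)
    case (step p c' s' w')
    have "single (s + s') (c * c') * (\<Prod>j\<in>E. g j ^ (w j + w' j)) \<in> lower_alg K I E g"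
    proof (rule lower_alg_term)
      show "c * c' \<in> K" using s step K by (simp add: is_subringD)
      show "keys (s + s') \<subseteq> I" using s step keys_plus_subset by blast
      show "nat (- lookup (s + s') j) \<le> w j + w' j" if "j \<in> E" for j
        using s(3)[OF that] step(4)[OF that] by (simp add: lookup_add)
    qed
    also have "single (s + s') (c * c') * (\<Prod>j\<in>E. g j ^ (w j + w' j)) =
       single s c * (\<Prod>j\<in>E. g j ^ w j) * (single s' c' * (\<Prod>j\<in>E. g j ^ w' j))"
      unfolding mult_single[of s c s' c', symmetric] by (simp only: power_add prod.distrib mult_ac)
    finally show ?case using step by (simp add: distrib_left lower_alg_add)
  qed (simp add: lower_alg.zero)
  show ?thesis using p
    by (induction rule: lower_alg.induct)
      (auto simp: distrib_right lower_alg.zero intro!: lower_alg_add term_mult)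
qed

lemma lower_alg_single:
  assumes "c \<in> K" "keys s \<subseteq> I" "\<And>j. j \<in> E \<Longrightarrow> 0 \<le> lookup s j"
  shows "single s c \<in> lower_alg K I E g"
  using lower_alg_term[of c K s I E "\<lambda>_. 0" g] assms by simp

lemma is_subring_lower_alg:
  assumes K: "is_subring K"
  shows "is_subring (lower_alg K I E g)"
  unfolding is_subring_def
proof (intro conjI ballI)
  show "1 \<in> lower_alg K I E g"
    using lower_alg_single[of 1 K 0 I E g] by (simp add: K is_subringD)
  fix p q assume pq: "p \<in> lower_alg K I E g" "q \<in> lower_alg K I E g"
  have "single 0 (- 1) \<in> lower_alg K I E g"
    by (rule lower_alg_single) (auto simp: K is_subringD)
  then have "p + single 0 (- 1) * q \<in> lower_alg K I E g"
    using pq lower_alg_add lower_alg_mult[OF K] by blast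
  then show "p - q \<in> lower_alg K I E g" by (simp add: single_uminus)
  show "p * q \<in> lower_alg K I E g" using lower_alg_mult[OF K] pq by blast
qed

lemma lower_alg_subset_lau:
  assumes K: "is_subring K" and g: "\<And>j. j \<in> E \<Longrightarrow> g j \<in> lau K I"
  shows "lower_alg K I E g \<subseteq> lau K I"
proof
  note S = is_subring_lau[OF K, of I]
  fix p assume "p \<in> lower_alg K I E g"
  then show "p \<in> lau K I"
  proof induction
    case (step p c s w)
    then show ?case
      by (intro is_subringD(5,6)[OF S] is_subring_prod[OF S] is_subring_power[OF S] g lau_single K)
  qed (simp add: S is_subringD)
qed

text \<open>The factors \<open>g j\<close> with \<open>j\<close> outside \<open>E'\<close> are kept
  as elements of the larger algebra, in which the variables \<open>x_j\<close> are
  invertible.\<close>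

lemma lower_alg_antimono:
  assumes K: "is_subring K" and E: "finite E" "E' \<subseteq> E"
    and g: "\<And>j. j \<in> E - E' \<Longrightarrow> g j \<in> lower_alg K I E' g"
  shows "lower_alg K I E g \<subseteq> lower_alg K I E' g"
proof
  note S = is_subring_lower_alg[OF K, of I E' g]
  fix p assume "p \<in> lower_alg K I E g"
  then show "p \<in> lower_alg K I E' g"
  proof induction
    case (step p c s w)
    have "single s c * (\<Prod>j\<in>E. g j ^ w j) =
        single s c * (\<Prod>j\<in>E'. g j ^ w j) * (\<Prod>j\<in>E-E'. g j ^ w j)"
      using prod.subset_diff[OF E(2,1), of "\<lambda>j. g j ^ w j"] by (simp add: mult_ac)
    also have "\<dots> \<in> lower_alg K I E' g"
      using step E(2) g
      by (intro is_subringD(6)[OF S] is_subring_prod[OF S] is_subring_power[OF S] lower_alg_term) auto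
    finally show ?case using step lower_alg_add by blast
  qed (rule lower_alg.zero)
qed

lemma keys_power_homogeneous:
  fixes p :: "'a::comm_ring_1 laurent"
  assumes "\<And>e. e \<in> keys p \<Longrightarrow> lookup e j = 0" "e \<in> keys (p ^ k)"
  shows "lookup e j = 0"
  using assms(2)
proof (induction k arbitrary: e)
  case (Suc k)
  then have "e \<in> {u + v | u v. u \<in> keys p \<and> v \<in> keys (p ^ k)}"
    using keys_mult[of p "p ^ k"] by auto
  then show ?case using assms(1) Suc.IH by (auto simp: lookup_add)
qed simp

lemma lower_alg_power_mult:
  assumes K: "is_subring K" and q: "q \<in> lau K I" "\<And>e. e \<in> keys q \<Longrightarrow> - int k \<le> lookup e j"
  shows "g j ^ k * q \<in> lower_alg K I {j} g"
proof -
  have "g j ^ k * (\<Sum>e\<in>keys q. single e (lookup q e)) \<in> lower_alg K I {j} g"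
    unfolding sum_distrib_left
  proof (rule is_subring_sum[OF is_subring_lower_alg[OF K]])
    fix e assume e: "e \<in> keys q"
    have "single e (lookup q e) * (\<Prod>j\<in>{j}. g j ^ k) \<in> lower_alg K I {j} g"
      using q(2)[OF e] by (intro lower_alg_term) (auto simp: lau_coeff[OF q(1)] lau_keys[OF q(1) e, THEN subsetD])
    then show "g j ^ k * single e (lookup q e) \<in> lower_alg K I {j} g"
      by (simp add: mult.commute)
  qed
  then show ?thesis by (simp flip: laurent_sum_single)
qed

text \<open>As \<open>g j\<close> does not involve \<open>x_j\<close>, multiplying by its powers
  respects the grading by the exponent of \<open>x_j\<close>, so a pole of order \<open>k\<close>
  costs a factor \<open>g j ^ k\<close> separately in each degree. Membership becomes a divisibility
  condition in the Laurent ring.\<close>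

lemma lower_alg_one_iff:
  assumes K: "is_subring K" and g: "g j \<in> lau K I" "\<And>e. e \<in> keys (g j) \<Longrightarrow> lookup e j = 0"
  shows "p \<in> lower_alg K I {j} g \<longleftrightarrow>
    p \<in> lau K I \<and> (\<forall>k::nat. dvd_in (lau K I) (g j ^ k) (part (deg j) (- int k) p))"
    (is "?L \<longleftrightarrow> ?R")
proof
  note S = is_subring_lau[OF K, of I]
  have hom: "part (deg j) a (g j ^ k * q) = g j ^ k * part (deg j) a q" for a k q
    using part_homogeneous_mult[OF additive_deg, of "g j ^ k" j 0 a q]
      keys_power_homogeneous[of "g j", OF g(2)] by auto
  {
    assume ?L
    then show ?R
    proof induction
      case (step p c s w)
      have "dvd_in (lau K I) (g j ^ k) (part (deg j) (- int k) (single s c * g j ^ w j))" for k :: nat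
      proof (cases "lookup s j = - int k")
        case True
        then have "k \<le> w j" using step(4)[of j] by simp
        then have "dvd_in (lau K I) (g j ^ k) (g j ^ w j)"
          by (intro dvd_in_power_le S g)
        then show ?thesis
          using step True by (auto simp: mult.commute[of _ "g j ^ w j"] hom part_single
              intro!: dvd_in_mult S lau_single K)
      next
        case False
        then show ?thesis
          by (simp add: mult.commute[of _ "g j ^ w j"] hom part_single dvd_in_0 S)
      qed
      moreover have "single s c * g j ^ w j \<in> lau K I"
        using step by (intro is_subringD(6)[OF S] is_subring_power[OF S] g lau_single K)
      ultimately show ?case
        using step by (auto simp: part_add dvd_in_add S is_subringD)
    qed (auto simp: S is_subringD dvd_in_0)
  }
  assume R: ?R
  have "(\<Sum>a\<in>deg j ` keys p. part (deg j) a p) \<in> lower_alg K I {j} g"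
  proof (rule is_subring_sum[OF is_subring_lower_alg[OF K]])
    fix a assume "a \<in> deg j ` keys p"
    show "part (deg j) a p \<in> lower_alg K I {j} g"
    proof (cases "a \<ge> 0")
      case True
      then have "g j ^ 0 * part (deg j) a p \<in> lower_alg K I {j} g"
        using R by (intro lower_alg_power_mult K lau_part) (auto simp: keys_part)
      then show ?thesis by simp
    next
      case False
      define k where "k = nat (- a)"
      have a: "a = - int k" using False by (simp add: k_def)
      obtain q where q: "q \<in> lau K I" "part (deg j) a p = g j ^ k * q"
        using R a unfolding dvd_in_def by blast
      \<comment> \<open>The quotient \<open>q\<close> may be inhomogeneous; its part of degree
        \<open>a = -k\<close> is also a quotient and meets the exponent bound of
        \<open>lower_alg_power_mult\<close>.\<close>
      have "part (deg j) a p = g j ^ k * part (deg j) a q"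
        using arg_cong[OF q(2), of "part (deg j) a"] by (simp add: part_part hom)
      also have "\<dots> \<in> lower_alg K I {j} g"
        using q by (intro lower_alg_power_mult K lau_part) (auto simp: keys_part a)
      finally show ?thesis .
    qed
  qed
  then show ?L by (simp flip: sum_parts)
qed

text \<open>Only constants, variables and the quotients \<open>g j / x_j\<close> have to be checked.
  This serves for the specialisation of the generic seed, for a change of seed and for the
  evaluation into the cluster algebra.\<close>

lemma lower_alg_image:
  fixes h :: "'a::comm_ring_1 laurent \<Rightarrow> 'c::comm_ring_1"
  assumes T: "is_subring T" and E: "E \<subseteq> I" and I: "finite I"
    and h_add: "\<And>p q. h (p + q) = h p + h q" and h_mult: "\<And>p q. h (p * q) = h p * h q"
    and h_1: "h 1 = 1"
    and const: "\<And>c. c \<in> K \<Longrightarrow> h (single 0 c) \<in> T"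
    and inv: "\<And>l. l \<in> I - E \<Longrightarrow> h (mon (single l 1)) \<in> T \<and> h (mon (single l (-1))) \<in> T"
    and exch: "\<And>j. j \<in> E \<Longrightarrow> h (mon (single j 1)) \<in> T \<and> h (mon (single j (-1)) * g j) \<in> T"
    and p: "p \<in> lower_alg K I E g"
  shows "h p \<in> T"
  using p
proof induction
  case zero
  have "h 0 = 0" using h_add[of 0 0] by simp
  then show ?case by (simp add: T is_subringD)
next
  case (step p c s w)
  have h_pow: "h (p ^ k) = h p ^ k" for p and k :: nat
    by (induction k) (auto simp: h_1 h_mult)
  have h_prod: "h (prod f Z) = (\<Prod>z\<in>Z. h (f z))" for f :: "nat \<Rightarrow> 'a laurent" and Z
    by (induction Z rule: infinite_finite_induct) (auto simp: h_1 h_mult)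
  have mon_pos: "(mon (single l a) :: 'a laurent) = mon (single l 1) ^ nat a" if "a \<ge> 0" for l a
  proof -
    have "mon (single l 1) ^ k = (mon (single l (int k)) :: 'a laurent)" for k :: nat
      by (induction k) (auto simp: mult_single simp flip: single_add)
    from this[of "nat a", symmetric] that show ?thesis by simp
  qed
  have mon_neg: "(mon (single l a) :: 'a laurent) = mon (single l (-1)) ^ nat (- a)" if "a \<le> 0" for l a
  proof -
    have "mon (single l (-1)) ^ k = (mon (single l (- int k)) :: 'a laurent)" for k :: nat
      by (induction k) (auto simp: mult_single simp flip: single_add)
    from this[of "nat (- a)"] that show ?thesis by simp
  qed
  have "s = (\<Sum>l\<in>keys s. single l (lookup s l))" by (rule laurent_sum_single)
  also have "\<dots> = (\<Sum>l\<in>I. single l (lookup s l))"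
    using step(3) I by (intro sum.mono_neutral_left) (auto simp: in_keys_iff)
  finally have s: "s = (\<Sum>l\<in>I. single l (lookup s l))" .
  have mon_sum: "mon (sum f Z) = (\<Prod>z\<in>Z. mon (f z) :: 'a laurent)" for f and Z :: "nat set"
    by (induction Z rule: infinite_finite_induct) (auto simp flip: mon_mult)
  have "single s c = single 0 c * (\<Prod>l\<in>I. mon (single l (lookup s l)))"
    unfolding mon_sum[symmetric] s[symmetric] by (simp add: mult_single)
  also have "\<dots> = single 0 c * (\<Prod>l\<in>I - E. mon (single l (lookup s l))) * (\<Prod>l\<in>E. mon (single l (lookup s l)))"
    using prod.subset_diff[OF E I, of "\<lambda>l. mon (single l (lookup s l)) :: 'a laurent"]
    by (simp add: mult_ac)
  finally have "h (single s c * (\<Prod>j\<in>E. g j ^ w j)) =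
      h (single 0 c) * (\<Prod>l\<in>I - E. h (mon (single l (lookup s l)))) *
      (\<Prod>j\<in>E. h (mon (single j (lookup s j)) * g j ^ w j))"
    by (simp add: h_mult h_prod prod.distrib mult_ac)
  also have "\<dots> \<in> T"
  proof (intro is_subringD(6)[OF T] is_subring_prod[OF T] const step)
    fix l assume l: "l \<in> I - E"
    show "h (mon (single l (lookup s l))) \<in> T"
      using inv[OF l] mon_pos[of "lookup s l" l] mon_neg[of "lookup s l" l]
      by (cases "lookup s l \<ge> 0") (auto simp: h_pow is_subring_power[OF T])
  next
    fix j assume j: "j \<in> E"
    let ?a = "lookup s j"
    \<comment> \<open>\<open>g j\<close> is itself a product of two generators, which covers the
      powers of \<open>g j\<close> beyond the pole order.\<close>
    have "g j = mon (single j 1) * (mon (single j (-1)) * g j)"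
      by (simp add: mult_single flip: mult.assoc single_add)
    then have "h (g j) = h (mon (single j 1)) * h (mon (single j (-1)) * g j)"
      using h_mult by metis
    then have gT: "h (g j) \<in> T" using exch[OF j] by (simp add: is_subringD(6)[OF T])
    show "h (mon (single j ?a) * g j ^ w j) \<in> T"
    proof (cases "?a \<ge> 0")
      case True
      then show ?thesis using exch[OF j] gT
        by (simp add: mon_pos[of ?a j] h_mult h_pow is_subringD(6)[OF T] is_subring_power[OF T])
    next
      case False
      then have "mon (single j ?a) * g j ^ w j =
          (mon (single j (-1)) * g j) ^ nat (- ?a) * g j ^ (w j - nat (- ?a))"
        using step(4)[OF j] by (simp add: mon_neg[of ?a j] power_mult_distrib mult.assoc flip: power_add)
      then show ?thesis using exch[OF j] gT
        by (simp add: h_mult[of "_ ^ _" "_ ^ _"] h_pow is_subringD(6)[OF T] is_subring_power[OF T])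
    qed
  qed
  finally show ?case using step by (simp add: h_add is_subringD(5)[OF T])
qed

section \<open>Exchange polynomials as Laurent polynomials\<close>

definition expvec :: "nat set \<Rightarrow> (nat \<Rightarrow> int) \<Rightarrow> (nat \<Rightarrow>\<^sub>0 int)" where
  "expvec I v = (\<Sum>k\<in>I. single k (v k))"

lemma lookup_expvec: "finite I \<Longrightarrow> lookup (expvec I v) k = (if k \<in> I then v k else 0)"
  by (auto simp: expvec_def lookup_sum lookup_single when_def)

lemma keys_expvec: "finite I \<Longrightarrow> keys (expvec I v) \<subseteq> I"
  by (auto simp: in_keys_iff lookup_expvec split: if_splits)

definition posvec :: "nat set \<Rightarrow> (nat \<Rightarrow> nat \<Rightarrow> int) \<Rightarrow> nat \<Rightarrow> (nat \<Rightarrow>\<^sub>0 int)" where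
  "posvec I b j = expvec I (\<lambda>k. max 0 (b k j))"

definition negvec :: "nat set \<Rightarrow> (nat \<Rightarrow> nat \<Rightarrow> int) \<Rightarrow> nat \<Rightarrow> (nat \<Rightarrow>\<^sub>0 int)" where
  "negvec I b j = expvec I (\<lambda>k. max 0 (- b k j))"

text \<open>The exchange polynomial in which the variables with index in \<open>Z\<close> are set to \<open>0\<close>,
  provided that they occur at most in its first monomial.\<close>

definition exch_at :: "nat set \<Rightarrow> (nat \<Rightarrow> nat \<Rightarrow> int) \<Rightarrow> nat set \<Rightarrow> nat \<Rightarrow> 'a::comm_ring_1 laurent" where
  "exch_at I b Z j = (if \<exists>z\<in>Z. b z j > 0 then 0 else mon (posvec I b j)) + mon (negvec I b j)"

definition exch :: "nat set \<Rightarrow> (nat \<Rightarrow> nat \<Rightarrow> int) \<Rightarrow> nat \<Rightarrow> 'a::comm_ring_1 laurent" where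
  "exch I b j = mon (posvec I b j) + mon (negvec I b j)"

lemma exch_at_empty: "exch_at I b {} = exch I b"
  by (auto simp: exch_at_def exch_def)

text \<open>Only the sign pattern of skew-symmetrizability; it is inherited by subsets of indices
  and does not refer to a symmetrizer.\<close>

definition skew_signs :: "(nat \<Rightarrow> nat \<Rightarrow> int) \<Rightarrow> nat set \<Rightarrow> bool" where
  "skew_signs b E \<longleftrightarrow> (\<forall>i\<in>E. \<forall>j\<in>E. sgn (b i j) = - sgn (b j i))"

text \<open>Acyclicity in the form used for induction: every nonempty subset has a source
  \<open>e\<close>, as \<open>b j e \<le> 0\<close> excludes an edge from \<open>j\<close> to
  \<open>e\<close>.\<close>

definition acyclic_on :: "(nat \<Rightarrow> nat \<Rightarrow> int) \<Rightarrow> nat set \<Rightarrow> bool" where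
  "acyclic_on b E \<longleftrightarrow> (\<forall>D\<subseteq>E. D \<noteq> {} \<longrightarrow> (\<exists>e\<in>D. \<forall>j\<in>D. b j e \<le> 0))"

text \<open>Coprimality as cancellation: \<open>f_j\<close> is not a zero divisor modulo
  \<open>f_i\<close>. In this form it needs neither gcds nor factoriality of the Laurent
  ring.\<close>

definition coprime_exch :: "'a::comm_ring_1 set \<Rightarrow> nat set \<Rightarrow> (nat \<Rightarrow> nat \<Rightarrow> int) \<Rightarrow> nat set \<Rightarrow> bool" where
  "coprime_exch K I b E \<longleftrightarrow> (\<forall>i\<in>E. \<forall>j\<in>E. i \<noteq> j \<longrightarrow> (\<forall>g\<in>lau K I.
     dvd_in (lau K I) (exch I b i) (exch I b j * g) \<longrightarrow> dvd_in (lau K I) (exch I b i) g))"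

lemma skew_signs_subset: "skew_signs b E \<Longrightarrow> D \<subseteq> E \<Longrightarrow> skew_signs b D"
  by (auto simp: skew_signs_def)

lemma acyclic_on_subset: "acyclic_on b E \<Longrightarrow> D \<subseteq> E \<Longrightarrow> acyclic_on b D"
  by (simp add: acyclic_on_def)

lemma acyclic_on_source:
  assumes "acyclic_on b E" "E \<noteq> {}"
  obtains e where "e \<in> E" "\<And>j. j \<in> E \<Longrightarrow> b j e \<le> 0"
proof -
  have "\<exists>e\<in>E. \<forall>j\<in>E. b j e \<le> 0"
    using assms(1)[unfolded acyclic_on_def, rule_format, OF order_refl assms(2)] .
  then show thesis using that by auto
qed

lemma coprime_exch_subset: "coprime_exch K I b E \<Longrightarrow> D \<subseteq> E \<Longrightarrow> coprime_exch K I b D"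
  unfolding coprime_exch_def by blast

lemma skew_signsD: "skew_signs b E \<Longrightarrow> i \<in> E \<Longrightarrow> j \<in> E \<Longrightarrow> sgn (b i j) = - sgn (b j i)"
  unfolding skew_signs_def by blast

lemma skew_signs_diag: "skew_signs b E \<Longrightarrow> j \<in> E \<Longrightarrow> b j j = 0"
  using skew_signsD[of b E j j] by (auto simp: sgn_if split: if_splits)

lemma skew_signs_nonneg: "skew_signs b E \<Longrightarrow> i \<in> E \<Longrightarrow> j \<in> E \<Longrightarrow> b j i \<le> 0 \<Longrightarrow> 0 \<le> b i j"
  using skew_signsD[of b E i j] by (auto simp: sgn_if split: if_splits)

lemma skew_signs_zero: "skew_signs b E \<Longrightarrow> i \<in> E \<Longrightarrow> j \<in> E \<Longrightarrow> b j i = 0 \<longleftrightarrow> b i j = 0"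
  using skew_signsD[of b E i j] by (auto simp: sgn_if split: if_splits)

text \<open>The coefficient at the second monomial is 1, or 2 if both monomials coincide;
  characteristic 0 keeps it from vanishing.\<close>

lemma exch_at_neq_0:
  assumes "finite I"
  shows "exch_at I b Z j \<noteq> (0 :: 'a::{idom,ring_char_0} laurent)"
proof -
  have "lookup (exch_at I b Z j :: 'a laurent) (negvec I b j) \<in> {1, 2}"
    by (auto simp: exch_at_def lookup_add lookup_single when_def)
  then show ?thesis by auto
qed

lemma exch_neq_0: "finite I \<Longrightarrow> exch I b j \<noteq> (0 :: 'a::{idom,ring_char_0} laurent)"
  using exch_at_neq_0[of I b "{}" j] by (simp add: exch_at_empty)

lemma exch_at_keys:
  "e \<in> keys (exch_at I b Z j :: 'a::comm_ring_1 laurent) \<Longrightarrow>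
    (e = posvec I b j \<and> \<not> (\<exists>z\<in>Z. b z j > 0)) \<or> e = negvec I b j"
  using keys_add[of "if \<exists>z\<in>Z. b z j > 0 then 0 else mon (posvec I b j) :: 'a laurent" "mon (negvec I b j)"]
  by (auto simp: exch_at_def split: if_splits)

lemma exch_keys:
  "e \<in> keys (exch I b j :: 'a::comm_ring_1 laurent) \<Longrightarrow> e = posvec I b j \<or> e = negvec I b j"
  using exch_at_keys[of e I b "{}" j] by (auto simp: exch_at_empty)

lemma lookup_posvec: "finite I \<Longrightarrow> lookup (posvec I b j) k = (if k \<in> I then max 0 (b k j) else 0)"
  by (simp add: posvec_def lookup_expvec)

lemma lookup_negvec: "finite I \<Longrightarrow> lookup (negvec I b j) k = (if k \<in> I then max 0 (- b k j) else 0)"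
  by (simp add: negvec_def lookup_expvec)

lemma keys_posvec: "finite I \<Longrightarrow> keys (posvec I b j) \<subseteq> I"
  by (simp add: posvec_def keys_expvec)

lemma keys_negvec: "finite I \<Longrightarrow> keys (negvec I b j) \<subseteq> I"
  by (simp add: negvec_def keys_expvec)

lemma exch_at_nonneg: "finite I \<Longrightarrow> e \<in> keys (exch_at I b Z j :: 'a::comm_ring_1 laurent) \<Longrightarrow> 0 \<le> lookup e k"
  by (drule exch_at_keys) (auto simp: lookup_posvec lookup_negvec)

lemma exch_nonneg: "finite I \<Longrightarrow> e \<in> keys (exch I b j :: 'a::comm_ring_1 laurent) \<Longrightarrow> 0 \<le> lookup e k"
  using exch_at_nonneg[of I e b "{}" j k] by (simp add: exch_at_empty)

lemma exch_homogeneous: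
  "finite I \<Longrightarrow> b k j = 0 \<Longrightarrow> e \<in> keys (exch I b j :: 'a::comm_ring_1 laurent) \<Longrightarrow> lookup e k = 0"
  by (drule exch_keys) (auto simp: lookup_posvec lookup_negvec)

lemma exch_at_lower_alg:
  assumes "is_subring K" "finite I"
  shows "exch_at I b Z j \<in> lower_alg K I E g"
  unfolding exch_at_def using assms
  by (auto intro!: lower_alg_add lower_alg_single lower_alg.zero simp: is_subringD lookup_posvec lookup_negvec
      dest: keys_posvec[THEN subsetD] keys_negvec[THEN subsetD])

lemma exch_lower_alg: "is_subring K \<Longrightarrow> finite I \<Longrightarrow> exch I b j \<in> lower_alg K I E g"
  using exch_at_lower_alg[of K I b "{}" j] by (simp add: exch_at_empty)

lemma exch_at_lau:
  assumes K: "is_subring K" and I: "finite I"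
  shows "exch_at I b Z j \<in> lau K I"
proof -
  note S = is_subring_lau[OF K, of I]
  show ?thesis unfolding exch_at_def
    by (intro is_subringD(5)[OF S])
      (auto simp: is_subringD(2)[OF S] intro!: mon_lau K keys_posvec keys_negvec I)
qed

lemma exch_lau: "is_subring K \<Longrightarrow> finite I \<Longrightarrow> exch I b j \<in> lau K I"
  using exch_at_lau[of K I b "{}" j] by (simp add: exch_at_empty)

section \<open>Linear independence of the standard elements\<close>

text \<open>A combination of standard monomials: a negative exponent of \<open>x_j\<close> comes
  with just as many factors \<open>g j\<close>, so \<open>x_j\<close> and \<open>g j / x_j\<close>
  never occur together.\<close>

definition std_comb :: "(nat \<Rightarrow> 'a::comm_ring_1 laurent) \<Rightarrow> nat set \<Rightarrow> 'a laurent \<Rightarrow> 'a laurent" where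
  "std_comb g E c = (\<Sum>s\<in>keys c. single s (lookup c s) * (\<Prod>j\<in>E. g j ^ nat (- lookup s j)))"

lemma std_comb_superset:
  assumes "finite A" "keys c \<subseteq> A"
  shows "std_comb g E c = (\<Sum>s\<in>A. single s (lookup c s) * (\<Prod>j\<in>E. g j ^ nat (- lookup s j)))"
  unfolding std_comb_def using assms
  by (intro sum.mono_neutral_left) (auto simp: in_keys_iff)

lemma std_comb_add: "std_comb g E (c + d) = std_comb g E c + std_comb g E d"
proof -
  let ?A = "keys c \<union> keys d"
  have "std_comb g E (c + d) = (\<Sum>s\<in>?A. single s (lookup (c + d) s) * (\<Prod>j\<in>E. g j ^ nat (- lookup s j)))"
    by (rule std_comb_superset) (simp_all add: keys_add)
  also have "\<dots> = (\<Sum>s\<in>?A. single s (lookup c s) * (\<Prod>j\<in>E. g j ^ nat (- lookup s j)))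
      + (\<Sum>s\<in>?A. single s (lookup d s) * (\<Prod>j\<in>E. g j ^ nat (- lookup s j)))"
    by (simp add: lookup_add single_add distrib_right sum.distrib)
  also have "\<dots> = std_comb g E c + std_comb g E d"
    by (subst (1 2) std_comb_superset[of ?A]) auto
  finally show ?thesis .
qed

lemma std_comb_single: "std_comb g E (single s c) = single s c * (\<Prod>j\<in>E. g j ^ nat (- lookup s j))"
  using std_comb_superset[of "{s}" "single s c" g E] by simp

text \<open>The part of degree 0 is the substitution \<open>x_i = 0\<close>, which is multiplicative
  on elements without negative powers of \<open>x_i\<close>.\<close>

lemma part_0_mult_nonneg:
  fixes p q :: "'a::comm_ring_1 laurent"
  assumes "\<And>e. e \<in> keys p \<Longrightarrow> 0 \<le> lookup e i" "\<And>e. e \<in> keys q \<Longrightarrow> 0 \<le> lookup e i"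
  shows "part (deg i) 0 (p * q) = part (deg i) 0 p * part (deg i) 0 q"
  using part_mult_lowest[OF additive_deg, of p 0 i q 0] assms by auto

lemma keys_mult_nonneg:
  fixes p q :: "'a::comm_ring_1 laurent"
  assumes "\<And>e. e \<in> keys p \<Longrightarrow> 0 \<le> lookup e i" "\<And>e. e \<in> keys q \<Longrightarrow> 0 \<le> lookup e i"
    "e \<in> keys (p * q)"
  shows "0 \<le> lookup e i"
  using keys_mult_ge[OF additive_deg, of p 0 i q 0 e] assms by auto

lemma part_0_one [simp]: "part (deg i) 0 1 = (1 :: 'a::comm_ring_1 laurent)"
  using part_single[of "deg i" 0 0 "1::'a"] by simp

lemma keys_prod_power_nonneg:
  fixes g :: "nat \<Rightarrow> 'a::comm_ring_1 laurent"
  assumes "\<And>j e. j \<in> E \<Longrightarrow> e \<in> keys (g j) \<Longrightarrow> 0 \<le> lookup e i" "e \<in> keys (\<Prod>j\<in>E. g j ^ w j)"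
  shows "0 \<le> lookup e i"
proof -
  have pow: "0 \<le> lookup e i" if "j \<in> E" "e \<in> keys (g j ^ k)" for j k e
    using that(2)
  proof (induction k arbitrary: e)
    case (Suc k)
    then show ?case using assms(1)[OF that(1)] keys_mult_nonneg[of "g j" i "g j ^ k" e] by auto
  qed simp
  show ?thesis using assms(2) pow
  proof (induction E arbitrary: e rule: infinite_finite_induct)
    case (insert j E)
    then show ?case using keys_mult_nonneg[of "g j ^ w j" i "\<Prod>j\<in>E. g j ^ w j" e] by auto
  qed auto
qed

lemma part_0_prod_power:
  fixes g :: "nat \<Rightarrow> 'a::comm_ring_1 laurent"
  assumes "\<And>j e. j \<in> E \<Longrightarrow> e \<in> keys (g j) \<Longrightarrow> 0 \<le> lookup e i"
  shows "part (deg i) 0 (\<Prod>j\<in>E. g j ^ w j) = (\<Prod>j\<in>E. part (deg i) 0 (g j) ^ w j)"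
proof -
  have pow: "part (deg i) 0 (g j ^ k) = part (deg i) 0 (g j) ^ k" if "j \<in> E" for j k
  proof (induction k)
    case (Suc k)
    have "e \<in> keys (g j ^ k) \<Longrightarrow> 0 \<le> lookup e i" for e
      using keys_prod_power_nonneg[of "{j}" g i e "\<lambda>_. k"] assms that by auto
    then show ?case using Suc part_0_mult_nonneg[of "g j" i "g j ^ k"] assms[OF that] by auto
  qed simp
  show ?thesis using assms pow
  proof (induction E rule: infinite_finite_induct)
    case (insert j E)
    have "0 \<le> lookup e i" if "e \<in> keys (g j ^ w j)" for e
      using keys_prod_power_nonneg[of "{j}" g i e w] insert.prems(1)[of j] that by auto
    moreover have "0 \<le> lookup e i" if "e \<in> keys (\<Prod>j\<in>E. g j ^ w j)" for e
      using keys_prod_power_nonneg[of E g i e w] insert.prems(1) that by auto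
    moreover have "part (deg i) 0 (\<Prod>j\<in>E. g j ^ w j) = (\<Prod>j\<in>E. part (deg i) 0 (g j) ^ w j)"
      by (rule insert.IH) (use insert.prems in blast)+
    ultimately show ?case
      using insert part_0_mult_nonneg[of "g j ^ w j" i "\<Prod>j\<in>E. g j ^ w j"] by auto
  qed auto
qed

text \<open>Because \<open>0 \<le> b e j\<close>, the variable \<open>x_e\<close> can only occur in
  the first monomial, the one that \<open>exch_at\<close> drops.\<close>

lemma part_0_exch_at:
  assumes "finite I" "e \<in> I" "0 \<le> b e j"
  shows "part (deg e) 0 (exch_at I b Z j) = (exch_at I b (insert e Z) j :: 'a::comm_ring_1 laurent)"
  using assms by (auto simp: exch_at_def part_add part_single lookup_posvec lookup_negvec)

text \<open>Induction over \<open>E\<close>, removing a source \<open>e\<close>. The part of lowest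
  degree \<open>a\<close> in \<open>x_e\<close> sets \<open>x_e = 0\<close> in every
  \<open>g j\<close>, and \<open>g e\<close> does not involve \<open>x_e\<close>, so
  \<open>g e ^ nat (- a)\<close> comes out as a common factor and leaves a combination over
  \<open>E - {e}\<close>. The set \<open>Z\<close> of variables already put to 0 is general because
  the induction enlarges it.\<close>

lemma std_comb_eq_0:
  fixes c :: "'a::{idom,ring_char_0} laurent"
  assumes "finite I" "E \<subseteq> I" "skew_signs b E" "acyclic_on b E"
    and "std_comb (exch_at I b Z) E c = 0"
  shows "c = 0"
proof -
  have "finite E" by (rule finite_subset[OF assms(2,1)])
  then show ?thesis using assms
  proof (induction "card E" arbitrary: E Z c)
    case 0
    have "E = {}" using 0(1,2) by simp
    then have "std_comb (exch_at I b Z) E c = c"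
      using laurent_sum_single[of c, symmetric] by (simp add: std_comb_def)
    then show ?case using 0(7) by simp
  next
    case (Suc n)
    have "E \<noteq> {}" using Suc.hyps(2) by auto
    then obtain e where e: "e \<in> E" "\<And>j. j \<in> E \<Longrightarrow> b j e \<le> 0"
      using acyclic_on_source[OF \<open>acyclic_on b E\<close>] by metis
    have eI: "e \<in> I" using e Suc.prems by auto
    have bej: "0 \<le> b e j" if "j \<in> E" for j
      using skew_signs_nonneg[OF \<open>skew_signs b E\<close> e(1) that] e(2)[OF that] by simp
    have bee: "b e e = 0" using skew_signs_diag[OF \<open>skew_signs b E\<close> e(1)] .
    let ?g = "exch_at I b Z :: nat \<Rightarrow> 'a laurent" and ?g' = "exch_at I b (insert e Z) :: nat \<Rightarrow> 'a laurent"
    let ?E = "E - {e}"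
    have g'e: "?g' e = ?g e" by (simp add: exch_at_def bee)
    show ?case
    proof (rule ccontr)
      assume c: "c \<noteq> 0"
      define a where "a = Min (deg e ` keys c)"
      have ne: "deg e ` keys c \<noteq> {}" using c by simp
      have a_le: "a \<le> lookup s e" if "s \<in> keys c" for s
        using that by (auto simp: a_def)
      obtain s0 where s0: "s0 \<in> keys c" "lookup s0 e = a"
        using Min_in[OF _ ne] by (auto simp: a_def)
      have part_term: "part (deg e) a (single s k * (\<Prod>j\<in>E. ?g j ^ w j)) =
          (if lookup s e = a then single s k * (\<Prod>j\<in>E. ?g' j ^ w j) else 0)"
        if "a \<le> lookup s e" for s k w
      proof -
        have "part (deg e) a (single s k * (\<Prod>j\<in>E. ?g j ^ w j)) =
            single s k * part (deg e) (a - lookup s e) (\<Prod>j\<in>E. ?g j ^ w j)"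
          by (rule part_single_mult) simp
        also have "\<dots> = (if lookup s e = a then single s k * (\<Prod>j\<in>E. ?g' j ^ w j) else 0)"
        proof (cases "lookup s e = a")
          case True
          have "part (deg e) 0 (\<Prod>j\<in>E. ?g j ^ w j) = (\<Prod>j\<in>E. part (deg e) 0 (?g j) ^ w j)"
            by (rule part_0_prod_power) (use exch_at_nonneg[OF \<open>finite I\<close>] in blast)
          also have "\<dots> = (\<Prod>j\<in>E. ?g' j ^ w j)"
            by (rule prod.cong[OF HOL.refl]) (simp add: part_0_exch_at[OF \<open>finite I\<close> eI] bej)
          finally show ?thesis using True by simp
        next
          case False
          then have "a - lookup s e < 0" using that by simp
          moreover have "0 \<le> lookup u e" if "u \<in> keys (\<Prod>j\<in>E. ?g j ^ w j)" for u
            by (rule keys_prod_power_nonneg[OF _ that]) (use exch_at_nonneg[OF \<open>finite I\<close>] in blast)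
          ultimately have "part (deg e) (a - lookup s e) (\<Prod>j\<in>E. ?g j ^ w j) = 0"
            by (force simp: part_eq_0_iff)
          then show ?thesis using False by simp
        qed
        finally show ?thesis .
      qed
      let ?c = "part (deg e) a c"
      have "0 = part (deg e) a (std_comb ?g E c)" using Suc.prems by simp
      also have "\<dots> = (\<Sum>s\<in>keys c. if lookup s e = a
          then single s (lookup c s) * (\<Prod>j\<in>E. ?g' j ^ nat (- lookup s j)) else 0)"
        unfolding std_comb_def part_sum
        by (rule sum.cong[OF HOL.refl]) (rule part_term[OF a_le])
      also have "\<dots> = (\<Sum>s\<in>{s \<in> keys c. lookup s e = a}.
          single s (lookup c s) * (\<Prod>j\<in>E. ?g' j ^ nat (- lookup s j)))"
        by (rule sum.inter_filter[symmetric]) simp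
      also have "\<dots> = (\<Sum>s\<in>keys ?c. ?g e ^ nat (- a) *
          (single s (lookup ?c s) * (\<Prod>j\<in>?E. ?g' j ^ nat (- lookup s j))))"
      proof (rule sum.cong)
        fix s assume "s \<in> keys ?c"
        then have s: "lookup s e = a" "lookup ?c s = lookup c s"
          by (auto simp: keys_part lookup_part)
        have "(\<Prod>j\<in>E. ?g' j ^ nat (- lookup s j)) =
            ?g e ^ nat (- a) * (\<Prod>j\<in>?E. ?g' j ^ nat (- lookup s j))"
          using prod.remove[OF \<open>finite E\<close> e(1), of "\<lambda>j. ?g' j ^ nat (- lookup s j)"] s g'e by simp
        then show "single s (lookup c s) * (\<Prod>j\<in>E. ?g' j ^ nat (- lookup s j)) = ?g e ^ nat (- a) *
          (single s (lookup ?c s) * (\<Prod>j\<in>?E. ?g' j ^ nat (- lookup s j)))"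
          using s by (simp only: mult_ac)
      qed (auto simp: keys_part)
      also have "\<dots> = ?g e ^ nat (- a) * std_comb ?g' ?E ?c"
        by (simp add: std_comb_def sum_distrib_left)
      finally have "?g e ^ nat (- a) * std_comb ?g' ?E ?c = 0" by simp
      moreover have "?g e \<noteq> 0" by (rule exch_at_neq_0[OF \<open>finite I\<close>])
      ultimately have "std_comb ?g' ?E ?c = 0" by simp
      moreover have "n = card ?E" using Suc.hyps(2) e(1) \<open>finite E\<close> by simp
      moreover have "skew_signs b ?E" "acyclic_on b ?E"
        using Suc.prems skew_signs_subset[of b E ?E] acyclic_on_subset[of b E ?E] by auto
      moreover have "?E \<subseteq> I" "finite ?E" using Suc.prems by auto
      ultimately have "?c = 0"
        using Suc.hyps(1)[of ?E "insert e Z" ?c] \<open>finite I\<close> by blast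
      then show False using s0 by (auto simp: part_eq_0_iff)
    qed
  qed
qed

section \<open>Upper bound and lower bound agree for acyclic coprime seeds\<close>

lemma mon_power_obtain:
  obtains t where "(mon s :: 'a::comm_ring_1 laurent) ^ k = mon t" "\<And>j. lookup t j = int k * lookup s j"
proof -
  have "\<exists>t. (mon s :: 'a laurent) ^ k = mon t \<and> (\<forall>j. lookup t j = int k * lookup s j)"
  proof (induction k)
    case 0
    then show ?case by (intro exI[of _ 0]) simp
  next
    case (Suc k)
    then obtain t where "(mon s :: 'a laurent) ^ k = mon t" "\<forall>j. lookup t j = int k * lookup s j" by blast
    then show ?case
      by (intro exI[of _ "s + t"]) (auto simp: mult_single lookup_add algebra_simps)
  qed
  then show thesis using that by blast
qed

lemma prod_power_decrease:
  fixes h :: "nat \<Rightarrow> 'a::comm_monoid_mult"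
  assumes "finite E" "j \<in> E" "w j > 0"
  shows "(\<Prod>k\<in>E. h k ^ w k) = h j * (\<Prod>k\<in>E. h k ^ (w(j := w j - 1)) k)"
proof -
  have "(\<Prod>k\<in>E - {j}. h k ^ w k) = (\<Prod>k\<in>E - {j}. h k ^ (w(j := w j - 1)) k)"
    by (rule prod.cong) auto
  moreover have "h j ^ w j = h j * h j ^ (w j - 1)"
    using assms(3) by (cases "w j") auto
  ultimately show ?thesis
    using prod.remove[OF assms(1,2), of "\<lambda>k. h k ^ w k"]
      prod.remove[OF assms(1,2), of "\<lambda>k. h k ^ (w(j := w j - 1)) k"]
    by (simp add: mult.assoc)
qed

text \<open>No edge inside \<open>E\<close> ends in \<open>e\<close>: the first monomial of
  \<open>f e\<close> contains no variable from \<open>E\<close>, and \<open>x_e\<close> occurs in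
  the other \<open>f j\<close> only in the first monomial. So \<open>x_e = 0\<close> either erases
  the first monomial of \<open>f j\<close> or leaves \<open>f j\<close> unchanged.\<close>

locale source =
  fixes K :: "'a::{idom,ring_char_0} set" and I :: "nat set" and b :: "nat \<Rightarrow> nat \<Rightarrow> int"
    and E :: "nat set" and e :: nat
  assumes K: "is_subring K" and I: "finite I" and EI: "E \<subseteq> I"
    and skew: "skew_signs b E" and acyc: "acyclic_on b E"
    and e: "e \<in> E" and src: "\<And>j. j \<in> E \<Longrightarrow> b j e \<le> 0"
begin

abbreviation "f \<equiv> (exch I b :: nat \<Rightarrow> 'a laurent)"
abbreviation "f0 \<equiv> (exch_at I b {e} :: nat \<Rightarrow> 'a laurent)"
abbreviation "E' \<equiv> E - {e}"
abbreviation "xe \<equiv> (mon (single e 1) :: 'a laurent)"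
abbreviation "xe_inv \<equiv> (mon (single e (-1)) :: 'a laurent)"
abbreviation "Lau \<equiv> lau K I"
abbreviation "Low \<equiv> lower_alg K I E f"

lemmas Lau = is_subring_lau[OF K, of I]
lemmas Low = is_subring_lower_alg[OF K, of I E f]

lemma finE: "finite E"
  by (rule finite_subset[OF EI I])

lemma eI: "e \<in> I"
  using e EI by auto

lemma row_e_nonneg: "j \<in> E \<Longrightarrow> 0 \<le> b e j"
  using skew_signs_nonneg[OF skew e] src by blast

lemma diag: "j \<in> E \<Longrightarrow> b j j = 0"
  using skew_signs_diag[OF skew] .

lemma xe_cancel [simp]: "xe * (xe_inv * p) = p" "xe_inv * (xe * p) = p" "xe * xe_inv = 1" "xe_inv * xe = 1"
  by (simp_all add: mult_single flip: mult.assoc single_add)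

lemma part_f: "j \<in> E \<Longrightarrow> part (deg e) 0 (f j) = f0 j"
  by (simp add: part_0_exch_at[OF I eI] row_e_nonneg flip: exch_at_empty)

lemma f_hom: "k \<in> E \<Longrightarrow> j \<in> E \<Longrightarrow> b k j = 0 \<Longrightarrow> part (deg k) a (f j * q) = f j * part (deg k) a q"
  using part_homogeneous_mult[OF additive_deg, of "f j" k 0 a q] exch_homogeneous[OF I, of b k j] by auto

lemma f_pow_hom: "k \<in> E \<Longrightarrow> j \<in> E \<Longrightarrow> b k j = 0 \<Longrightarrow> part (deg k) a (f j ^ m * q) = f j ^ m * part (deg k) a q"
  by (induction m) (simp_all add: f_hom mult.assoc)

section \<open>Elements without a pole at \<open>x_e\<close>, and their values at
  \<open>x_e = 0\<close>\<close>

lemma single_prod_Low: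
  assumes "c \<in> K" "keys s \<subseteq> I" "0 \<le> lookup s e" "\<And>j. j \<in> E' \<Longrightarrow> nat (- lookup s j) \<le> w j"
  shows "single s c * (\<Prod>j\<in>E'. f j ^ w j) \<in> Low"
proof -
  have "single s c * (\<Prod>j\<in>E. f j ^ (w(e := 0)) j) \<in> Low"
    using assms by (intro lower_alg_term) auto
  also have "(\<Prod>j\<in>E. f j ^ (w(e := 0)) j) = (\<Prod>j\<in>E'. f j ^ w j)"
    using prod.remove[OF finE e, of "\<lambda>j. f j ^ (w(e := 0)) j"] by simp
  finally show ?thesis .
qed

text \<open>Pairs consisting of an element not involving \<open>x\<^sub>e\<close> except through the \<open>f\<^sub>j\<close>, and its
  value at \<open>x\<^sub>e = 0\<close>, both written with the same coefficients.\<close>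

inductive lift_rel :: "'a laurent \<Rightarrow> 'a laurent \<Rightarrow> bool" where
  zero: "lift_rel 0 0"
| step: "lift_rel p p0 \<Longrightarrow> c \<in> K \<Longrightarrow> keys s \<subseteq> I \<Longrightarrow> lookup s e = 0 \<Longrightarrow>
    (\<And>j. j \<in> E' \<Longrightarrow> nat (- lookup s j) \<le> w j) \<Longrightarrow>
    lift_rel (single s c * (\<Prod>j\<in>E'. f j ^ w j) + p) (single s c * (\<Prod>j\<in>E'. f0 j ^ w j) + p0)"

lemma lift_term:
  "c \<in> K \<Longrightarrow> keys s \<subseteq> I \<Longrightarrow> lookup s e = 0 \<Longrightarrow>
    (\<And>j. j \<in> E' \<Longrightarrow> nat (- lookup s j) \<le> w j) \<Longrightarrow>
    lift_rel (single s c * (\<Prod>j\<in>E'. f j ^ w j)) (single s c * (\<Prod>j\<in>E'. f0 j ^ w j))"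
  using lift_rel.step[OF lift_rel.zero, of c s w] by simp

lemma lift_add: "lift_rel p p0 \<Longrightarrow> lift_rel q q0 \<Longrightarrow> lift_rel (p + q) (p0 + q0)"
  by (induction rule: lift_rel.induct) (auto simp: add.assoc intro!: lift_rel.step)

lemma lift_single_mult:
  assumes "lift_rel p p0" "c \<in> K" "keys t \<subseteq> I" "lookup t e = 0" "\<And>j. j \<in> E' \<Longrightarrow> 0 \<le> lookup t j"
  shows "lift_rel (single t c * p) (single t c * p0)"
  using assms(1)
proof induction
  case (step p p0 c' s w)
  have "lift_rel (single (t + s) (c * c') * (\<Prod>j\<in>E'. f j ^ w j)) (single (t + s) (c * c') * (\<Prod>j\<in>E'. f0 j ^ w j))"
  proof (rule lift_term)
    show "keys (t + s) \<subseteq> I" using assms(3) step(3) by (rule keys_plus_subset)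
    show "nat (- lookup (t + s) j) \<le> w j" if "j \<in> E'" for j
      using assms(5)[OF that] step(5)[OF that] by (simp add: lookup_add)
  qed (use assms step K in \<open>auto simp: is_subringD lookup_add\<close>)
  from lift_add[OF this step(6)] show ?case
    by (simp only: distrib_left mult.assoc[symmetric] mult_single)
qed (simp add: lift_rel.zero)

lemma lift_diff:
  assumes "lift_rel p p0" "lift_rel q q0"
  shows "lift_rel (p - q) (p0 - q0)"
proof -
  have "- 1 \<in> K" using K by (simp add: is_subringD)
  then have "lift_rel (single 0 (- 1) * q) (single 0 (- 1) * q0)"
    by (intro lift_single_mult assms) auto
  from lift_add[OF assms(1) this] show ?thesis by (simp add: single_uminus)
qed

lemma lift_Low: "lift_rel p p0 \<Longrightarrow> p \<in> Low"
proof (induction rule: lift_rel.induct)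
  case (step p p0 c s w)
  then show ?case by (intro lower_alg_add single_prod_Low) auto
qed (rule lower_alg.zero)

lemma lift_part: "lift_rel p p0 \<Longrightarrow> part (deg e) 0 p = p0 \<and> (\<forall>u\<in>keys p. 0 \<le> lookup u e)"
proof (induction rule: lift_rel.induct)
  case (step p p0 c s w)
  have prod: "part (deg e) 0 (\<Prod>j\<in>E'. f j ^ w j) = (\<Prod>j\<in>E'. f0 j ^ w j)"
  proof -
    have "part (deg e) 0 (\<Prod>j\<in>E'. f j ^ w j) = (\<Prod>j\<in>E'. part (deg e) 0 (f j) ^ w j)"
      by (rule part_0_prod_power) (rule exch_nonneg[OF I])
    also have "\<dots> = (\<Prod>j\<in>E'. f0 j ^ w j)"
      by (rule prod.cong) (simp_all add: part_f)
    finally show ?thesis .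
  qed
  have nonneg: "0 \<le> lookup u e" if "u \<in> keys (single s c * (\<Prod>j\<in>E'. f j ^ w j))" for u
  proof (rule keys_mult_nonneg[OF _ _ that])
    show "0 \<le> lookup u e" if "u \<in> keys (single s c)" for u
      using that step(4) by (auto split: if_splits)
    show "0 \<le> lookup u e" if "u \<in> keys (\<Prod>j\<in>E'. f j ^ w j)" for u
      by (rule keys_prod_power_nonneg[OF _ that]) (rule exch_nonneg[OF I])
  qed
  show ?case
    using step nonneg keys_add[of "single s c * (\<Prod>j\<in>E'. f j ^ w j)" p]
    by (auto simp: part_add part_single_mult prod)
qed simp

lemma posvec_e: "j \<in> E \<Longrightarrow> lookup (posvec I b e) j = 0"
  using src EI by (auto simp: lookup_posvec[OF I])

lemma negvec_e: "j \<in> E \<Longrightarrow> lookup (negvec I b e) j = - b j e"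
  using src[of j] EI by (auto simp: lookup_negvec[OF I])

text \<open>Both monomials of \<open>f e\<close> are free of \<open>x_e\<close> and have no negative
  exponents, so each acts on the two members of the pair by the same shift of exponents.\<close>

lemma lift_f:
  assumes "lift_rel p p0"
  shows "lift_rel (f e * p) (f e * p0)"
proof -
  have "lift_rel (mon (posvec I b e) * p) (mon (posvec I b e) * p0)"
    using posvec_e e K by (intro lift_single_mult assms keys_posvec I) (auto simp: is_subringD)
  moreover have "lift_rel (mon (negvec I b e) * p) (mon (negvec I b e) * p0)"
    using negvec_e e src diag K by (intro lift_single_mult assms keys_negvec I) (auto simp: is_subringD)
  ultimately show ?thesis unfolding exch_def distrib_right by (rule lift_add)
qed

text \<open>Straightening: a surplus factor \<open>f j\<close> is expanded into its two monomials,
  which lowers the sum of \<open>w\<close>. A first monomial containing \<open>x_e\<close> goes into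
  the remainder \<open>xe * l\<close> and vanishes at \<open>x_e = 0\<close>; everything else
  happens identically for \<open>f\<close> and \<open>f0\<close>, so one family of coefficients
  \<open>d\<close> serves both.\<close>

lemma expand_term:
  assumes "c \<in> K" "keys s \<subseteq> I" "lookup s e = 0" "\<And>j. j \<in> E' \<Longrightarrow> nat (- lookup s j) \<le> w j"
  shows "\<exists>d l. l \<in> Low \<and> single s c * (\<Prod>j\<in>E'. f j ^ w j) = std_comb f E' d + xe * l \<and>
    single s c * (\<Prod>j\<in>E'. f0 j ^ w j) = std_comb f0 E' d"
  using assms(2-)
proof (induction "\<Sum>j\<in>E'. w j" arbitrary: s w rule: less_induct)
  case less
  show ?case
  proof (cases "\<forall>j\<in>E'. w j = nat (- lookup s j)")
    case True
    have "single s c * (\<Prod>j\<in>E'. h j ^ w j) = std_comb h E' (single s c)" for h :: "nat \<Rightarrow> 'a laurent"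
      unfolding std_comb_single using True by (intro arg_cong[where f = "\<lambda>p. _ * p"] prod.cong) auto
    then show ?thesis
      by (intro exI[of _ "single s c"] exI[of _ 0]) (simp add: lower_alg.zero)
  next
    case False
    then obtain j where j: "j \<in> E'" "nat (- lookup s j) < w j"
      using less.prems(3) by (metis le_neq_implies_less)
    define w' where "w' = w(j := w j - 1)"
    have finE': "finite E'" using finE by simp
    have jE: "j \<in> E" using j by simp
    have dec: "(\<Prod>k\<in>E'. h k ^ w k) = h j * (\<Prod>k\<in>E'. h k ^ w' k)" for h :: "nat \<Rightarrow> 'a laurent"
      unfolding w'_def by (rule prod_power_decrease[OF finE' j(1)]) (use j in simp)
    have "w' j < w j" using j by (simp add: w'_def)
    then have smaller: "sum w' E' < sum w E'"
      using sum_strict_mono_ex1[OF finE', of w' w] j(1) by (auto simp: w'_def)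
    have cond: "nat (- lookup (s + t) k) \<le> w' k" if "k \<in> E'" "\<And>k. 0 \<le> lookup t k" for k t
      using less.prems(3)[OF that(1)] j(2) that(2)[of k] by (auto simp: w'_def lookup_add)
    have keys: "keys (s + posvec I b j) \<subseteq> I" "keys (s + negvec I b j) \<subseteq> I"
      using less.prems(1) keys_posvec[OF I] keys_negvec[OF I] by (simp_all add: keys_plus_subset)
    have "lookup (s + negvec I b j) e = 0"
      using less.prems(2) row_e_nonneg[OF jE] by (simp add: lookup_add lookup_negvec[OF I])
    with less.hyps[OF smaller keys(2)] cond[of _ "negvec I b j"]
    obtain d2 l2 where neg: "l2 \<in> Low"
      "single (s + negvec I b j) c * (\<Prod>k\<in>E'. f k ^ w' k) = std_comb f E' d2 + xe * l2"
      "single (s + negvec I b j) c * (\<Prod>k\<in>E'. f0 k ^ w' k) = std_comb f0 E' d2"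
      by (auto simp: lookup_negvec[OF I])
    have split: "single s c * (mon u * p) = single (s + u) c * p" for u and p :: "'a laurent"
      by (simp add: mult_single flip: mult.assoc)
    have f_expand: "single s c * (\<Prod>k\<in>E'. f k ^ w k) =
        single (s + posvec I b j) c * (\<Prod>k\<in>E'. f k ^ w' k) + single (s + negvec I b j) c * (\<Prod>k\<in>E'. f k ^ w' k)"
      unfolding dec exch_def[of I b j] distrib_right distrib_left split ..
    show ?thesis
    proof (cases "b e j > 0")
      case True
      \<comment> \<open>The first monomial of \<open>f j\<close> is divisible by \<open>x_e\<close>
        here; \<open>t\<close> is the exponent after splitting off one \<open>x_e\<close>.\<close>
      define t where "t = s + posvec I b j - single e 1"
      have f0_expand: "single s c * (\<Prod>k\<in>E'. f0 k ^ w k) = single (s + negvec I b j) c * (\<Prod>k\<in>E'. f0 k ^ w' k)"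
        unfolding dec using True by (simp add: exch_at_def[of I b _ j] split)
      have "single t c * (\<Prod>k\<in>E'. f k ^ w' k) \<in> Low"
      proof (rule single_prod_Low)
        show "keys t \<subseteq> I" unfolding t_def
          using keys(1) eI keys_diff[of "s + posvec I b j" "single e 1"] by auto
        show "0 \<le> lookup t e"
          using True less.prems(2) eI by (simp add: t_def lookup_minus lookup_add lookup_posvec[OF I])
        show "nat (- lookup t k) \<le> w' k" if "k \<in> E'" for k
          using cond[OF that, of "posvec I b j"] that
          by (simp add: t_def lookup_minus lookup_single lookup_posvec[OF I])
      qed (rule assms)
      then have "single t c * (\<Prod>k\<in>E'. f k ^ w' k) + l2 \<in> Low"
        using neg(1) by (rule lower_alg_add)
      moreover have "single (s + posvec I b j) c = xe * single t c"
        by (simp add: t_def mult_single)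
      ultimately show ?thesis
        using neg by (intro exI[of _ d2] exI[of _ "single t c * (\<Prod>k\<in>E'. f k ^ w' k) + l2"])
          (simp add: f_expand f0_expand algebra_simps)
    next
      case False
      then have bej: "b e j = 0" using row_e_nonneg[OF jE] by simp
      then have "lookup (s + posvec I b j) e = 0"
        using less.prems(2) by (simp add: lookup_add lookup_posvec[OF I])
      with less.hyps[OF smaller keys(1)] cond[of _ "posvec I b j"]
      obtain d1 l1 where pos: "l1 \<in> Low"
        "single (s + posvec I b j) c * (\<Prod>k\<in>E'. f k ^ w' k) = std_comb f E' d1 + xe * l1"
        "single (s + posvec I b j) c * (\<Prod>k\<in>E'. f0 k ^ w' k) = std_comb f0 E' d1"
        by (auto simp: lookup_posvec[OF I])
      have f0_expand: "single s c * (\<Prod>k\<in>E'. f0 k ^ w k) =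
          single (s + posvec I b j) c * (\<Prod>k\<in>E'. f0 k ^ w' k) + single (s + negvec I b j) c * (\<Prod>k\<in>E'. f0 k ^ w' k)"
        unfolding dec using bej by (simp add: exch_at_def[of I b _ j] distrib_left distrib_right split)
      show ?thesis
        using pos neg lower_alg_add[OF pos(1) neg(1)]
        by (intro exI[of _ "d1 + d2"] exI[of _ "l1 + l2"])
          (simp add: f_expand f0_expand std_comb_add algebra_simps)
    qed
  qed
qed

text \<open>The standard expansion of the value at \<open>x_e = 0\<close> vanishes, so its
  coefficients \<open>d\<close> are zero by linear independence. They are also the coefficients of
  \<open>p\<close>, so only the remainder \<open>xe * l\<close> is left.\<close>

lemma lift_rel_0:
  assumes "lift_rel p 0"
  shows "\<exists>l\<in>Low. p = xe * l"
proof -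
  have "\<exists>d l. l \<in> Low \<and> p = std_comb f E' d + xe * l \<and> p0 = std_comb f0 E' d" if "lift_rel p p0" for p p0
    using that
  proof induction
    case zero
    then show ?case by (intro exI[of _ 0]) (simp add: std_comb_def lower_alg.zero)
  next
    case (step p p0 c s w)
    obtain d1 l1 where 1: "l1 \<in> Low" "single s c * (\<Prod>j\<in>E'. f j ^ w j) = std_comb f E' d1 + xe * l1"
      "single s c * (\<Prod>j\<in>E'. f0 j ^ w j) = std_comb f0 E' d1"
      using expand_term[OF step(2-5)] by blast
    obtain d2 l2 where 2: "l2 \<in> Low" "p = std_comb f E' d2 + xe * l2" "p0 = std_comb f0 E' d2"
      using step(6) by blast
    show ?case
      by (intro exI[of _ "d1 + d2"] exI[of _ "l1 + l2"])
        (simp add: 1 2 lower_alg_add std_comb_add algebra_simps)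
  qed
  from this[OF assms] obtain d l where l: "l \<in> Low" "p = std_comb f E' d + xe * l" "std_comb f0 E' d = 0"
    by metis
  have "d = 0"
    by (rule std_comb_eq_0[OF I _ skew_signs_subset[OF skew] acyclic_on_subset[OF acyc] l(3)]) (use EI in auto)
  then show ?thesis using l by (auto simp: std_comb_def)
qed

text \<open>For a non-neighbour \<open>j\<close> of \<open>e\<close>, setting \<open>x_e = 0\<close>
  does not change \<open>f j\<close>, so the pole condition at \<open>j\<close> survives.\<close>

lemma lift_single_lower:
  assumes "lift_rel p p0" "j \<in> E'" "b j e = 0"
  shows "p0 \<in> lower_alg K I {j} f"
proof -
  note S = is_subring_lower_alg[OF K, of I "{j}" f]
  have "f0 j = f j"
    using skew_signs_zero[OF skew e, of j] assms by (auto simp: exch_at_def exch_def)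
  show ?thesis using assms(1)
  proof induction
    case (step p p0 c s w)
    have "(\<Prod>k\<in>E'. f0 k ^ w k) = f j ^ w j * (\<Prod>k\<in>E' - {j}. f0 k ^ w k)"
      using prod.remove[of E' j "\<lambda>k. f0 k ^ w k"] finE assms(2) \<open>f0 j = f j\<close> by simp
    then have eq: "single s c * (\<Prod>k\<in>E'. f0 k ^ w k) =
        single s c * (\<Prod>k\<in>{j}. f k ^ w k) * (\<Prod>k\<in>E' - {j}. f0 k ^ w k)"
      by (simp add: mult_ac)
    have "single s c * (\<Prod>k\<in>{j}. f k ^ w k) * (\<Prod>k\<in>E' - {j}. f0 k ^ w k) \<in> lower_alg K I {j} f"
      using step assms(2)
      by (intro is_subringD(6)[OF S] is_subring_prod[OF S] is_subring_power[OF S] lower_alg_term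
          exch_at_lower_alg K I) auto
    then show ?case unfolding eq using step(6) by (rule lower_alg_add)
  qed (rule lower_alg.zero)
qed

text \<open>Coprimality yields one factor \<open>f i\<close> of \<open>q\<close> at a time; it is
  cancelled on both sides before the next one is extracted.\<close>

lemma coprime_power:
  assumes "coprime_exch K I b E" "i \<in> E" "j \<in> E" "i \<noteq> j" "q \<in> Lau"
    "dvd_in Lau (f i ^ k) (f j * q)"
  shows "dvd_in Lau (f i ^ k) q"
  using assms(5,6)
proof (induction k arbitrary: q)
  case 0
  then show ?case by (auto intro: dvd_inI)
next
  case (Suc k)
  have "dvd_in Lau (f i) (f i ^ Suc k)"
    by (rule dvd_inI[of "f i ^ k"]) (auto intro!: is_subring_power[OF Lau] exch_lau K I)
  then have "dvd_in Lau (f i) (f j * q)"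
    using Suc dvd_in_trans[OF Lau] by blast
  then obtain q' where q': "q' \<in> Lau" "q = f i * q'"
    using assms(1-4) Suc.prems(1) unfolding coprime_exch_def dvd_in_def by blast
  have "dvd_in Lau (f i * f i ^ k) (f i * (f j * q'))"
    using Suc.prems(2) q' by (simp add: mult_ac)
  then have "dvd_in Lau (f i ^ k) (f j * q')"
    by (rule dvd_in_cancel) (rule exch_neq_0[OF I])
  from Suc.IH[OF q'(1) this] show ?case
    unfolding q'(2) power_Suc by (intro dvd_in_mult_mono Lau dvd_in_refl)
qed

text \<open>The quotient \<open>q\<close> is first controlled where the neighbours of \<open>e\<close> are inverted, by
  applying the theorem to the non-neighbours; a neighbour \<open>x\<^sub>j\<close> then cancels because the second
  monomial of \<open>f\<^sub>e\<close> is divisible by it while the first one is a unit.\<close>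

lemma lift_quotient:
  assumes IH: "\<And>D p. D \<subset> E \<Longrightarrow> p \<in> Lau \<Longrightarrow> (\<And>j. j \<in> D \<Longrightarrow> p \<in> lower_alg K I {j} f) \<Longrightarrow> p \<in> lower_alg K I D f"
    and cop: "coprime_exch K I b E"
    and p: "lift_rel p (f e * q)" and q: "q \<in> Lau"
  shows "\<exists>r. lift_rel r (part (deg e) 0 q)"
proof -
  define q0 where "q0 = part (deg e) 0 q"
  define D where "D = {j \<in> E'. b j e = 0}"
  have q0: "q0 \<in> Lau" unfolding q0_def by (rule lau_part[OF K q])
  \<comment> \<open>\<open>f e * q\<close> is a value at \<open>x_e = 0\<close>, hence of degree 0
    in \<open>x_e\<close>, and so is \<open>f e\<close>; therefore \<open>q\<close> may be replaced
    by its part \<open>q0\<close> of degree 0.\<close>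
  have fq0: "f e * q0 = f e * q"
    using lift_part[OF p] f_hom[OF e e diag[OF e], of 0 q] f_hom[OF e e diag[OF e], of 0 q0]
    by (metis q0_def part_part)
  \<comment> \<open>At non-neighbours the pole condition passes from \<open>f e * q0\<close> to
    \<open>q0\<close>, since \<open>f e\<close> does not involve \<open>x_j\<close> and is coprime
    to \<open>f j\<close>.\<close>
  have "q0 \<in> lower_alg K I {j} f" if "j \<in> D" for j
  proof -
    have j: "j \<in> E'" "b j e = 0" "j \<in> E" using that by (auto simp: D_def)
    have hom: "lookup u j = 0" if "u \<in> keys (f j)" for u
      by (rule exch_homogeneous[OF I _ that]) (rule diag[OF j(3)])
    note one_iff = lower_alg_one_iff[where g = f and j = j, OF K exch_lau[OF K I] hom]
    have "f e * q0 \<in> lower_alg K I {j} f"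
      unfolding fq0 by (rule lift_single_lower[OF p j(1,2)])
    then have "dvd_in Lau (f j ^ k) (part (deg j) (- int k) (f e * q0))" for k
      using one_iff by blast
    then have "dvd_in Lau (f j ^ k) (f e * part (deg j) (- int k) q0)" for k
      using f_hom[OF j(3) e j(2)] by simp
    then have "dvd_in Lau (f j ^ k) (part (deg j) (- int k) q0)" for k
      using coprime_power[OF cop j(3) e _ lau_part[OF K q0]] j(1) by auto
    then show ?thesis using one_iff q0 by blast
  qed
  moreover have "D \<subset> E" using e by (auto simp: D_def)
  ultimately have q0D: "q0 \<in> lower_alg K I D f"
    using IH q0 by blast
  \<comment> \<open>Within \<open>E\<close>, the second monomial of \<open>f e\<close> contains
    exactly the neighbours of \<open>e\<close>, so a high power of \<open>m\<close> clears all poles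
    at neighbours.\<close>
  define m where "m = (mon (negvec I b e) :: 'a laurent)"
  have m_mult: "\<exists>r. lift_rel r (m * p)" if ex: "\<exists>r. lift_rel r p" for p
  proof -
    obtain r where "lift_rel r p" using ex by blast
    then have "lift_rel (m * r) (m * p)" unfolding m_def
      using negvec_e e src diag K by (intro lift_single_mult keys_negvec I) (auto simp: is_subringD)
    then show ?thesis by blast
  qed
  have m_pow: "\<exists>r. lift_rel r (m ^ k * p)" if "\<exists>r. lift_rel r p" for p k
    using that by (induction k) (auto simp: mult.assoc intro!: m_mult)
  have "\<exists>k. \<exists>r. lift_rel r (m ^ k * part (deg e) 0 p)" if "p \<in> lower_alg K I D f" for p
    using that
  proof induction
    case zero
    then show ?case using lift_rel.zero by auto
  next
    case (step p c s w)
    obtain k2 r2 where r2: "lift_rel r2 (m ^ k2 * part (deg e) 0 p)" using step(5) by blast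
    have fD: "part (deg e) 0 (single s c * (\<Prod>j\<in>D. f j ^ w j)) =
        (if lookup s e = 0 then single s c * (\<Prod>j\<in>D. f j ^ w j) else 0)"
    proof -
      have D0: "b e j = 0" if "j \<in> D" for j
        using that skew_signs_zero[OF skew e, of j] by (auto simp: D_def)
      have "part (deg e) a ((\<Prod>j\<in>D. f j ^ w j) * q) = (\<Prod>j\<in>D. f j ^ w j) * part (deg e) a q" for a q
      proof -
        have "lookup u e = 0" if "u \<in> keys (\<Prod>j\<in>D. f j ^ w j)" for u
        proof -
          have "part (deg e) k ((\<Prod>j\<in>F. f j ^ w j) * q) = (\<Prod>j\<in>F. f j ^ w j) * part (deg e) k q"
            if "F \<subseteq> D" "finite F" for F k q
            using that(2,1)
            by (induction F arbitrary: q rule: finite_induct)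
              (auto simp: mult.assoc D_def f_pow_hom[OF e] D0)
          from this[of D "lookup u e" 1] finE have "part (deg e) (lookup u e) (\<Prod>j\<in>D. f j ^ w j)
              = (\<Prod>j\<in>D. f j ^ w j) * part (deg e) (lookup u e) 1"
            by (auto simp: D_def)
          moreover have "part (deg e) (lookup u e) (\<Prod>j\<in>D. f j ^ w j) \<noteq> 0"
            using that by (auto simp: part_eq_0_iff)
          ultimately have "part (deg e) (lookup u e) (1 :: 'a laurent) \<noteq> 0" by auto
          then show ?thesis
            using part_single[of "deg e" "lookup u e" 0 "1 :: 'a"] by (auto split: if_splits)
        qed
        then show ?thesis
          using part_homogeneous_mult[OF additive_deg, of "\<Prod>j\<in>D. f j ^ w j" e 0 a q] by auto
      qed
      then show ?thesis
        by (simp add: mult.commute[of "single s c"] part_single)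
    qed
    have "\<exists>k r. lift_rel r (m ^ k * part (deg e) 0 (single s c * (\<Prod>j\<in>D. f j ^ w j)))"
    proof (cases "lookup s e = 0")
      case False
      then show ?thesis using lift_rel.zero by (auto simp: fD)
    next
      case True
      \<comment> \<open>Large enough for all neighbours at once, as each of them occurs in
        \<open>m\<close> with exponent at least 1.\<close>
      define k where "k = (\<Sum>j\<in>E'. nat (- lookup s j))"
      obtain t where t: "m ^ k = mon t" "\<And>j. lookup t j = int k * lookup (negvec I b e) j"
        using mon_power_obtain unfolding m_def by blast
      define w' where "w' j = (if j \<in> D then w j else 0)" for j
      have "lift_rel (single (t + s) c * (\<Prod>j\<in>E'. f j ^ w' j)) (single (t + s) c * (\<Prod>j\<in>E'. f0 j ^ w' j))"
      proof (rule lift_term)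
        have "keys t \<subseteq> keys (negvec I b e)"
          by (auto simp: in_keys_iff t(2))
        then show "keys (t + s) \<subseteq> I"
          using keys_negvec[OF I, of b e] step(3) by (intro keys_plus_subset) auto
        show "lookup (t + s) e = 0"
          using True negvec_e[OF e] diag[OF e] by (simp add: lookup_add t(2))
        show "nat (- lookup (t + s) j) \<le> w' j" if j: "j \<in> E'" for j
        proof (cases "j \<in> D")
          case True
          then show ?thesis
            using step(4)[OF True] negvec_e[of j] j by (simp add: w'_def lookup_add t(2) D_def)
        next
          case False
          then have "b j e \<le> - 1" using src[of j] j by (auto simp: D_def)
          then have "1 \<le> lookup (negvec I b e) j" using negvec_e[of j] j by simp
          then have "int k \<le> int k * lookup (negvec I b e) j"
            by (metis mult.right_neutral mult_left_mono of_nat_0_le_iff)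
          moreover have "nat (- lookup s j) \<le> k"
            unfolding k_def using finE j by (intro member_le_sum) auto
          ultimately show ?thesis using False by (simp add: w'_def lookup_add t(2))
        qed
      qed (rule step)
      moreover have "(\<Prod>j\<in>E'. f0 j ^ w' j) = (\<Prod>j\<in>D. f j ^ w j)"
      proof -
        have "(\<Prod>j\<in>E'. f0 j ^ w' j) = (\<Prod>j\<in>D. f0 j ^ w' j)"
          using finE by (intro prod.mono_neutral_right) (auto simp: D_def w'_def)
        also have "\<dots> = (\<Prod>j\<in>D. f j ^ w j)"
        proof (rule prod.cong)
          fix j assume j: "j \<in> D"
          then have "b e j = 0" using skew_signs_zero[OF skew e, of j] by (auto simp: D_def)
          then show "f0 j ^ w' j = f j ^ w j" using j by (simp add: exch_at_def exch_def w'_def)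
        qed simp
        finally show ?thesis .
      qed
      moreover have "single (t + s) c * P = m ^ k * (single s c * P)" for P
        by (simp add: t(1) mult_single flip: mult.assoc)
      ultimately show ?thesis using True by (auto simp: fD)
    qed
    then obtain k1 r1 where r1: "lift_rel r1 (m ^ k1 * part (deg e) 0 (single s c * (\<Prod>j\<in>D. f j ^ w j)))"
      by blast
    obtain r1' where r1': "lift_rel r1' (m ^ k2 * (m ^ k1 * part (deg e) 0 (single s c * (\<Prod>j\<in>D. f j ^ w j))))"
      using m_pow r1 by blast
    obtain r2' where r2': "lift_rel r2' (m ^ k1 * (m ^ k2 * part (deg e) 0 p))"
      using m_pow r2 by blast
    have "lift_rel (r1' + r2') (m ^ (k1 + k2) * part (deg e) 0 (single s c * (\<Prod>j\<in>D. f j ^ w j) + p))"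
      using lift_add[OF r1' r2'] by (simp add: part_add power_add distrib_left mult_ac)
    then show ?case by blast
  qed
  from this[OF q0D] obtain k r where "lift_rel r (m ^ k * part (deg e) 0 q0)" by blast
  then have start: "\<exists>r. lift_rel r (m ^ k * q0)" by (auto simp: q0_def part_part)
  \<comment> \<open>With \<open>P\<close> the first monomial of \<open>f e\<close>, free of the
    variables in \<open>E\<close>, one has
    \<open>P * (m ^ l * q0) = m ^ l * (f e * q0) - m ^ Suc l * q0\<close>; both terms on the right
    have lifts, and \<open>P\<close> can be divided out.\<close>
  have descend: "\<exists>r. lift_rel r (m ^ l * q0)" if ex: "\<exists>r. lift_rel r (m ^ Suc l * q0)" for l
  proof -
    obtain r1 where r1: "lift_rel r1 (m ^ Suc l * q0)" using ex by blast
    obtain r2 where r2: "lift_rel r2 (m ^ l * (f e * q0))"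
      using m_pow[of "f e * q0" l] p fq0 by auto
    have "lift_rel (mon (- posvec I b e) * (r2 - r1)) (mon (- posvec I b e) * (m ^ l * (f e * q0) - m ^ Suc l * q0))"
      using posvec_e e K keys_posvec[OF I, of b e]
      by (intro lift_single_mult lift_diff r1 r2) (auto simp: is_subringD)
    also have "m ^ l * (f e * q0) - m ^ Suc l * q0 = mon (posvec I b e) * (m ^ l * q0)"
      by (simp add: exch_def m_def algebra_simps)
    finally show ?thesis by auto
  qed
  have "\<exists>r. lift_rel r (m ^ (k - l) * q0)" for l
  proof (induction l)
    case 0
    then show ?case using start by simp
  next
    case (Suc l)
    then show ?case
      using descend[of "k - Suc l"] by (cases "l < k") (simp_all add: Suc_diff_Suc)
  qed
  from this[of k] show ?thesis by (simp add: q0_def)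
qed

text \<open>A lift \<open>r\<close> of the quotient makes \<open>p - f e * r\<close> a lift of 0,
  hence a multiple of \<open>x_e\<close>.\<close>

lemma lift_divisible:
  assumes IH: "\<And>D p. D \<subset> E \<Longrightarrow> p \<in> Lau \<Longrightarrow> (\<And>j. j \<in> D \<Longrightarrow> p \<in> lower_alg K I {j} f) \<Longrightarrow> p \<in> lower_alg K I D f"
    and cop: "coprime_exch K I b E"
    and p: "lift_rel p p0" "dvd_in Lau (f e) p0"
  shows "\<exists>l\<in>Low. \<exists>r\<in>Low. p = xe * l + f e * r"
proof -
  obtain q where q: "q \<in> Lau" "p0 = f e * q" using p(2) by (auto simp: dvd_in_def)
  obtain r where r: "lift_rel r (part (deg e) 0 q)"
    using lift_quotient[OF IH cop _ q(1), of p] p(1) q(2) by blast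
  have "f e * part (deg e) 0 q = f e * q"
    using f_hom[OF e e diag[OF e], of 0 q] f_hom[OF e e diag[OF e], of 0 "part (deg e) 0 q"]
      lift_part[OF p(1)] q(2) by (metis part_part)
  then have "lift_rel (p - f e * r) 0"
    using lift_diff[OF p(1) lift_f[OF r]] q(2) by (metis diff_self)
  then obtain l where "l \<in> Low" "p - f e * r = xe * l" using lift_rel_0 by blast
  then show ?thesis using lift_Low[OF r] by (metis add.commute diff_eq_eq)
qed

text \<open>A polynomial in \<open>f e / x_e\<close> whose coefficients have no pole at
  \<open>x_e\<close>. Terms with positive exponent at \<open>e\<close> go into
  \<open>xe * l\<close>; a surplus of \<open>f e\<close> in the others is absorbed into the
  coefficient by \<open>lift_f\<close>.\<close>

lemma Low_decompose:
  assumes "c \<in> Low"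
  shows "\<exists>n p p0 l. (\<forall>k. lift_rel (p k) (p0 k)) \<and> l \<in> Low \<and>
    c = (\<Sum>k<n. p k * (xe_inv * f e) ^ k) + xe * l"
  using assms
proof induction
  case zero
  show ?case
    by (rule exI[of _ 0], rule exI[of _ "\<lambda>_. 0"], rule exI[of _ "\<lambda>_. 0"], rule exI[of _ 0])
      (auto simp: lift_rel.zero lower_alg.zero)
next
  case (step q c s w)
  obtain n p p0 l where IH: "\<And>k. lift_rel (p k) (p0 k)" "l \<in> Low"
    "q = (\<Sum>k<n. p k * (xe_inv * f e) ^ k) + xe * l"
    using step(5) by blast
  have prodE: "(\<Prod>j\<in>E. f j ^ w j) = f e ^ w e * (\<Prod>j\<in>E'. f j ^ w j)"
    using prod.remove[OF finE e] .
  show ?case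
  proof (cases "lookup s e > 0")
    case True
    have "single (s - single e 1) c * (\<Prod>j\<in>E'. f j ^ w j) \<in> Low"
    proof (rule single_prod_Low)
      show "keys (s - single e 1) \<subseteq> I" using step(3) eI keys_diff[of s "single e 1"] by auto
      show "nat (- lookup (s - single e 1) j) \<le> w j" if "j \<in> E'" for j
        using that step(4)[of j] by (simp add: lookup_minus lookup_single)
    qed (use True step in \<open>auto simp: lookup_minus\<close>)
    then have "f e ^ w e * (single (s - single e 1) c * (\<Prod>j\<in>E'. f j ^ w j)) + l \<in> Low"
      using is_subringD(5)[OF Low is_subringD(6)[OF Low is_subring_power[OF Low exch_lower_alg[OF K I]]] IH(2)]
      by blast
    moreover have "single s c = xe * single (s - single e 1) c"
      by (simp add: mult_single)
    ultimately show ?thesis using IH(1)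
      by (intro exI[of _ n] exI[of _ p] exI[of _ p0] exI[of _ "f e ^ w e * (single (s - single e 1) c * (\<Prod>j\<in>E'. f j ^ w j)) + l"])
        (simp add: IH(3) prodE algebra_simps)
  next
    case False
    define k where "k = nat (- lookup s e)"
    define t where "t = s - single e (- int k)"
    have kw: "k \<le> w e" unfolding k_def using step(4)[OF e] .
    have te: "lookup t e = 0" using False by (simp add: t_def lookup_minus k_def)
    have keys_t: "keys t \<subseteq> I"
      using step(3) eI keys_diff[of s "single e (- int k)"] by (auto simp: t_def split: if_splits)
    have lift: "lift_rel (single t c * (\<Prod>j\<in>E'. f j ^ w j)) (single t c * (\<Prod>j\<in>E'. f0 j ^ w j))"
      using step(2,4) te keys_t by (intro lift_term) (auto simp: t_def lookup_minus lookup_single)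
    have lift_pow: "\<exists>r r0. r = f e ^ a * (single t c * (\<Prod>j\<in>E'. f j ^ w j)) \<and> lift_rel r r0" for a
    proof (induction a)
      case 0
      then show ?case using lift by auto
    next
      case (Suc a)
      then show ?case using lift_f by (auto simp: mult.assoc)
    qed
    then obtain r r0 where r: "r = f e ^ (w e - k) * (single t c * (\<Prod>j\<in>E'. f j ^ w j))" "lift_rel r r0"
      by blast
    have xe_pow: "xe_inv ^ k = mon (single e (- int k))"
      by (induction k) (auto simp: mult_single simp flip: single_add)
    have "single s c = xe_inv ^ k * single t c"
      unfolding xe_pow by (simp add: t_def mult_single)
    moreover have "f e ^ w e = f e ^ (w e - k) * f e ^ k" using kw by (simp flip: power_add)
    ultimately have eq: "single s c * (\<Prod>j\<in>E. f j ^ w j) = r * (xe_inv * f e) ^ k"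
      by (simp add: prodE r(1) power_mult_distrib mult_ac)
    define n' where "n' = max n (Suc k)"
    define P where "P i = (if i < n then p i else 0) + (if i = k then r else 0)" for i
    define P0 where "P0 i = (if i < n then p0 i else 0) + (if i = k then r0 else 0)" for i
    have "lift_rel (P i) (P0 i)" for i
      unfolding P_def P0_def using IH(1) r(2) lift_rel.zero by (intro lift_add) auto
    moreover have "(\<Sum>i<n'. P i * (xe_inv * f e) ^ i) =
        (\<Sum>i<n. p i * (xe_inv * f e) ^ i) + r * (xe_inv * f e) ^ k"
    proof -
      have "(\<Sum>i<n'. P i * (xe_inv * f e) ^ i) = (\<Sum>i<n'. (if i < n then p i else 0) * (xe_inv * f e) ^ i)
          + (\<Sum>i<n'. if i = k then r * (xe_inv * f e) ^ i else 0)"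
        unfolding P_def distrib_right sum.distrib by (intro arg_cong2[of _ _ _ _ "(+)"] sum.cong) auto
      also have "(\<Sum>i<n'. (if i < n then p i else 0) * (xe_inv * f e) ^ i) = (\<Sum>i<n. p i * (xe_inv * f e) ^ i)"
        by (rule sum.mono_neutral_cong_right) (auto simp: n'_def)
      also have "(\<Sum>i<n'. if i = k then r * (xe_inv * f e) ^ i else 0) = r * (xe_inv * f e) ^ k"
        by (simp add: n'_def)
      finally show ?thesis .
    qed
    ultimately show ?thesis
      using IH(2,3) eq by (intro exI[of _ n'] exI[of _ P] exI[of _ P0] exI[of _ l]) simp
  qed
qed

section \<open>Division by \<open>x_e\<close> inside the lower bound\<close>

lemma Low_subset: "Low \<subseteq> lower_alg K I {e} f"
  using lower_alg_antimono[OF K finE, of "{e}" f I] e exch_lower_alg[OF K I] by blast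

text \<open>Induction on the number of terms. If \<open>n\<close> is the top index, divisibility by
  \<open>f e ^ Suc n\<close> in degree \<open>- Suc n\<close> of \<open>c / x_e\<close> forces
  \<open>f e\<close> to divide the value of \<open>p n\<close> at \<open>x_e = 0\<close>. Then
  \<open>p n = xe * l1 + f e * r\<close>, and since \<open>f e = xe * y\<close> with
  \<open>y = f e / x_e\<close>, the term \<open>p n * y ^ n\<close> becomes a multiple of
  \<open>x_e\<close> and joins the remainder.\<close>

lemma xe_descent:
  assumes IH: "\<And>D p. D \<subset> E \<Longrightarrow> p \<in> Lau \<Longrightarrow> (\<And>j. j \<in> D \<Longrightarrow> p \<in> lower_alg K I {j} f) \<Longrightarrow> p \<in> lower_alg K I D f"
    and cop: "coprime_exch K I b E"
    and c: "c \<in> Low" "xe_inv * c \<in> lower_alg K I {e} f"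
  shows "xe_inv * c \<in> Low"
proof -
  have hom: "lookup u e = 0" if "u \<in> keys (f e)" for u
    by (rule exch_homogeneous[OF I _ that]) (rule diag[OF e])
  note one_iff = lower_alg_one_iff[where g = f and j = e, OF K exch_lau[OF K I] hom]
  let ?y = "xe_inv * f e"
  have y: "?y \<in> Low"
    using lower_alg_term[of 1 K "single e (-1)" I E "\<lambda>j. if j = e then 1 else 0" f] e eI K finE
    by (simp add: is_subringD lookup_single if_distrib[of "\<lambda>k. _ ^ k"] prod.delta cong: if_cong)
  have main: "xe_inv * ((\<Sum>k<n. p k * ?y ^ k) + xe * l) \<in> Low"
    if "\<And>k. lift_rel (p k) (p0 k)" "l \<in> Low"
      "xe_inv * ((\<Sum>k<n. p k * ?y ^ k) + xe * l) \<in> lower_alg K I {e} f" for n p p0 l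
    using that
  proof (induction n arbitrary: l)
    case 0
    then show ?case by simp
  next
    case (Suc n)
    let ?c = "(\<Sum>k<Suc n. p k * ?y ^ k) + xe * l"
    have y_pow: "?y ^ k = mon (single e (- int k)) * f e ^ k" for k
    proof -
      have "xe_inv ^ k = mon (single e (- int k))"
        by (induction k) (auto simp: mult_single simp flip: single_add)
      then show ?thesis by (simp add: power_mult_distrib)
    qed
    have part_term: "part (deg e) (- int n) (p k * ?y ^ k) = ?y ^ k * part (deg e) (int k - int n) (p k)" for k
    proof -
      have "part (deg e) (- int n) (p k * ?y ^ k) =
          part (deg e) (- int n) (mon (single e (- int k)) * (f e ^ k * p k))"
        unfolding y_pow by (simp only: mult_ac)
      also have "\<dots> = mon (single e (- int k)) * (f e ^ k * part (deg e) (int k - int n) (p k))"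
        by (simp add: part_single_mult f_pow_hom[OF e e diag[OF e]])
      finally show ?thesis unfolding y_pow mult.assoc .
    qed
    \<comment> \<open>The coefficients have no pole, so the terms below the top index contribute
      nothing in degree \<open>- n\<close>.\<close>
    have vanish: "part (deg e) (int k - int n) (p k) = 0" if "k < n" for k
      using lift_part[OF Suc.prems(1)[of k]] that by (force simp: part_eq_0_iff)
    have part0: "part (deg e) 0 (p n) = p0 n" using lift_part[OF Suc.prems(1)[of n]] by blast
    have sum_part: "part (deg e) (- int n) (\<Sum>k<Suc n. p k * ?y ^ k) = ?y ^ n * p0 n"
    proof -
      have "part (deg e) (- int n) (\<Sum>k<Suc n. p k * ?y ^ k) =
          (\<Sum>k<Suc n. ?y ^ k * part (deg e) (int k - int n) (p k))"
        unfolding part_sum part_term ..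
      also have "\<dots> = ?y ^ n * p0 n"
        by (simp add: vanish part0)
      finally show ?thesis .
    qed
    have suc: "- int (Suc n) = - int n - 1" by simp
    have "part (deg e) (- int (Suc n)) (xe_inv * ?c) = xe_inv * part (deg e) (- int n) ?c"
      by (simp add: part_single_mult)
    also have "part (deg e) (- int n) ?c = ?y ^ n * p0 n + xe * part (deg e) (- int (Suc n)) l"
      unfolding part_add sum_part part_single_mult[OF additive_deg] suc by simp
    finally have eq: "part (deg e) (- int (Suc n)) (xe_inv * ?c) =
        mon (single e (- int (Suc n))) * (f e ^ n * p0 n) + part (deg e) (- int (Suc n)) l"
      unfolding distrib_left y_pow by (simp add: mult_single flip: mult.assoc single_add)
    \<comment> \<open>Both \<open>c / x_e\<close> and \<open>l\<close> satisfy the pole condition of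
      order \<open>Suc n\<close>; their difference leaves \<open>f e ^ n * p0 n\<close> up to a
      monomial.\<close>
    have "dvd_in Lau (f e ^ Suc n) (part (deg e) (- int (Suc n)) (xe_inv * ?c))"
      "dvd_in Lau (f e ^ Suc n) (part (deg e) (- int (Suc n)) l)"
      using Suc.prems(3) Suc.prems(2) Low_subset one_iff by blast+
    from dvd_in_diff[OF Lau this] have "dvd_in Lau (f e ^ Suc n) (mon (single e (- int (Suc n))) * (f e ^ n * p0 n))"
      unfolding eq by simp
    then have "dvd_in Lau (f e ^ Suc n) (mon (single e (- int (Suc n))) * (f e ^ n * p0 n) * mon (- single e (- int (Suc n))))"
      by (rule dvd_in_mult[OF Lau]) (use eI in \<open>auto intro!: mon_lau K\<close>)
    then have "dvd_in Lau (f e ^ n * f e) (f e ^ n * p0 n)"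
      by (simp add: mult_ac)
    then have "dvd_in Lau (f e) (p0 n)"
      by (rule dvd_in_cancel) (simp add: exch_neq_0[OF I])
    from lift_divisible[OF IH cop Suc.prems(1)[of n] this]
    obtain l1 r where l1: "l1 \<in> Low" "r \<in> Low" "p n = xe * l1 + f e * r" by blast
    define l' where "l' = l + l1 * ?y ^ n + r * ?y ^ Suc n"
    have l': "l' \<in> Low"
      unfolding l'_def
      by (rule is_subringD(5)[OF Low is_subringD(5)[OF Low Suc.prems(2)
          is_subringD(6)[OF Low l1(1) is_subring_power[OF Low y]]]
          is_subringD(6)[OF Low l1(2) is_subring_power[OF Low y]]])
    have "p n = xe * l1 + (xe * ?y) * r" unfolding l1(3) by simp
    moreover have "(u * a + (u * y) * r) * y ^ n = u * (a * y ^ n + r * y ^ Suc n)" for u a r y :: "'a laurent"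
      by (simp add: algebra_simps)
    ultimately have pn: "p n * ?y ^ n = xe * (l1 * ?y ^ n + r * ?y ^ Suc n)"
      by (simp only:)
    have c_eq: "?c = (\<Sum>k<n. p k * ?y ^ k) + xe * l'"
      unfolding l'_def sum.lessThan_Suc pn by (simp only: distrib_left ac_simps)
    show ?case using Suc.IH[OF Suc.prems(1) l'] Suc.prems(3) unfolding c_eq by blast
  qed
  obtain n p p0 l where "\<And>k. lift_rel (p k) (p0 k)" "l \<in> Low" "c = (\<Sum>k<n. p k * ?y ^ k) + xe * l"
    using Low_decompose[OF c(1)] by blast
  then show ?thesis using main c(2) by blast
qed

lemma clear_xe:
  assumes "p \<in> lower_alg K I E' f"
  shows "\<exists>k. xe ^ k * p \<in> Low"
  using assms
proof induction
  case zero
  then show ?case by (auto intro: lower_alg.zero)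
next
  case (step p c s w)
  obtain k where k: "xe ^ k * p \<in> Low" using step(5) by blast
  define k' where "k' = nat (- lookup s e)"
  have xe_pow: "xe ^ a = mon (single e (int a))" for a
    by (induction a) (auto simp: mult_single simp flip: single_add)
  have xe: "xe ^ a \<in> Low" for a
    unfolding xe_pow using eI K by (intro lower_alg_single) (auto simp: is_subringD lookup_single when_def split: if_splits)
  have "single (single e (int k') + s) c * (\<Prod>j\<in>E'. f j ^ w j) \<in> Low"
  proof (rule single_prod_Low)
    show "keys (single e (int k') + s) \<subseteq> I" using step(3) eI by (intro keys_plus_subset) auto
    show "nat (- lookup (single e (int k') + s) j) \<le> w j" if "j \<in> E'" for j
      using that step(4)[OF that] by (simp add: lookup_add lookup_single)
  qed (use step in \<open>auto simp: lookup_add k'_def\<close>)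
  then have "xe ^ k' * (single s c * (\<Prod>j\<in>E'. f j ^ w j)) \<in> Low"
    unfolding xe_pow by (simp add: mult_single flip: mult.assoc)
  then have "xe ^ k * (xe ^ k' * (single s c * (\<Prod>j\<in>E'. f j ^ w j))) + xe ^ k' * (xe ^ k * p) \<in> Low"
    by (rule is_subringD(5)[OF Low is_subringD(6)[OF Low xe] is_subringD(6)[OF Low xe k]])
  then have "xe ^ (k + k') * (single s c * (\<Prod>j\<in>E'. f j ^ w j) + p) \<in> Low"
    by (simp add: power_add algebra_simps)
  then show ?case by blast
qed

text \<open>For \<open>E'\<close> the variable \<open>x_e\<close> is invertible, so the induction
  hypothesis gives membership after multiplication by a power of \<open>x_e\<close>. These factors
  are removed one at a time, each time using that \<open>p\<close> satisfies the pole condition at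
  \<open>e\<close>.\<close>

lemma upper_subset_step:
  assumes IH: "\<And>D p. D \<subset> E \<Longrightarrow> p \<in> Lau \<Longrightarrow> (\<And>j. j \<in> D \<Longrightarrow> p \<in> lower_alg K I {j} f) \<Longrightarrow> p \<in> lower_alg K I D f"
    and cop: "coprime_exch K I b E"
    and p: "p \<in> Lau" "\<And>j. j \<in> E \<Longrightarrow> p \<in> lower_alg K I {j} f"
  shows "p \<in> Low"
proof -
  note S = is_subring_lower_alg[OF K, of I "{e}" f]
  have "p \<in> lower_alg K I E' f"
    using IH[of E' p] p e by auto
  then obtain k where k: "xe ^ k * p \<in> Low" using clear_xe by blast
  have xe: "xe \<in> lower_alg K I {e} f"
    using eI K by (intro lower_alg_single) (auto simp: is_subringD)
  have A: "xe ^ a * p \<in> lower_alg K I {e} f" for a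
    using p(2)[OF e] xe by (intro is_subringD(6)[OF S] is_subring_power[OF S])
  have "xe ^ (k - a) * p \<in> Low" for a
  proof (induction a)
    case 0
    then show ?case using k by simp
  next
    case (Suc a)
    show ?case
    proof (cases "a < k")
      case True
      then have "xe ^ (k - a) * p = xe * (xe ^ (k - Suc a) * p)"
        by (simp add: Suc_diff_Suc mult.assoc flip: power_Suc)
      then have eq: "xe_inv * (xe ^ (k - a) * p) = xe ^ (k - Suc a) * p"
        by (simp only: xe_cancel)
      show ?thesis
        using xe_descent[OF IH cop Suc] A[of "k - Suc a"] unfolding eq by blast
    qed (use Suc in simp)
  qed
  from this[of k] show ?thesis by simp
qed

end

text \<open>Induction over all proper subsets, not only over \<open>E - {e}\<close>: the quotient
  argument at the source also needs the case of its non-neighbours.\<close>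

theorem upper_bound_subset_lower_alg:
  fixes K :: "'a::{idom,ring_char_0} set"
  assumes "is_subring K" "finite I" "E \<subseteq> I" "skew_signs b E" "acyclic_on b E" "coprime_exch K I b E"
    and "p \<in> lau K I" "\<And>j. j \<in> E \<Longrightarrow> p \<in> lower_alg K I {j} (exch I b)"
  shows "p \<in> lower_alg K I E (exch I b)"
proof -
  have "finite E" by (rule finite_subset[OF assms(3,2)])
  then show ?thesis using assms(3-)
  proof (induction E arbitrary: p rule: finite_psubset_induct)
    case (psubset E)
    show ?case
    proof (cases "E = {}")
      case True
      have "exch I b 0 ^ 0 * p \<in> lower_alg K I {} (exch I b)"
        using laurent_sum_single[of p, symmetric]
          is_subring_sum[OF is_subring_lower_alg[OF assms(1)], of "keys p" "\<lambda>e. single e (lookup p e)" I "{}" "exch I b"]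
          lower_alg_single[of _ K _ I "{}" "exch I b"] lau_coeff[OF psubset.prems(5)] lau_keys[OF psubset.prems(5)]
        by simp
      then show ?thesis using True by simp
    next
      case False
      obtain e where e: "e \<in> E" "\<And>j. j \<in> E \<Longrightarrow> b j e \<le> 0"
        using acyclic_on_source[OF \<open>acyclic_on b E\<close> False] by metis
      interpret source K I b E e
        using assms(1,2) psubset.prems e by unfold_locales auto
      show ?thesis
      proof (rule upper_subset_step)
        fix D p assume D: "D \<subset> E" "p \<in> lau K I" "\<And>j. j \<in> D \<Longrightarrow> p \<in> lower_alg K I {j} (exch I b)"
        have "D \<subseteq> E" using D(1) by auto
        then show "p \<in> lower_alg K I D (exch I b)"
          using psubset.IH[OF D(1) subset_trans[OF _ psubset.prems(1)] skew_signs_subset[OF psubset.prems(2)]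
              acyclic_on_subset[OF psubset.prems(3)] coprime_exch_subset[OF psubset.prems(4)] D(2)] D(3)
          by metis
      qed (use psubset.prems in auto)
    qed
  qed
qed

section \<open>Unique factorization of Laurent polynomial rings\<close>

definition unit_in :: "'a::comm_ring_1 set \<Rightarrow> 'a \<Rightarrow> bool" where
  "unit_in S u \<longleftrightarrow> u \<in> S \<and> (\<exists>v\<in>S. u * v = 1)"

definition prime_in :: "'a::comm_ring_1 set \<Rightarrow> 'a \<Rightarrow> bool" where
  "prime_in S p \<longleftrightarrow> p \<in> S \<and> p \<noteq> 0 \<and> \<not> unit_in S p \<and>
     (\<forall>a\<in>S. \<forall>b\<in>S. dvd_in S p (a * b) \<longrightarrow> dvd_in S p a \<or> dvd_in S p b)"

text \<open>The factors are prime rather than irreducible, so uniqueness is automatic and only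
  existence has to be carried along.\<close>

definition prime_factorial :: "'a::comm_ring_1 set \<Rightarrow> bool" where
  "prime_factorial S \<longleftrightarrow> (\<forall>a\<in>S. a \<noteq> 0 \<longrightarrow>
     (\<exists>u ps. unit_in S u \<and> (\<forall>p\<in>set ps. prime_in S p) \<and> a = u * prod_list ps))"

lemma prime_inD:
  assumes "prime_in S p"
  shows "p \<in> S" "p \<noteq> 0" "\<not> unit_in S p"
    "a \<in> S \<Longrightarrow> b \<in> S \<Longrightarrow> dvd_in S p (a * b) \<Longrightarrow> dvd_in S p a \<or> dvd_in S p b"
  using assms by (auto simp: prime_in_def)

lemma unit_in_mult: "is_subring S \<Longrightarrow> unit_in S u \<Longrightarrow> unit_in S v \<Longrightarrow> unit_in S (u * v)"
proof -
  assume S: "is_subring S" and "unit_in S u" "unit_in S v"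
  then obtain u' v' where "u \<in> S" "v \<in> S" "u' \<in> S" "v' \<in> S" "u * u' = 1" "v * v' = 1"
    by (auto simp: unit_in_def)
  moreover from this have "(u * v) * (u' * v') = 1" by (metis mult.commute mult.left_commute mult_1)
  ultimately show ?thesis using S by (auto simp: unit_in_def is_subringD intro!: bexI[of _ "u' * v'"])
qed

lemma unit_in_one: "is_subring S \<Longrightarrow> unit_in S 1"
  by (auto simp: unit_in_def is_subringD)

lemma unit_in_mono: "unit_in S u \<Longrightarrow> S \<subseteq> T \<Longrightarrow> unit_in T u"
  by (auto simp: unit_in_def)

lemma unit_in_factor:
  "is_subring S \<Longrightarrow> a \<in> S \<Longrightarrow> b \<in> S \<Longrightarrow> unit_in S (a * b) \<Longrightarrow> unit_in S a"
  unfolding unit_in_def by (metis is_subringD(6) mult.assoc)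

lemma prime_dvd_unit: "is_subring S \<Longrightarrow> prime_in S p \<Longrightarrow> unit_in S u \<Longrightarrow> \<not> dvd_in S p u"
  unfolding dvd_in_def using prime_inD unit_in_factor by blast

lemma prime_dvd_prod_list:
  assumes S: "is_subring S" and p: "prime_in S p"
  shows "set qs \<subseteq> S \<Longrightarrow> dvd_in S p (prod_list qs) \<Longrightarrow> \<exists>q\<in>set qs. dvd_in S p q"
proof (induction qs)
  case Nil
  then show ?case using prime_dvd_unit[OF S p unit_in_one[OF S]] by simp
next
  case (Cons q qs)
  then show ?case using prime_inD(4)[OF p, of q "prod_list qs"] is_subring_prod_list[OF S, of qs] by auto
qed

lemma prime_dvd_prime:
  fixes p q :: "'a::idom"
  assumes S: "is_subring S" and p: "prime_in S p" and q: "prime_in S q" and "dvd_in S p q"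
  shows "\<exists>u. unit_in S u \<and> q = p * u"
proof -
  obtain c where c: "c \<in> S" "q = p * c" using assms(4) by (auto simp: dvd_in_def)
  have "dvd_in S q p \<or> dvd_in S q c"
    using prime_inD(4)[OF q prime_inD(1)[OF p] c(1)] c(2) dvd_in_refl[OF S, of q] by metis
  then show ?thesis
  proof
    assume "dvd_in S q p"
    then obtain d where d: "d \<in> S" "p = q * d" by (auto simp: dvd_in_def)
    then have "p * (c * d) = p * 1" using c(2) by (metis mult.assoc mult.right_neutral)
    then have "c * d = 1" using prime_inD(2)[OF p] by simp
    then show ?thesis using c d by (auto simp: unit_in_def)
  next
    assume "dvd_in S q c"
    then obtain d where d: "d \<in> S" "c = q * d" by (auto simp: dvd_in_def)
    then have "q * (p * d) = q * 1" using c(2) by (metis mult.left_commute mult.right_neutral)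
    then have "p * d = 1" using prime_inD(2)[OF q] by simp
    then have "unit_in S p" using prime_inD(1)[OF p] d by (auto simp: unit_in_def)
    then show ?thesis using prime_inD(3)[OF p] by simp
  qed
qed

text \<open>The order of vanishing with respect to \<open>d\<close>. At \<open>p = 0\<close> the
  minimum is taken over the empty set and has no meaning.\<close>

definition low :: "('e \<Rightarrow> int) \<Rightarrow> ('e \<Rightarrow>\<^sub>0 'a::zero) \<Rightarrow> int" where
  "low d p = Min (d ` keys p)"

lemma low_le: "e \<in> keys p \<Longrightarrow> low d p \<le> d e"
  by (auto simp: low_def)

lemma part_low: "p \<noteq> 0 \<Longrightarrow> part d (low d p) p \<noteq> 0"
proof -
  assume "p \<noteq> 0"
  then have "low d p \<in> d ` keys p" unfolding low_def by (intro Min_in) auto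
  then obtain e where "e \<in> keys p" "d e = low d p" by auto
  then show ?thesis by (auto simp: part_eq_0_iff)
qed

lemma part_below_low: "k < low d p \<Longrightarrow> part d k p = 0"
  using low_le[of _ p d] by (force simp: part_eq_0_iff)

lemma prod_list_remove1: "q \<in> set qs \<Longrightarrow> prod_list qs = q * prod_list (remove1 q qs)"
  for q :: "'a::comm_monoid_mult"
  by (induction qs) (auto simp: mult_ac)

lemma low_eqI: "(\<And>e. e \<in> keys p \<Longrightarrow> k \<le> d e) \<Longrightarrow> part d k p \<noteq> 0 \<Longrightarrow> low d p = k"
  unfolding low_def by (rule Min_eqI) (auto simp: part_eq_0_iff)

lemma low_mult:
  fixes p q :: "'a::idom laurent"
  assumes "additive_fun d" "p \<noteq> 0" "q \<noteq> 0"
  shows "low d (p * q) = low d p + low d q" "part d (low d (p * q)) (p * q) = part d (low d p) p * part d (low d q) q"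
proof -
  have eq: "part d (low d p + low d q) (p * q) = part d (low d p) p * part d (low d q) q"
    using assms by (intro part_mult_lowest) (auto simp: low_le)
  show "low d (p * q) = low d p + low d q"
  proof (rule low_eqI)
    show "low d p + low d q \<le> d e" if "e \<in> keys (p * q)" for e
      by (rule keys_mult_ge[OF assms(1) _ _ that]) (auto simp: low_le)
  qed (use assms part_low eq in auto)
  then show "part d (low d (p * q)) (p * q) = part d (low d p) p * part d (low d q) q" using eq by simp
qed

text \<open>Gauss's theorem for one more invertible variable \<open>x_i\<close>. Instead of passing
  to the fraction field of \<open>S\<close>, divisions are carried out up to a nonzero factor from
  \<open>S\<close>.\<close>

locale gauss =
  fixes K :: "'a::idom set" and I :: "nat set" and i :: nat
  assumes K: "is_subring K" and i: "i \<notin> I" and fact: "prime_factorial (lau K I)"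
begin

abbreviation "S \<equiv> lau K I"
abbreviation "T \<equiv> lau K (insert i I)"

lemmas S = is_subring_lau[OF K, of I]
lemmas T = is_subring_lau[OF K, of "insert i I"]

lemma ST: "S \<subseteq> T"
  by (rule lau_mono) auto

definition xi :: "int \<Rightarrow> 'a laurent" where "xi k = mon (single i k)"

definition coef :: "int \<Rightarrow> 'a laurent \<Rightarrow> 'a laurent" where
  "coef k a = xi (- k) * part (deg i) k a"

lemma xi_mult: "xi k * xi l = xi (k + l)"
  by (simp add: xi_def mult_single single_add)

lemma xi_0 [simp]: "xi 0 = 1"
  by (simp add: xi_def)

lemma xi_neq_0 [simp]: "xi k \<noteq> 0"
  by (simp add: xi_def)

lemma xi_T: "xi k \<in> T"
  unfolding xi_def using K by (intro mon_lau) auto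

lemma xi_unit: "unit_in T (xi k)"
  unfolding unit_in_def using xi_T xi_mult[of k "- k"] by force

lemma part_coef: "part (deg i) k a = xi k * coef k a"
  by (simp add: coef_def xi_mult flip: mult.assoc)

lemma S_deg: "a \<in> S \<Longrightarrow> e \<in> keys a \<Longrightarrow> lookup e i = 0"
  using i lau_keys[of a K I e] by (auto simp: in_keys_iff)

lemma coef_S: "a \<in> T \<Longrightarrow> coef k a \<in> S"
proof -
  assume a: "a \<in> T"
  have c: "coef k a \<in> T"
    unfolding coef_def by (intro is_subringD(6)[OF T] xi_T lau_part K a)
  have "keys e \<subseteq> I" if e: "e \<in> keys (coef k a)" for e
  proof -
    have "e \<in> {u + v | u v. u \<in> keys (xi (- k)) \<and> v \<in> keys (part (deg i) k a)}"
      using keys_mult e unfolding coef_def by blast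
    then have "lookup e i = 0" by (auto simp: xi_def keys_part lookup_add split: if_splits)
    then show ?thesis using lau_keys[OF c e] by (auto simp: in_keys_iff)
  qed
  then show ?thesis using c by (auto simp: lau_def)
qed

lemma coef_mult_S: "s \<in> S \<Longrightarrow> coef k (s * a) = s * coef k a"
  using part_homogeneous_mult[OF additive_deg, of s i 0 k a] S_deg by (auto simp: coef_def mult_ac)

lemma coef_mult:
  assumes "finite Z" "deg i ` keys a \<subseteq> Z"
  shows "coef k (a * b) = (\<Sum>c\<in>Z. coef c a * coef (k - c) b)"
proof -
  have "coef k (a * b) = (\<Sum>c\<in>Z. xi (- k) * (part (deg i) c a * part (deg i) (k - c) b))"
    unfolding coef_def part_mult[OF additive_deg assms] sum_distrib_left ..
  also have "\<dots> = (\<Sum>c\<in>Z. coef c a * coef (k - c) b)"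
  proof (rule sum.cong)
    fix c
    have "xi (- k) = xi (- c) * xi (- (k - c))" by (simp add: xi_mult)
    then show "xi (- k) * (part (deg i) c a * part (deg i) (k - c) b) = coef c a * coef (k - c) b"
      unfolding coef_def by (simp only: mult_ac)
  qed simp
  finally show ?thesis .
qed

lemma coef_one: "coef 0 1 = 1"
  using part_single[of "deg i" 0 0 "1 :: 'a"] by (simp add: coef_def)

lemma coef_eq_0: "k \<notin> deg i ` keys a \<Longrightarrow> coef k a = 0"
proof -
  assume "k \<notin> deg i ` keys a"
  then have "part (deg i) k a = 0" by (auto simp: part_eq_0_iff)
  then show ?thesis by (simp add: coef_def)
qed

lemma dvd_T_iff:
  assumes "s \<in> S" "a \<in> T"
  shows "dvd_in T s a \<longleftrightarrow> (\<forall>k. dvd_in S s (coef k a))"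
proof
  assume "dvd_in T s a"
  then obtain c where "c \<in> T" "a = s * c" by (auto simp: dvd_in_def)
  then show "\<forall>k. dvd_in S s (coef k a)"
    using assms by (auto simp: coef_mult_S intro!: dvd_inI[of "coef _ c"] coef_S)
next
  assume *: "\<forall>k. dvd_in S s (coef k a)"
  have "dvd_in T s (\<Sum>k\<in>deg i ` keys a. part (deg i) k a)"
  proof (rule dvd_in_sum[OF T])
    fix k
    obtain c where "c \<in> S" "coef k a = s * c" using * by (auto simp: dvd_in_def)
    then show "dvd_in T s (part (deg i) k a)"
      unfolding part_coef using ST
      by (intro dvd_inI[of "xi k * c"]) (auto intro!: is_subringD(6)[OF T] xi_T simp: mult_ac)
  qed
  then show "dvd_in T s a" by (simp flip: sum_parts)
qed

lemma unit_S_iff: "s \<in> S \<Longrightarrow> unit_in T s \<longleftrightarrow> unit_in S s"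
proof
  assume s: "s \<in> S" and "unit_in T s"
  then obtain v where v: "v \<in> T" "s * v = 1" by (auto simp: unit_in_def)
  then have "s * coef 0 v = 1" using coef_mult_S[OF s, of 0 v] coef_one by simp
  then show "unit_in S s" using s coef_S[OF v(1)] by (auto simp: unit_in_def)
qed (use ST unit_in_mono in blast)

text \<open>Gauss's lemma: if \<open>p\<close> divides neither factor, let \<open>k\<close> and
  \<open>l\<close> be the lowest degrees whose coefficients are not divisible by \<open>p\<close>.
  In degree \<open>k + l\<close> of the product all other terms are divisible by
  \<open>p\<close>.\<close>

lemma prime_S_T:
  assumes p: "prime_in S p"
  shows "prime_in T p"
  unfolding prime_in_def
proof (intro conjI ballI impI)
  note pS = prime_inD(1)[OF p]
  show "p \<in> T" using pS ST by blast
  show "p \<noteq> 0" using prime_inD(2)[OF p] .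
  show "\<not> unit_in T p" using prime_inD(3)[OF p] unit_S_iff[OF pS] by simp
  fix a b assume ab: "a \<in> T" "b \<in> T" "dvd_in T p (a * b)"
  show "dvd_in T p a \<or> dvd_in T p b"
  proof (rule ccontr)
    assume contr: "\<not> (dvd_in T p a \<or> dvd_in T p b)"
    have least: "\<exists>k. \<not> dvd_in S p (coef k a) \<and> (\<forall>c<k. dvd_in S p (coef c a))"
      if "a \<in> T" "\<not> dvd_in T p a" for a
    proof -
      define Z where "Z = {k \<in> deg i ` keys a. \<not> dvd_in S p (coef k a)}"
      have Z: "k \<in> Z" if "\<not> dvd_in S p (coef k a)" for k
        using that coef_eq_0[of k a] dvd_in_0[OF S, of p] by (force simp: Z_def)
      have "finite Z" "Z \<noteq> {}" using that dvd_T_iff[OF pS that(1)] Z by (auto simp: Z_def)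
      then have min: "Min Z \<in> Z" "c < Min Z \<Longrightarrow> c \<notin> Z" for c
        by (auto simp: Min_in dest: Min_le)
      have "\<not> dvd_in S p (coef (Min Z) a)" using min(1) by (simp add: Z_def)
      moreover have "\<forall>c<Min Z. dvd_in S p (coef c a)" using min(2) Z by blast
      ultimately show ?thesis by blast
    qed
    obtain k where k: "\<not> dvd_in S p (coef k a)" "\<And>c. c < k \<Longrightarrow> dvd_in S p (coef c a)"
      using least[OF ab(1)] contr by blast
    obtain l where l: "\<not> dvd_in S p (coef l b)" "\<And>c. c < l \<Longrightarrow> dvd_in S p (coef c b)"
      using least[OF ab(2)] contr by blast
    define Z where "Z = insert k (deg i ` keys a)"
    have "finite Z" "k \<in> Z" by (auto simp: Z_def)
    have "coef (k + l) (a * b) = (\<Sum>c\<in>Z. coef c a * coef (k + l - c) b)"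
      by (rule coef_mult) (auto simp: Z_def)
    also have "\<dots> = coef k a * coef l b + (\<Sum>c\<in>Z - {k}. coef c a * coef (k + l - c) b)"
      using sum.remove[OF \<open>finite Z\<close> \<open>k \<in> Z\<close>, of "\<lambda>c. coef c a * coef (k + l - c) b"] by simp
    finally have eq: "coef k a * coef l b = coef (k + l) (a * b) - (\<Sum>c\<in>Z - {k}. coef c a * coef (k + l - c) b)"
      by simp
    have "dvd_in S p (coef k a * coef l b)"
      unfolding eq
    proof (rule dvd_in_diff[OF S])
      show "dvd_in S p (coef (k + l) (a * b))"
        using ab dvd_T_iff[OF pS] is_subringD(6)[OF T] by blast
      show "dvd_in S p (\<Sum>c\<in>Z - {k}. coef c a * coef (k + l - c) b)"
      proof (rule dvd_in_sum[OF S])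
        fix c assume "c \<in> Z - {k}"
        then consider "c < k" | "k + l - c < l" by force
        then show "dvd_in S p (coef c a * coef (k + l - c) b)"
        proof cases
          case 1
          then show ?thesis using k(2) ab by (intro dvd_in_mult[OF S] coef_S)
        next
          case 2
          then show ?thesis using l(2) ab by (intro dvd_in_mult2[OF S] coef_S)
        qed
      qed
    qed
    then show False using prime_inD(4)[OF p coef_S[OF ab(1)] coef_S[OF ab(2)]] k(1) l(1) by blast
  qed
qed

section \<open>Width and division with remainder\<close>

abbreviation bot :: "'a laurent \<Rightarrow> int" where "bot \<equiv> low (deg i)"
text \<open>Expressed through \<open>low\<close> of the negated degree, so that additivity of
  \<open>low\<close> covers both ends.\<close>

abbreviation top' :: "'a laurent \<Rightarrow> int" where "top' p \<equiv> - low (\<lambda>e. - lookup e i) p"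

text \<open>A size that ignores the units \<open>xi k\<close>: the degree of the polynomial obtained
  by shifting the lowest exponent to 0.\<close>

definition wid :: "'a laurent \<Rightarrow> nat" where "wid p = nat (top' p - bot p)"

lemma additive_neg: "additive_fun (\<lambda>e. - lookup e i :: int)"
  by (simp add: additive_fun_def lookup_add)

lemma le_top: "e \<in> keys p \<Longrightarrow> lookup e i \<le> top' p"
  using low_le[of e p "\<lambda>e. - lookup e i"] by simp

lemma bot_le_top: "p \<noteq> 0 \<Longrightarrow> bot p \<le> top' p"
proof -
  assume "p \<noteq> 0"
  then obtain e where "e \<in> keys p" using keys_eq_empty[of p] by blast
  then show ?thesis using le_top[of e p] low_le[of e p "deg i"] by simp
qed

lemma wid_mult: "p \<noteq> 0 \<Longrightarrow> q \<noteq> 0 \<Longrightarrow> wid (p * q) = wid p + wid q"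
  using low_mult(1)[OF additive_deg, of p q i] low_mult(1)[OF additive_neg, of p q]
    bot_le_top[of p] bot_le_top[of q] by (simp add: wid_def)

lemma part_neg: "part (\<lambda>e. - lookup e i) k p = part (deg i) (- k) p"
  by (rule poly_mapping_eqI) (auto simp: lookup_part)

lemma lead_neq_0: "p \<noteq> 0 \<Longrightarrow> coef (top' p) p \<noteq> 0"
  using part_low[of p "\<lambda>e. - lookup e i"] by (simp add: part_neg coef_def)

lemma coef_top: "coef (top' p) p = xi (low (\<lambda>e. - lookup e i) p) * part (\<lambda>e. - lookup e i) (low (\<lambda>e. - lookup e i) p) p"
  by (simp add: coef_def part_neg)

lemma lead_mult: "p \<noteq> 0 \<Longrightarrow> q \<noteq> 0 \<Longrightarrow> coef (top' (p * q)) (p * q) = coef (top' p) p * coef (top' q) q"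
proof -
  assume "p \<noteq> 0" "q \<noteq> 0"
  note lm = low_mult[OF additive_neg this]
  show ?thesis unfolding coef_top lm(2) unfolding lm(1) xi_mult[symmetric] by (simp only: mult_ac)
qed

lemma wid_0:
  assumes "p \<in> T" "p \<noteq> 0" "wid p = 0"
  shows "\<exists>k. \<exists>s\<in>S. p = xi k * s"
proof -
  have *: "bot p = top' p" using assms(2,3) bot_le_top[of p] by (simp add: wid_def)
  have "lookup e i = bot p" if "e \<in> keys p" for e
    using le_top[OF that] low_le[OF that, of "deg i"] * by simp
  then have "p = part (deg i) (bot p) p"
    by (intro poly_mapping_eqI) (auto simp: lookup_part in_keys_iff)
  then show ?thesis using part_coef coef_S[OF assms(1)] by metis
qed

lemma wid_S: "s \<in> S \<Longrightarrow> s \<noteq> 0 \<Longrightarrow> wid s = 0"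
proof -
  assume s: "s \<in> S" "s \<noteq> 0"
  then have "(\<lambda>e. lookup e i) ` keys s = {0}" "(\<lambda>e. - lookup e i) ` keys s = {0}"
    using S_deg[OF s(1)] by (auto simp: image_iff keys_eq_empty[symmetric] simp del: keys_eq_empty)
  then show ?thesis by (simp add: wid_def low_def)
qed

text \<open>Multiplying \<open>g\<close> by the leading coefficient \<open>D\<close> of
  \<open>d\<close> lets the top terms cancel. The top degree drops, and the bottom degree does not
  fall, because \<open>wid d \<le> wid g\<close> keeps the subtracted multiple of \<open>d\<close>
  above the bottom of \<open>g\<close>.\<close>

lemma pseudo_division:
  assumes d: "d \<in> T" "d \<noteq> 0" and g: "g \<in> T"
  shows "\<exists>s\<in>S. \<exists>q\<in>T. \<exists>r\<in>T. s \<noteq> 0 \<and> s * g = q * d + r \<and> (r = 0 \<or> wid r < wid d)"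
  using g
proof (induction "wid g" arbitrary: g rule: less_induct)
  case less
  show ?case
  proof (cases "g = 0 \<or> wid g < wid d")
    case True
    then show ?thesis using less.prems
      by (intro bexI[of _ 1] bexI[of _ 0] bexI[of _ g]) (auto simp: is_subringD[OF S] is_subringD[OF T])
  next
    case False
    then have g0: "g \<noteq> 0" and wid: "wid d \<le> wid g" by auto
    define D where "D = coef (top' d) d"
    define G where "G = coef (top' g) g"
    define M where "M = xi (top' g - top' d)"
    define h where "h = D * g - G * M * d"
    have DG: "D \<in> S" "G \<in> S" "D \<noteq> 0" "G \<noteq> 0"
      using lead_neq_0[OF d(2)] lead_neq_0[OF g0] d(1) less.prems by (simp_all add: D_def G_def coef_S)
    have DGT: "D \<in> T" "G \<in> T" using DG ST by auto
    have MT: "M \<in> T" unfolding M_def by (rule xi_T)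
    have h: "h \<in> T" unfolding h_def
      using DGT MT d less.prems by (intro is_subringD(3,6)[OF T])
    have bound: "bot g \<le> lookup e i \<and> lookup e i < top' g" if e: "e \<in> keys h" for e
    proof -
      have GM: "lookup u i = top' g - top' d" if "u \<in> keys (G * M)" for u
      proof -
        have "u \<in> {a + b | a b. a \<in> keys G \<and> b \<in> keys M}" using keys_mult that by blast
        then show ?thesis using S_deg[OF DG(2)] by (auto simp: M_def xi_def lookup_add split: if_splits)
      qed
      have "e \<in> keys (D * g) \<union> keys (G * M * d)"
        using e keys_diff[of "D * g" "G * M * d"] unfolding h_def by auto
      then have "(\<exists>u v. e = u + v \<and> u \<in> keys D \<and> v \<in> keys g) \<or>
          (\<exists>u v. e = u + v \<and> u \<in> keys (G * M) \<and> v \<in> keys d)"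
        using keys_mult[of D g] keys_mult[of "G * M" d] by blast
      then have "bot g \<le> lookup e i \<and> lookup e i \<le> top' g"
      proof (elim disjE exE conjE)
        fix u v assume "e = u + v" "u \<in> keys D" "v \<in> keys g"
        then show ?thesis using S_deg[OF DG(1)] low_le[of v g "deg i"] le_top[of v g] by (simp add: lookup_add)
      next
        fix u v assume *: "e = u + v" "u \<in> keys (G * M)" "v \<in> keys d"
        have "top' d - bot d \<le> top' g - bot g"
          using wid bot_le_top[OF d(2)] bot_le_top[OF g0] by (simp add: wid_def)
        then show ?thesis using * GM[OF *(2)] low_le[of v d "deg i"] le_top[of v d] by (simp add: lookup_add)
      qed
      moreover have "lookup e i \<noteq> top' g"
      proof
        assume te: "lookup e i = top' g"
        have "part (deg i) (top' g) (D * g) = D * (xi (top' g) * G)"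
          using part_homogeneous_mult[OF additive_deg, of D i 0 "top' g" g] S_deg[OF DG(1)] part_coef[of "top' g" g]
          by (auto simp: G_def)
        moreover have "part (deg i) (top' g) (G * M * d) = G * M * (xi (top' d) * D)"
          using part_homogeneous_mult[OF additive_deg, of "G * M" i "top' g - top' d" "top' g" d] GM part_coef[of "top' d" d]
          by (auto simp: D_def)
        moreover have "M * xi (top' d) = xi (top' g)" by (simp add: M_def xi_mult)
        then have "D * (xi (top' g) * G) = G * M * (xi (top' d) * D)" by (simp add: mult_ac)
        ultimately have "part (deg i) (top' g) h = 0" by (simp add: h_def part_diff)
        then show False using e te by (auto simp: part_eq_0_iff)
      qed
      ultimately show ?thesis by simp
    qed
    have "h = 0 \<or> wid h < wid g"
    proof (cases "h = 0")
      case False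
      then obtain e1 e2 where "e1 \<in> keys h" "lookup e1 i = bot h" "e2 \<in> keys h" "lookup e2 i = top' h"
        using part_low[OF False, of "deg i"] part_low[OF False, of "\<lambda>e. - lookup e i"]
        by (force simp: part_eq_0_iff)
      then have "bot g \<le> bot h" "top' h < top' g" "bot h \<le> top' h"
        using bound bot_le_top[OF False] by fastforce+
      then show ?thesis by (simp add: wid_def)
    qed simp
    then have "\<exists>s\<in>S. \<exists>q\<in>T. \<exists>r\<in>T. s \<noteq> 0 \<and> s * h = q * d + r \<and> (r = 0 \<or> wid r < wid d)"
    proof
      assume "h = 0"
      then show ?thesis
        by (intro bexI[of _ 1] bexI[of _ 0] bexI[of _ 0]) (auto simp: is_subringD[OF S] is_subringD[OF T])
    qed (use less.hyps h in blast)
    then obtain s q r where sqr: "s \<in> S" "q \<in> T" "r \<in> T" "s \<noteq> 0" "s * h = q * d + r" "r = 0 \<or> wid r < wid d"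
      by blast
    have "(s * D) * g = (q + s * (G * M)) * d + r"
      using sqr(5) by (simp add: h_def algebra_simps)
    moreover have "q + s * (G * M) \<in> T"
      using sqr ST DGT MT by (intro is_subringD(5,6)[OF T]) auto
    moreover have "s * D \<in> S" "s * D \<noteq> 0" using sqr DG is_subringD(6)[OF S] by auto
    ultimately show ?thesis using sqr by blast
  qed
qed

definition primitive :: "'a laurent \<Rightarrow> bool" where
  "primitive a \<longleftrightarrow> a \<in> T \<and> a \<noteq> 0 \<and> (\<forall>p. prime_in S p \<longrightarrow> \<not> dvd_in T p a)"

lemma factor_S:
  assumes "s \<in> S" "s \<noteq> 0"
  obtains u ps where "unit_in S u" "\<And>p. p \<in> set ps \<Longrightarrow> prime_in S p" "s = u * prod_list ps"
  using fact assms unfolding prime_factorial_def by metis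

lemma prod_primes_T: "(\<And>p. p \<in> set ps \<Longrightarrow> prime_in S p) \<Longrightarrow> prod_list ps \<in> T"
  using ST prime_inD(1) by (intro is_subring_prod_list[OF T]) blast

lemma prod_primes_S: "(\<And>p. p \<in> set ps \<Longrightarrow> prime_in S p) \<Longrightarrow> prod_list ps \<in> S"
  using prime_inD(1) by (intro is_subring_prod_list[OF S]) blast

text \<open>The primes of \<open>s\<close> stay prime in \<open>T\<close> and do not divide
  \<open>a\<close>, so in \<open>s * b = a * y\<close> each of them divides the cofactor
  \<open>y\<close> and can be cancelled.\<close>

lemma primitive_cancel:
  assumes a: "primitive a" and s: "s \<in> S" "s \<noteq> 0" and b: "b \<in> T" and dvd: "dvd_in T a (s * b)"
  shows "dvd_in T a b"
proof -
  obtain u ps where ups: "unit_in S u" "\<And>p. p \<in> set ps \<Longrightarrow> prime_in S p" "s = u * prod_list ps"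
    using factor_S[OF s] by blast
  have primes: "dvd_in T a b" if "\<And>p. p \<in> set ps \<Longrightarrow> prime_in S p" "b \<in> T" "dvd_in T a (prod_list ps * b)" for ps b
    using that
  proof (induction ps)
    case (Cons p ps)
    have p: "prime_in S p" using Cons.prems by simp
    obtain y where y: "y \<in> T" "p * (prod_list ps * b) = a * y"
      using Cons.prems(3) by (auto simp: dvd_in_def mult.assoc)
    have "prod_list ps * b \<in> T"
      using Cons.prems(1,2) by (intro is_subringD(6)[OF T] prod_primes_T) auto
    then have "dvd_in T p (a * y)" unfolding y(2)[symmetric] by (rule dvd_inI) simp
    then have "dvd_in T p y"
      using prime_inD(4)[OF prime_S_T[OF p] _ y(1)] a p by (auto simp: primitive_def)
    then obtain z where z: "z \<in> T" "y = p * z" by (auto simp: dvd_in_def)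
    then have "p * (prod_list ps * b) = p * (a * z)" using y by (simp add: mult_ac)
    then have "prod_list ps * b = a * z" using prime_inD(2)[OF p] by simp
    then show ?case using Cons.IH Cons.prems(1,2) z(1) by (auto intro: dvd_inI)
  qed simp
  obtain v where v: "v \<in> S" "u * v = 1" using ups(1) by (auto simp: unit_in_def)
  have pb: "prod_list ps * b = v * (s * b)"
    using v(2) by (simp add: ups(3)) (metis mult.commute mult.left_commute mult_1)
  have "dvd_in T a (prod_list ps * b)"
    unfolding pb by (rule dvd_in_mult2[OF T dvd]) (use v(1) ST in blast)
  then show ?thesis using primes[OF ups(2) b] by blast
qed

text \<open>Each prime factor of \<open>s\<close> divides \<open>q\<close> or \<open>d\<close> and
  is cancelled there; the ones taken from \<open>d\<close> are collected in
  \<open>t\<close>.\<close>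

lemma distribute:
  assumes s: "s \<in> S" "s \<noteq> 0" and eq: "s * a = q * d" and T': "a \<in> T" "q \<in> T" "d \<in> T"
  shows "\<exists>q'\<in>T. \<exists>d'\<in>T. \<exists>t\<in>S. a = q' * d' \<and> d = t * d'"
proof -
  obtain u ps where ups: "unit_in S u" "\<And>p. p \<in> set ps \<Longrightarrow> prime_in S p" "s = u * prod_list ps"
    using factor_S[OF s] by blast
  have primes: "\<exists>q'\<in>T. \<exists>d'\<in>T. \<exists>t\<in>S. a = q' * d' \<and> d = t * d'"
    if "\<And>p. p \<in> set ps \<Longrightarrow> prime_in S p" "prod_list ps * a = q * d" "q \<in> T" "d \<in> T" for ps q d
    using that
  proof (induction ps arbitrary: q d)
    case Nil
    then show ?case
      by (intro bexI[of _ q] bexI[of _ d] bexI[of _ 1]) (auto simp: is_subringD[OF S])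
  next
    case (Cons p ps)
    have p: "prime_in S p" using Cons.prems by simp
    have "dvd_in T p (q * d)"
      unfolding Cons.prems(2)[symmetric] using Cons.prems(1) T'(1)
      by (intro dvd_inI[of "prod_list ps * a"] is_subringD(6)[OF T] prod_primes_T) (auto simp: mult.assoc)
    then have "dvd_in T p q \<or> dvd_in T p d"
      using prime_inD(4)[OF prime_S_T[OF p]] Cons.prems by blast
    then show ?case
    proof
      assume "dvd_in T p q"
      then obtain q1 where q1: "q1 \<in> T" "q = p * q1" by (auto simp: dvd_in_def)
      then have "p * (prod_list ps * a) = p * (q1 * d)" using Cons.prems(2) by (simp add: mult_ac)
      then have "prod_list ps * a = q1 * d" using prime_inD(2)[OF p] by simp
      then show ?thesis using Cons.IH[of q1 d] Cons.prems q1 by auto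
    next
      assume "dvd_in T p d"
      then obtain d1 where d1: "d1 \<in> T" "d = p * d1" by (auto simp: dvd_in_def)
      then have "p * (prod_list ps * a) = p * (q * d1)" using Cons.prems(2) by (simp add: mult_ac)
      then have "prod_list ps * a = q * d1" using prime_inD(2)[OF p] by simp
      then obtain q' d' t where "q' \<in> T" "d' \<in> T" "t \<in> S" "a = q' * d'" "d1 = t * d'"
        using Cons.IH[of q d1] Cons.prems d1 by auto
      then show ?thesis using d1(2) prime_inD(1)[OF p]
        by (intro bexI[of _ q'] bexI[of _ d'] bexI[of _ "p * t"]) (auto simp: mult.assoc is_subringD[OF S])
    qed
  qed
  obtain v where v: "v \<in> S" "u * v = 1" using ups(1) by (auto simp: unit_in_def)
  have "prod_list ps * a = v * (s * a)"
    using v(2) by (simp add: ups(3)) (metis mult.commute mult.left_commute mult_1)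
  then have "prod_list ps * a = (v * q) * d" using eq by (simp add: mult.assoc)
  moreover have "v * q \<in> T" using v(1) ST T'(2) is_subringD(6)[OF T] by blast
  ultimately show ?thesis using primes[of ps "v * q" d] ups(2) T'(3) by blast
qed

text \<open>Bezout over the fraction field of \<open>S\<close> in disguise. In the ideal of
  \<open>a\<close> and \<open>b\<close> an element \<open>d\<close> of least width divides every
  element up to a factor from \<open>S\<close>. If \<open>d\<close> has width 0, then
  \<open>a\<close> divides a multiple of \<open>c\<close> by an element of \<open>S\<close>;
  otherwise indecomposability makes \<open>a\<close> agree with \<open>d\<close> up to units and a
  factor from \<open>S\<close>, and \<open>a\<close> divides such a multiple of \<open>b\<close>.
  Primitivity removes the factor.\<close>

lemma prime_of_primitive:
  assumes a: "primitive a" "wid a > 0"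
    and irr: "\<And>c d. c \<in> T \<Longrightarrow> d \<in> T \<Longrightarrow> a = c * d \<Longrightarrow> wid c = 0 \<or> wid d = 0"
  shows "prime_in T a"
  unfolding prime_in_def
proof (intro conjI ballI impI)
  show aT: "a \<in> T" and a0: "a \<noteq> 0" using a(1) by (auto simp: primitive_def)
  show "\<not> unit_in T a"
  proof
    assume "unit_in T a"
    then obtain v where v: "v \<in> T" "a * v = 1" by (auto simp: unit_in_def)
    then have "v \<noteq> 0" by auto
    then have "wid a + wid v = wid 1" using wid_mult[OF a0, of v] v by simp
    also have "\<dots> = 0" using wid_S[of 1] is_subringD(1)[OF S] by simp
    finally show False using a(2) by simp
  qed
  fix b c assume b: "b \<in> T" and c: "c \<in> T" and dvd: "dvd_in T a (b * c)"
  define J where "J = {u * a + v * b | u v. u \<in> T \<and> v \<in> T}"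
  have J_T: "J \<subseteq> T" using aT b by (auto simp: J_def is_subringD[OF T])
  have aJ: "a \<in> J" unfolding J_def
    using is_subringD(1,2)[OF T] by (intro CollectI exI[of _ 1] exI[of _ 0]) auto
  have bJ: "b \<in> J" unfolding J_def
    using is_subringD(1,2)[OF T] by (intro CollectI exI[of _ 0] exI[of _ 1]) auto
  have J_comb: "s * g - q * d \<in> J" if sgqd: "s \<in> T" "q \<in> T" "g \<in> J" "d \<in> J" for s q g d
  proof -
    obtain u v u' v' where uv: "g = u * a + v * b" "u \<in> T" "v \<in> T" "d = u' * a + v' * b" "u' \<in> T" "v' \<in> T"
      using sgqd(3,4) by (auto simp: J_def)
    have "s * g - q * d = (s * u - q * u') * a + (s * v - q * v') * b"
      unfolding uv by (simp add: algebra_simps)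
    moreover have "s * u - q * u' \<in> T" "s * v - q * v' \<in> T"
      using sgqd uv by (auto simp: is_subringD[OF T])
    ultimately show ?thesis unfolding J_def by blast
  qed
  obtain d where d: "d \<in> J" "d \<noteq> 0" "\<And>r. r \<in> J \<Longrightarrow> r \<noteq> 0 \<Longrightarrow> wid d \<le> wid r"
    using exists_least_iff[of "\<lambda>n. \<exists>d\<in>J. d \<noteq> 0 \<and> wid d = n"] aJ a0
    by (metis not_le_imp_less)
  have dT: "d \<in> T" using d J_T by auto
  have multiple: "\<exists>s\<in>S. \<exists>q\<in>T. s \<noteq> 0 \<and> s * g = q * d" if g: "g \<in> J" for g
  proof -
    obtain s q r where sqr: "s \<in> S" "q \<in> T" "r \<in> T" "s \<noteq> 0" "s * g = q * d + r" "r = 0 \<or> wid r < wid d"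
      using pseudo_division[OF dT d(2), of g] g J_T by blast
    have "r = s * g - q * d" using sqr(5) by simp
    then have "r \<in> J" using J_comb[of s q g d] sqr ST g d(1) by auto
    then have "r = 0" using d(3)[of r] sqr(6) by force
    then show ?thesis using sqr by auto
  qed
  show "dvd_in T a b \<or> dvd_in T a c"
  proof (cases "wid d = 0")
    case True
    then obtain k s where s: "s \<in> S" "d = xi k * s" using wid_0[OF dT d(2)] by blast
    obtain u v where uv: "u \<in> T" "v \<in> T" "d = u * a + v * b" using d(1) by (auto simp: J_def)
    have "dvd_in T a (a * (u * c) + (b * c) * v)"
      using uv c by (intro dvd_in_add[OF T] dvd_in_mult[OF T] dvd dvd_inI[of "u * c"]) (auto simp: is_subringD[OF T])
    also have "a * (u * c) + (b * c) * v = d * c" unfolding uv(3) by (simp add: algebra_simps)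
    finally have "dvd_in T a (d * c * xi (- k))" using dvd_in_mult[OF T _ xi_T] by blast
    also have "d * c * xi (- k) = (xi k * xi (- k)) * (s * c)" unfolding s(2) by (simp only: mult_ac)
    finally have "dvd_in T a (s * c)" by (simp add: xi_mult)
    moreover have "s \<noteq> 0" using s d(2) by auto
    ultimately show ?thesis using primitive_cancel[OF a(1) s(1) _ c] by blast
  next
    case False
    obtain s1 q1 where 1: "s1 \<in> S" "q1 \<in> T" "s1 \<noteq> 0" "s1 * a = q1 * d" using multiple[OF aJ] by blast
    obtain s2 q2 where 2: "s2 \<in> S" "q2 \<in> T" "s2 \<noteq> 0" "s2 * b = q2 * d" using multiple[OF bJ] by blast
    obtain q' d' t where qd: "q' \<in> T" "d' \<in> T" "t \<in> S" "a = q' * d'" "d = t * d'"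
      using distribute[OF 1(1,3,4) aT 1(2) dT] by blast
    have nz: "q' \<noteq> 0" "d' \<noteq> 0" "t \<noteq> 0" using qd a0 d(2) by auto
    have "wid d' > 0" using False wid_mult[OF nz(3,2)] wid_S[OF qd(3) nz(3)] qd(5) by simp
    then have "wid q' = 0" using irr[OF qd(1,2,4)] by simp
    then obtain k s where s: "s \<in> S" "q' = xi k * s" using wid_0[OF qd(1) nz(1)] by blast
    have "s \<noteq> 0" using s nz by auto
    then obtain u ps where ups: "unit_in S u" "\<And>p. p \<in> set ps \<Longrightarrow> prime_in S p" "s = u * prod_list ps"
      using factor_S[OF s(1)] by blast
    \<comment> \<open>A prime of \<open>S\<close> occurring in \<open>q'\<close> would divide the
      primitive element \<open>a\<close>; so \<open>q'\<close> is a unit.\<close>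
    have "ps = []"
    proof (rule ccontr)
      assume "ps \<noteq> []"
      then obtain p ps' where ps: "ps = p # ps'" by (cases ps) auto
      have "a = p * (xi k * (u * prod_list ps') * d')"
        unfolding qd(4) s(2) ups(3) ps by (simp add: mult_ac)
      moreover have "xi k * (u * prod_list ps') * d' \<in> T"
        using ups ps qd(2) ST xi_T prod_primes_T[of ps'] by (auto simp: unit_in_def intro!: is_subringD(6)[OF T])
      ultimately have "dvd_in T p a" by (auto intro: dvd_inI)
      then show False using a(1) ups(2)[of p] ps by (auto simp: primitive_def)
    qed
    then have "unit_in S s" using ups by simp
    then obtain v where v: "v \<in> S" "s * v = 1" by (auto simp: unit_in_def)
    have "a * (v * xi (- k)) = d' * (s * v) * (xi k * xi (- k))"
      unfolding qd(4) s(2) by (simp only: mult_ac)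
    then have d': "d' = a * (v * xi (- k))" by (simp add: v(2) xi_mult)
    have "s2 * b = a * (v * xi (- k) * (q2 * t))"
      unfolding 2(4) qd(5) by (subst d') (simp only: mult_ac)
    moreover have "v * xi (- k) * (q2 * t) \<in> T"
      using v qd(3) 2(2) ST xi_T by (auto intro!: is_subringD(6)[OF T])
    ultimately have "dvd_in T a (s2 * b)" by (auto intro: dvd_inI)
    then show ?thesis using primitive_cancel[OF a(1) 2(1,3) b] by blast
  qed
qed

text \<open>A prime of \<open>S\<close> dividing \<open>a\<close> divides its leading coefficient,
  whose number of prime factors therefore bounds how often one can be split off.\<close>

lemma primitive_part:
  assumes "a \<in> T" "a \<noteq> 0"
  shows "\<exists>ps c. (\<forall>p\<in>set ps. prime_in S p) \<and> primitive c \<and> a = prod_list ps * c"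
proof -
  have "\<exists>ps c. (\<forall>p\<in>set ps. prime_in S p) \<and> primitive c \<and> a = prod_list ps * c"
    if "unit_in S u" "\<And>p. p \<in> set qs \<Longrightarrow> prime_in S p" "coef (top' a) a = u * prod_list qs" "a \<in> T" "a \<noteq> 0" for u qs a
    using that
  proof (induction "length qs" arbitrary: u qs a)
    case (0 qs u a)
    have lead: "unit_in S (coef (top' a) a)" using 0 by simp
    have "\<not> dvd_in T p a" if "prime_in S p" for p
      using dvd_T_iff[OF prime_inD(1)[OF that] 0(5)] prime_dvd_unit[OF S that lead] by blast
    then have "primitive a" using 0 by (auto simp: primitive_def)
    then show ?case by (intro exI[of _ "[]"] exI[of _ a]) simp
  next
    case (Suc n qs u a)
    show ?case
    proof (cases "primitive a")
      case True
      then show ?thesis by (intro exI[of _ "[]"] exI[of _ a]) simp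
    next
      case False
      then obtain p where p: "prime_in S p" "dvd_in T p a" using Suc.prems by (auto simp: primitive_def)
      then obtain c where c: "c \<in> T" "a = p * c" by (auto simp: dvd_in_def)
      have pS: "p \<in> S" "p \<noteq> 0" using prime_inD[OF p(1)] by auto
      have c0: "c \<noteq> 0" using c Suc.prems by auto
      have qsS: "set qs \<subseteq> S" using Suc.prems(2) prime_inD(1) by blast
      have "dvd_in S p (u * prod_list qs)"
        using p(2) dvd_T_iff[OF pS(1) Suc.prems(4)] Suc.prems(3) by metis
      then have "dvd_in S p (prod_list qs)"
        using prime_inD(4)[OF p(1), of u "prod_list qs"] prime_dvd_unit[OF S p(1) Suc.prems(1)]
          Suc.prems(1) is_subring_prod_list[OF S qsS] by (auto simp: unit_in_def)
      then obtain q where q: "q \<in> set qs" "dvd_in S p q"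
        using prime_dvd_prod_list[OF S p(1) qsS] by blast
      obtain w where w: "unit_in S w" "q = p * w"
        using prime_dvd_prime[OF S p(1) Suc.prems(2)[OF q(1)] q(2)] by blast
      have "top' p = 0"
      proof -
        have "(\<lambda>e. - lookup e i) ` keys p = {0}"
          using pS S_deg[OF pS(1)] by (auto simp: image_iff keys_eq_empty[symmetric] simp del: keys_eq_empty)
        then show ?thesis by (simp add: low_def)
      qed
      then have "coef (top' p) p = p" using coef_mult_S[OF pS(1), of 0 1] coef_one by simp
      then have "p * coef (top' c) c = u * prod_list qs"
        using lead_mult[OF pS(2) c0] Suc.prems(3) c(2) by simp
      also have "prod_list qs = q * prod_list (remove1 q qs)"
        using q(1) by (rule prod_list_remove1)
      finally have "p * coef (top' c) c = p * ((u * w) * prod_list (remove1 q qs))"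
        unfolding w(2) by (simp only: mult_ac)
      then have lead: "coef (top' c) c = (u * w) * prod_list (remove1 q qs)" using pS(2) by simp
      have "\<exists>ps d. (\<forall>p\<in>set ps. prime_in S p) \<and> primitive d \<and> c = prod_list ps * d"
      proof (rule Suc.hyps(1)[OF _ unit_in_mult[OF S Suc.prems(1) w(1)] _ lead c(1) c0])
        show "n = length (remove1 q qs)" using q(1) Suc.hyps(2) by (simp add: length_remove1)
        show "prime_in S r" if "r \<in> set (remove1 q qs)" for r
          by (rule Suc.prems(2)) (rule subsetD[OF set_remove1_subset that])
      qed
      then obtain ps d where "\<forall>p\<in>set ps. prime_in S p" "primitive d" "c = prod_list ps * d" by blast
      then show ?thesis using p(1) c(2) by (intro exI[of _ "p # ps"] exI[of _ d]) (simp add: mult.assoc)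
    qed
  qed
  moreover obtain u qs where "unit_in S u" "\<And>p. p \<in> set qs \<Longrightarrow> prime_in S p" "coef (top' a) a = u * prod_list qs"
    using factor_S[OF coef_S[OF assms(1)] lead_neq_0[OF assms(2)]] by blast
  ultimately show ?thesis using assms by blast
qed

text \<open>Induction on the width. Width 0 leads back to \<open>S\<close>; if no splitting into two
  elements of positive width exists, the primitive part is prime.\<close>

theorem prime_factorial_T: "prime_factorial T"
  unfolding prime_factorial_def
proof (intro ballI impI)
  fix a assume "a \<in> T" "a \<noteq> 0"
  then show "\<exists>u ps. unit_in T u \<and> (\<forall>p\<in>set ps. prime_in T p) \<and> a = u * prod_list ps"
  proof (induction "wid a" arbitrary: a rule: less_induct)
    case less
    consider "wid a = 0" | c d where "c \<in> T" "d \<in> T" "a = c * d" "wid c > 0" "wid d > 0"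
      | "wid a > 0" "\<And>c d. c \<in> T \<Longrightarrow> d \<in> T \<Longrightarrow> a = c * d \<Longrightarrow> wid c = 0 \<or> wid d = 0"
      by blast
    then show ?case
    proof cases
      case 1
      then obtain k s where s: "s \<in> S" "a = xi k * s" using wid_0 less.prems by blast
      then have "s \<noteq> 0" using less.prems by auto
      then obtain u ps where "unit_in S u" "\<And>p. p \<in> set ps \<Longrightarrow> prime_in S p" "s = u * prod_list ps"
        using factor_S[OF s(1)] by blast
      then show ?thesis using s unit_in_mult[OF T xi_unit unit_in_mono[OF _ ST]] prime_S_T
        by (intro exI[of _ "xi k * u"] exI[of _ ps]) (auto simp: mult.assoc)
    next
      case 2
      have nz: "c \<noteq> 0" "d \<noteq> 0" using 2 less.prems by auto
      then have "wid c < wid a" "wid d < wid a" using 2 wid_mult[OF nz] by auto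
      then obtain u ps v qs where "unit_in T u" "\<forall>p\<in>set ps. prime_in T p" "c = u * prod_list ps"
        "unit_in T v" "\<forall>p\<in>set qs. prime_in T p" "d = v * prod_list qs"
        using less.hyps[of c] less.hyps[of d] 2 nz by blast
      then show ?thesis using 2 unit_in_mult[OF T]
        by (intro exI[of _ "u * v"] exI[of _ "ps @ qs"]) (auto simp: mult_ac)
    next
      case 3
      obtain ps c where ps: "\<forall>p\<in>set ps. prime_in S p" "primitive c" "a = prod_list ps * c"
        using primitive_part[OF less.prems] by blast
      have psS: "prod_list ps \<in> S" "prod_list ps \<in> T" using ps(1) prod_primes_S prod_primes_T by auto
      have nz: "prod_list ps \<noteq> 0" "c \<noteq> 0" using ps less.prems by auto
      have wid: "wid a = wid c" using wid_mult[OF nz] wid_S[OF psS(1) nz(1)] ps(3) by simp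
      have "prime_in T c"
      proof (rule prime_of_primitive[OF ps(2)])
        show "0 < wid c" using 3 wid by simp
        fix c1 d assume cd: "c1 \<in> T" "d \<in> T" "c = c1 * d"
        have "c1 \<noteq> 0" using cd nz by auto
        have "wid (prod_list ps * c1) = 0 \<or> wid d = 0"
          using 3(2)[of "prod_list ps * c1" d] cd psS ps(3) is_subringD(6)[OF T] by (auto simp: mult.assoc)
        then show "wid c1 = 0 \<or> wid d = 0"
          using wid_mult[OF nz(1) \<open>c1 \<noteq> 0\<close>] by auto
      qed
      then show ?thesis using ps prime_S_T unit_in_one[OF T]
        by (intro exI[of _ 1] exI[of _ "ps @ [c]"]) auto
    qed
  qed
qed

end

lemma prime_factorial_lau:
  assumes "is_subring (K :: 'a::idom set)" "prime_factorial (lau K {})" "finite I"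
  shows "prime_factorial (lau K I)"
  using assms(3)
proof (induction I rule: finite_induct)
  case (insert i I)
  interpret gauss K I i using insert assms by unfold_locales
  show ?case by (rule prime_factorial_T)
qed (rule assms(2))

section \<open>Evaluation of Laurent polynomials\<close>

text \<open>Vanishing arguments are replaced by \<open>1\<close>, so that evaluation is multiplicative for every \<open>x\<close>.\<close>

definition mono_eval :: "(nat \<Rightarrow> 'g::field) \<Rightarrow> (nat \<Rightarrow>\<^sub>0 int) \<Rightarrow> 'g" where
  "mono_eval x e = (\<Prod>k\<in>keys e. (if x k = 0 then 1 else x k) powi lookup e k)"

definition laurent_eval :: "('a::comm_ring_1 \<Rightarrow> 'g::field) \<Rightarrow> (nat \<Rightarrow> 'g) \<Rightarrow> 'a laurent \<Rightarrow> 'g" where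
  "laurent_eval h x p = (\<Sum>e\<in>keys p. h (lookup p e) * mono_eval x e)"

lemma mono_eval_superset:
  assumes "finite A" "keys e \<subseteq> A"
  shows "mono_eval x e = (\<Prod>k\<in>A. (if x k = 0 then 1 else x k) powi lookup e k)"
  unfolding mono_eval_def using assms
  by (intro prod.mono_neutral_left) (auto simp: in_keys_iff)

lemma mono_eval_0 [simp]: "mono_eval x 0 = 1"
  by (simp add: mono_eval_def)

lemma mono_eval_add: "mono_eval x (a + b) = mono_eval x a * mono_eval x b"
proof -
  let ?A = "keys a \<union> keys b"
  have "mono_eval x (a + b) = (\<Prod>k\<in>?A. (if x k = 0 then 1 else x k) powi lookup (a + b) k)"
    by (rule mono_eval_superset) (simp_all add: keys_add)
  also have "\<dots> = (\<Prod>k\<in>?A. (if x k = 0 then 1 else x k) powi lookup a k) *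
      (\<Prod>k\<in>?A. (if x k = 0 then 1 else x k) powi lookup b k)"
    unfolding prod.distrib[symmetric] by (intro prod.cong) (auto simp: lookup_add power_int_add)
  also have "\<dots> = mono_eval x a * mono_eval x b"
    by (subst (1 2) mono_eval_superset[of ?A]) auto
  finally show ?thesis .
qed

lemma mono_eval_single: "x k \<noteq> 0 \<Longrightarrow> mono_eval x (single k a) = x k powi a"
  using mono_eval_superset[of "{k}" "single k a" x] by simp

lemma mono_eval_cong: "(\<And>k. k \<in> keys e \<Longrightarrow> x k = y k) \<Longrightarrow> mono_eval x e = mono_eval y e"
  unfolding mono_eval_def by (intro prod.cong) auto

lemma mono_eval_expvec:
  "finite I \<Longrightarrow> mono_eval x (expvec I v) = (\<Prod>k\<in>I. (if x k = 0 then 1 else x k) powi v k)"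
  using mono_eval_superset[OF _ keys_expvec, of I x v] by (auto simp: lookup_expvec intro!: prod.cong)

text \<open>Three instances matter: the identity on the ambient field, and the integers mapped into
  the ambient field and into the fraction field of the integral Laurent ring.\<close>

locale coeff_hom =
  fixes h :: "'a::comm_ring_1 \<Rightarrow> 'g::field"
  assumes h_add: "h (a + b) = h a + h b" and h_mult: "h (a * b) = h a * h b" and h_1: "h 1 = 1"
begin

lemma h_0: "h 0 = 0"
  using h_add[of 0 0] by (metis add_cancel_right_right add_0)

abbreviation "ev \<equiv> laurent_eval h"

lemma ev_superset:
  assumes "finite A" "keys p \<subseteq> A"
  shows "ev x p = (\<Sum>e\<in>A. h (lookup p e) * mono_eval x e)"
  unfolding laurent_eval_def using assms
  by (intro sum.mono_neutral_left) (auto simp: in_keys_iff h_0)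

lemma ev_add: "ev x (p + q) = ev x p + ev x q"
proof -
  let ?A = "keys p \<union> keys q"
  have "ev x (p + q) = (\<Sum>e\<in>?A. h (lookup (p + q) e) * mono_eval x e)"
    by (rule ev_superset) (simp_all add: keys_add)
  also have "\<dots> = (\<Sum>e\<in>?A. h (lookup p e) * mono_eval x e) + (\<Sum>e\<in>?A. h (lookup q e) * mono_eval x e)"
    by (simp add: lookup_add h_add distrib_right sum.distrib)
  also have "\<dots> = ev x p + ev x q"
    by (subst (1 2) ev_superset[of ?A]) auto
  finally show ?thesis .
qed

lemma ev_0 [simp]: "ev x 0 = 0"
  by (simp add: laurent_eval_def)

lemma ev_single: "ev x (single e c) = h c * mono_eval x e"
  using ev_superset[of "{e}" "single e c" x] by simp

lemma ev_mon: "ev x (mon e) = mono_eval x e"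
  by (simp add: ev_single h_1)

lemma ev_1 [simp]: "ev x 1 = 1"
  using ev_mon[of x 0] by simp

lemma ev_uminus: "ev x (- p) = - ev x p"
  using ev_add[of x p "- p"] by (simp add: eq_neg_iff_add_eq_0 add.commute)

lemma ev_diff: "ev x (p - q) = ev x p - ev x q"
  using ev_add[of x p "- q"] by (simp add: ev_uminus)

lemma ev_sum: "ev x (sum f Z) = (\<Sum>z\<in>Z. ev x (f z))"
  by (induction Z rule: infinite_finite_induct) (auto simp: ev_add)

lemma ev_mult: "ev x (p * q) = ev x p * ev x q"
proof -
  have single: "ev x (single e c * q) = ev x (single e c) * ev x q" for e c
  proof (induction q rule: laurent_induct)
    case (add e' q)
    then show ?case
      by (simp add: distrib_left ev_add mult_single ev_single h_mult mono_eval_add mult_ac)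
  qed simp
  show ?thesis
    by (induction p rule: laurent_induct) (auto simp: distrib_right ev_add single)
qed

lemma ev_power: "ev x (p ^ k) = ev x p ^ k"
  by (induction k) (auto simp: ev_mult)

lemma ev_prod: "ev x (prod f Z) = (\<Prod>z\<in>Z. ev x (f z))"
  by (induction Z rule: infinite_finite_induct) (auto simp: ev_mult)

lemma ev_cong:
  assumes "\<And>e k. e \<in> keys p \<Longrightarrow> k \<in> keys e \<Longrightarrow> x k = y k"
  shows "ev x p = ev y p"
proof -
  have "mono_eval x e = mono_eval y e" if "e \<in> keys p" for e
    by (rule mono_eval_cong) (rule assms[OF that])
  then show ?thesis unfolding laurent_eval_def by (intro sum.cong) auto
qed

text \<open>Stated for Laurent polynomials, so that it is injectivity of the evaluation on
  \<open>lau K I\<close> and elements can be identified by their values.\<close>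

definition indep :: "'a set \<Rightarrow> nat set \<Rightarrow> (nat \<Rightarrow> 'g) \<Rightarrow> bool" where
  "indep K I x \<longleftrightarrow> (\<forall>p\<in>lau K I. ev x p = 0 \<longrightarrow> p = 0)"

lemma indep_inj:
  assumes "is_subring K" "indep K I x" "p \<in> lau K I" "q \<in> lau K I" "ev x p = ev x q"
  shows "p = q"
proof -
  have "p - q \<in> lau K I" using is_subringD(3)[OF is_subring_lau] assms by blast
  then show ?thesis using assms by (auto simp: indep_def ev_diff)
qed

text \<open>Evaluation treats a vanishing argument as 1, so \<open>x k = 0\<close> would give the
  variable and the constant 1 the same value.\<close>

lemma indep_nonzero:
  assumes "is_subring K" "indep K I x" "k \<in> I"
  shows "x k \<noteq> 0"
proof
  assume x: "x k = 0"
  have "mono_eval x (single k 1) = 1"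
    using mono_eval_superset[of "{k}" "single k 1" x] x by simp
  then have "ev x (mon (single k 1)) = ev x (mon 0)"
    by (simp add: ev_mon)
  moreover have "mon (single k 1) \<in> lau K I" "mon 0 \<in> lau K I"
    by (rule mon_lau; use assms in simp)+
  ultimately have eq: "mon (single k 1) = (mon 0 :: 'a laurent)"
    using indep_inj[OF assms(1,2)] by blast
  have "lookup (mon (single k 1)) (single k 1) = (1 :: 'a)" by simp
  moreover have "single k (1::int) \<noteq> 0" by (metis lookup_single_eq lookup_zero zero_neq_one)
  then have "lookup (mon 0) (single k 1) = (0 :: 'a)" by (simp add: lookup_one when_def)
  ultimately show False using eq by simp
qed

end

section \<open>Mutation of independent families\<close>

locale eval_seed = coeff_hom h for h :: "'a::{idom,ring_char_0} \<Rightarrow> 'g::field" +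
  fixes K :: "'a set" and I :: "nat set" and x :: "nat \<Rightarrow> 'g" and b :: "nat \<Rightarrow> nat \<Rightarrow> int" and k :: nat
  assumes K: "is_subring K" and I: "finite I" and ind: "indep K I x" and k: "k \<in> I" and bkk: "b k k = 0"
begin

abbreviation "f \<equiv> (exch I b :: nat \<Rightarrow> 'a laurent)"

definition "F = ev x (f k)"

definition "x1 = x(k := F / x k)"

lemma x_nz: "l \<in> I \<Longrightarrow> x l \<noteq> 0"
  using indep_nonzero[OF K ind] .

lemma F_nz: "F \<noteq> 0"
  using ind exch_lau[OF K I, of b k] exch_neq_0[OF I, of b k] by (auto simp: F_def indep_def)

lemma x1_nz: "l \<in> I \<Longrightarrow> x1 l \<noteq> 0"
  using x_nz x_nz[OF k] F_nz by (auto simp: x1_def)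

lemma ev_x1_free:
  assumes "\<And>e. e \<in> keys p \<Longrightarrow> lookup e k = 0"
  shows "ev x1 p = ev x p"
  by (rule ev_cong) (use assms in \<open>auto simp: x1_def in_keys_iff\<close>)

lemma f_free: "e \<in> keys (f k) \<Longrightarrow> lookup e k = 0"
  using exch_homogeneous[OF I, of b k k] bkk by blast

lemma mono_x1:
  assumes "lookup e k \<ge> 0"
  shows "mono_eval x1 e = ev x (mon (e - single k (lookup e k)) * (mon (single k (-1)) * f k) ^ nat (lookup e k))"
proof -
  let ?a = "lookup e k"
  have "mono_eval x1 e = mono_eval x1 (e - single k ?a) * mono_eval x1 (single k ?a)"
    by (simp flip: mono_eval_add)
  also have "mono_eval x1 (e - single k ?a) = mono_eval x (e - single k ?a)"
    by (rule mono_eval_cong) (auto simp: x1_def in_keys_iff lookup_minus)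
  also have "mono_eval x1 (single k ?a) = (F / x k) ^ nat ?a"
    using mono_eval_single[of x1 k ?a] x1_nz[OF k] assms by (simp add: x1_def power_int_def)
  finally show ?thesis
    using x_nz[OF k] by (simp add: ev_mult ev_power ev_mon mono_eval_single F_def divide_inverse mult.commute)
qed

text \<open>Substituting \<open>F / x_k\<close> for \<open>x_k\<close> and clearing denominators
  with \<open>F ^ M\<close> turns a relation into a Laurent polynomial \<open>Q\<close> in the old
  variables. Since \<open>f k\<close> is free of \<open>x_k\<close>, the part of \<open>Q\<close> of
  degree \<open>- c0\<close> comes from the coefficient of degree \<open>c0\<close> alone.\<close>

lemma indep_x1: "indep K I x1"
  unfolding indep_def
proof (intro ballI impI)
  fix p assume p: "p \<in> lau K I" and zero: "ev x1 p = 0"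
  show "p = 0"
  proof (rule ccontr)
    assume p0: "p \<noteq> 0"
    define Z where "Z = deg k ` keys p"
    define r where "r c = mon (single k (- c)) * part (deg k) c p" for c
    \<comment> \<open>Any bound on the pole order of \<open>p\<close> at \<open>x_k\<close> will do;
      the sum of the absolute values of the degrees is one.\<close>
    obtain M :: nat where M: "\<And>c. c \<in> Z \<Longrightarrow> 0 \<le> c + int M"
    proof
      fix c assume c: "c \<in> Z"
      have "- c \<le> \<bar>c\<bar>" by simp
      also have "\<bar>c\<bar> \<le> (\<Sum>c\<in>Z. \<bar>c\<bar>)" using c by (intro member_le_sum) (auto simp: Z_def)
      finally show "0 \<le> c + int (nat (\<Sum>c\<in>Z. \<bar>c\<bar>))" by simp
    qed
    have r_free: "lookup e k = 0" if e: "e \<in> keys (r c)" for c e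
    proof -
      have "e \<in> {u + v | u v. u \<in> keys (mon (single k (- c)) :: 'a laurent) \<and> v \<in> keys (part (deg k) c p)}"
        using keys_mult e unfolding r_def by blast
      then show ?thesis by (auto simp: keys_part lookup_add split: if_splits)
    qed
    have part_r: "part (deg k) c p = mon (single k c) * r c" for c
      by (simp add: r_def mult_single flip: mult.assoc single_add)
    define Q where "Q = (\<Sum>c\<in>Z. r c * f k ^ nat (c + int M) * mon (single k (- c)))"
    have term_lau: "r c * f k ^ nat (c + int M) * mon (single k (- c)) \<in> lau K I" for c
      unfolding r_def using p k
      by (intro is_subringD(6)[OF is_subring_lau[OF K]] is_subring_power[OF is_subring_lau[OF K]]
          lau_part exch_lau mon_lau K I) auto
    then have Q_lau: "Q \<in> lau K I"
      unfolding Q_def by (intro is_subring_sum[OF is_subring_lau[OF K]])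
    have "ev x1 p = ev x1 (\<Sum>c\<in>Z. part (deg k) c p)"
      unfolding Z_def by (simp flip: sum_parts)
    also have "\<dots> = (\<Sum>c\<in>Z. (F / x k) powi c * ev x (r c))"
    proof -
      have "mono_eval x1 (single k c) = (F / x k) powi c" for c
        using mono_eval_single[of x1 k c] x1_nz[OF k] by (simp add: x1_def)
      then show ?thesis unfolding ev_sum part_r ev_mult ev_mon by (simp add: ev_x1_free[OF r_free])
    qed
    finally have "0 = F ^ M * (\<Sum>c\<in>Z. (F / x k) powi c * ev x (r c))" using zero by simp
    also have "\<dots> = (\<Sum>c\<in>Z. ev x (r c * f k ^ nat (c + int M) * mon (single k (- c))))"
      unfolding sum_distrib_left
    proof (rule sum.cong)
      fix c assume c: "c \<in> Z"
      have "F ^ nat (c + int M) = F powi (c + int M)"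
        using M[OF c] by (simp add: power_int_def)
      also have "\<dots> = F powi c * F ^ M" using F_nz by (simp add: power_int_add)
      finally have "F ^ M * (F / x k) powi c = F ^ nat (c + int M) * x k powi (- c)"
        by (simp add: power_int_divide_distrib power_int_minus field_simps)
      then show "F ^ M * ((F / x k) powi c * ev x (r c)) = ev x (r c * f k ^ nat (c + int M) * mon (single k (- c)))"
        using x_nz[OF k] by (simp add: ev_mult ev_power ev_mon mono_eval_single F_def[symmetric] mult_ac)
    qed simp
    also have "\<dots> = ev x Q" by (simp add: Q_def ev_sum)
    finally have "Q = 0" using ind Q_lau by (simp add: indep_def)
    have "Z \<noteq> {}" using p0 by (simp add: Z_def)
    then obtain c0 where c0: "c0 \<in> Z" by blast
    have part_term: "part (deg k) (- c0) (r c * f k ^ nat (c + int M) * mon (single k (- c)))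
        = (if c = c0 then r c * f k ^ nat (c + int M) * mon (single k (- c)) else 0)" for c
    proof -
      have hom: "lookup e k = 0" if e: "e \<in> keys (r c * f k ^ nat (c + int M))" for e
      proof -
        have "e \<in> {u + v | u v. u \<in> keys (r c) \<and> v \<in> keys (f k ^ nat (c + int M))}"
          using keys_mult e by blast
        then show ?thesis using r_free keys_power_homogeneous[of "f k" k] f_free by (auto simp: lookup_add)
      qed
      show ?thesis
        using part_homogeneous_mult[OF additive_deg, of "r c * f k ^ nat (c + int M)" k 0 "- c0" "mon (single k (- c))"] hom
        by (auto simp: part_single)
    qed
    have "part (deg k) (- c0) Q = (\<Sum>c\<in>Z. if c = c0 then r c * f k ^ nat (c + int M) * mon (single k (- c)) else 0)"
      unfolding Q_def part_sum part_term ..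
    also have "\<dots> = r c0 * f k ^ nat (c0 + int M) * mon (single k (- c0))"
      using c0 by (simp add: Z_def)
    finally have "r c0 * f k ^ nat (c0 + int M) * mon (single k (- c0)) = 0"
      using \<open>Q = 0\<close> by simp
    moreover have "f k \<noteq> 0" by (rule exch_neq_0[OF I])
    ultimately have "r c0 = 0" by simp
    then have "part (deg k) c0 p = 0" by (simp add: part_r)
    then show False using c0 by (auto simp: part_eq_0_iff Z_def)
  qed
qed

end

section \<open>Matrix mutation\<close>

text \<open>In every sign pattern the dividend is twice the expression with positive parts, which is
  the form used in the matrix computations.\<close>

lemma mutate_matrix_alt:
  "mutate_matrix i b k l = (if k = i \<or> l = i then - b k l
     else b k l + max 0 (b k i) * b i l + b k i * max 0 (- b i l))"
proof -
  have "(\<bar>u\<bar> * v + u * \<bar>v\<bar>) div 2 = max 0 u * v + u * max 0 (- v)" for u v :: int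
  proof -
    have "\<bar>u\<bar> * v + u * \<bar>v\<bar> = 2 * (max 0 u * v + u * max 0 (- v))"
      by (cases "u \<ge> 0"; cases "v \<ge> 0") (auto simp: abs_if max_def)
    then show ?thesis by simp
  qed
  then show ?thesis by (simp add: mutate_matrix_def)
qed

lemma mutate_matrix_uminus:
  "mutate_matrix i (\<lambda>k l. - b k l) k l = - mutate_matrix i b k l"
proof -
  have "max 0 (- u) * (- v) + (- u) * max 0 v = - (max 0 u * v + u * max 0 (- v))" for u v :: int
    by (cases "u \<ge> 0"; cases "v \<ge> 0") (auto simp: max_def)
  from this[of "b k i" "b i l"] show ?thesis by (simp add: mutate_matrix_alt)
qed

lemma exchange_matrix_skew_signs:
  assumes "exchange_matrix n b"
  shows "skew_signs b {1..n}"
  unfolding skew_signs_def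
proof (intro ballI)
  fix i j assume ij: "i \<in> {1..n}" "j \<in> {1..n}"
  obtain d where d: "\<And>i. i \<in> {1..n} \<Longrightarrow> d i > 0"
    "\<And>i j. i \<in> {1..n} \<Longrightarrow> j \<in> {1..n} \<Longrightarrow> d i * b i j = - (d j * b j i)"
    using assms unfolding exchange_matrix_def by metis
  have "sgn (d i * b i j) = - sgn (d j * b j i)" using d(2)[OF ij] by (simp add: sgn_minus)
  then show "sgn (b i j) = - sgn (b j i)" using d(1)[OF ij(1)] d(1)[OF ij(2)] by (simp add: sgn_mult)
qed

text \<open>The same \<open>d\<close> works for the mutated matrix: multiplication by a positive
  \<open>d k\<close> commutes with taking positive parts.\<close>

lemma exchange_matrix_mutate:
  assumes "exchange_matrix n b" "i \<in> {1..n}"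
  shows "exchange_matrix n (mutate_matrix i b)"
proof -
  obtain d where d: "\<And>i. i \<in> {1..n} \<Longrightarrow> d i > 0"
    "\<And>i j. i \<in> {1..n} \<Longrightarrow> j \<in> {1..n} \<Longrightarrow> d i * b i j = - (d j * b j i)"
    using assms unfolding exchange_matrix_def by metis
  have "d k * mutate_matrix i b k l = - (d l * mutate_matrix i b l k)"
    if kl: "k \<in> {1..n}" "l \<in> {1..n}" for k l
  proof (cases "k = i \<or> l = i")
    case True
    then show ?thesis using d(2)[OF kl] by (auto simp: mutate_matrix_alt)
  next
    case False
    have max_d: "c > 0 \<Longrightarrow> c * max 0 u = max 0 (c * u)" for c u :: int
      by (auto simp: max_def zero_le_mult_iff)
    have kik: "d k * max 0 (b k i) = d i * max 0 (- b i k)"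
      using max_d[OF d(1)[OF kl(1)]] max_d[OF d(1)[OF assms(2)]] d(2)[OF kl(1) assms(2)] by simp
    have lil: "d l * max 0 (b l i) = d i * max 0 (- b i l)"
      using max_d[OF d(1)[OF kl(2)]] max_d[OF d(1)[OF assms(2)]] d(2)[OF kl(2) assms(2)] by simp
    have "d k * (max 0 (b k i) * b i l + b k i * max 0 (- b i l)) =
        d i * max 0 (- b i k) * b i l - d i * b i k * max 0 (- b i l)"
      using kik d(2)[OF kl(1) assms(2)] by (simp add: distrib_left flip: mult.assoc)
    moreover have "d l * (max 0 (b l i) * b i k + b l i * max 0 (- b i k)) =
        d i * max 0 (- b i l) * b i k - d i * b i l * max 0 (- b i k)"
      using lil d(2)[OF kl(2) assms(2)] by (simp add: distrib_left flip: mult.assoc)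
    ultimately have "d k * (max 0 (b k i) * b i l + b k i * max 0 (- b i l)) =
        - (d l * (max 0 (b l i) * b i k + b l i * max 0 (- b i k)))"
      by (simp add: algebra_simps)
    then show ?thesis using d(2)[OF kl] False by (simp add: mutate_matrix_alt distrib_left)
  qed
  then show ?thesis using d(1) unfolding exchange_matrix_def by blast
qed

definition full_rank :: "nat \<Rightarrow> nat set \<Rightarrow> (nat \<Rightarrow> nat \<Rightarrow> int) \<Rightarrow> bool" where
  "full_rank n I b \<longleftrightarrow> (\<forall>c. (\<forall>k\<in>I. (\<Sum>l\<in>{1..n}. b k l * c l) = 0) \<longrightarrow> (\<forall>l\<in>{1..n}. c l = 0))"

text \<open>Mutation is an invertible row and column operation. A kernel vector \<open>c\<close> of
  the mutated matrix is turned into one of \<open>b\<close> by changing only its entry at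
  \<open>i\<close>.\<close>

lemma full_rank_mutate:
  assumes "full_rank n I b" "i \<in> {1..n}" "i \<in> I" "b i i = 0"
  shows "full_rank n I (mutate_matrix i b)"
  unfolding full_rank_def
proof (intro allI impI)
  fix c assume c: "\<forall>k\<in>I. (\<Sum>l\<in>{1..n}. mutate_matrix i b k l * c l) = 0"
  let ?J = "{1..n} - {i}"
  \<comment> \<open>The new entry collects the terms \<open>b k i * max 0 (- b i l)\<close> of the
    mutated rows; the terms with \<open>max 0 (b k i)\<close> drop out by the equation of row
    \<open>i\<close>.\<close>
  define c' where "c' = c(i := (\<Sum>l\<in>?J. max 0 (- b i l) * c l) - c i)"
  have split: "(\<Sum>l\<in>{1..n}. g l) = g i + (\<Sum>l\<in>?J. g l)" for g :: "nat \<Rightarrow> int"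
    by (rule sum.remove) (use assms in auto)
  have row_i: "(\<Sum>l\<in>?J. b i l * c l) = 0"
    using c assms(3,4) split[of "\<lambda>l. mutate_matrix i b i l * c l"]
    by (force simp: mutate_matrix_alt sum_negf)
  have c'_J: "(\<Sum>l\<in>?J. g l * c' l) = (\<Sum>l\<in>?J. g l * c l)" for g
    by (rule sum.cong) (auto simp: c'_def)
  have "(\<Sum>l\<in>{1..n}. b k l * c' l) = 0" if k: "k \<in> I" for k
  proof (cases "k = i")
    case True
    then show ?thesis
      unfolding split[of "\<lambda>l. b k l * c' l"] using row_i assms(4) by (simp add: c'_J del: One_nat_def)
  next
    case False
    have "0 = (\<Sum>l\<in>{1..n}. mutate_matrix i b k l * c l)" using c k by simp
    also have "\<dots> = - b k i * c i + (\<Sum>l\<in>?J. mutate_matrix i b k l * c l)"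
      unfolding split[of "\<lambda>l. mutate_matrix i b k l * c l"] by (simp add: mutate_matrix_alt)
    also have "(\<Sum>l\<in>?J. mutate_matrix i b k l * c l) =
        (\<Sum>l\<in>?J. b k l * c l + max 0 (b k i) * (b i l * c l) + b k i * (max 0 (- b i l) * c l))"
      using False by (intro sum.cong) (auto simp: mutate_matrix_alt algebra_simps)
    also have "\<dots> = (\<Sum>l\<in>?J. b k l * c l) + b k i * (\<Sum>l\<in>?J. max 0 (- b i l) * c l)"
      unfolding sum.distrib sum_distrib_left[symmetric] row_i by simp
    finally show ?thesis
      unfolding split[of "\<lambda>l. b k l * c' l"] c'_J by (simp add: c'_def algebra_simps)
  qed
  then have z: "\<forall>l\<in>{1..n}. c' l = 0" using assms(1) unfolding full_rank_def by blast
  have J0: "c l = 0" if "l \<in> ?J" for l using bspec[OF z, of l] that by (auto simp: c'_def)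
  then have "(\<Sum>l\<in>?J. max 0 (- b i l) * c l) = 0" by (intro sum.neutral) auto
  then have "c i = 0" using bspec[OF z assms(2)] by (simp add: c'_def)
  with J0 show "\<forall>l\<in>{1..n}. c l = 0" by (metis DiffI singletonD)
qed

text \<open>Linear independence of the columns \<open>i\<close> and \<open>j\<close> provides a grading for which \<open>f\<^sub>i\<close> is
  homogeneous while the lowest part of \<open>f\<^sub>j\<close> is a monomial; hence \<open>f\<^sub>i\<close> divides the lowest
  part of \<open>g\<close> whenever it divides \<open>f\<^sub>j g\<close>.\<close>

lemma coprime_exch_full_rank:
  fixes K :: "'a::idom set"
  assumes K: "is_subring K" and I: "finite I" and rank: "full_rank n I b"
  shows "coprime_exch K I b {1..n}"
  unfolding coprime_exch_def
proof (intro ballI impI)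
  note L = is_subring_lau[OF K, of I]
  fix i j and g :: "'a laurent"
  assume ij: "i \<in> {1..n}" "j \<in> {1..n}" "i \<noteq> j" and g: "g \<in> lau K I"
    and dvd: "dvd_in (lau K I) (exch I b i) (exch I b j * g)"
  have col: "\<exists>k\<in>I. s * b k i + t * b k j \<noteq> 0" if "s \<noteq> 0 \<or> t \<noteq> 0" for s t
  proof (rule ccontr)
    assume contr: "\<not> ?thesis"
    define c where "c = (\<lambda>_. 0)(i := s, j := t)"
    have "(\<Sum>l\<in>{1..n}. b k l * c l) = b k i * s + b k j * t" for k
    proof -
      have "(\<Sum>l\<in>{1..n}. b k l * c l) = (\<Sum>l\<in>{i, j}. b k l * c l)"
        using ij by (intro sum.mono_neutral_right) (auto simp: c_def)
      then show ?thesis using ij by (simp add: c_def)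
    qed
    then have "\<forall>k\<in>I. (\<Sum>l\<in>{1..n}. b k l * c l) = 0" using contr by (simp add: mult.commute)
    then have "c i = 0" "c j = 0" using rank ij unfolding full_rank_def by blast+
    then show False using that ij by (simp add: c_def)
  qed
  obtain p where p: "p \<in> I" "b p i \<noteq> 0" using col[of 1 0] by auto
  \<comment> \<open>The coefficients are chosen so that the combination is the 2-by-2 minor of the
    columns \<open>i\<close> and \<open>j\<close> in rows \<open>p\<close> and \<open>q\<close>;
    independence of the columns makes it nonzero for some \<open>q\<close>.\<close>
  obtain q where q: "q \<in> I" "b p i * b q j - b q i * b p j \<noteq> 0"
    using col[of "- b p j" "b p i"] p(2) by (auto simp: mult.commute)
  define \<delta> where "\<delta> = b p i * b q j - b q i * b p j"
  \<comment> \<open>The minor with column \<open>j\<close> replaced by the exponent vector, so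
    column \<open>i\<close> has weight 0; the sign of \<delta> makes the first monomial of
    \<open>f_j\<close> the heavier one.\<close>
  define w where "w e = sgn \<delta> * (b p i * lookup e q - b q i * lookup e p)" for e :: "nat \<Rightarrow>\<^sub>0 int"
  have add: "additive_fun w" by (simp add: additive_fun_def w_def lookup_add algebra_simps)
  have pn: "lookup (posvec I b l) a - lookup (negvec I b l) a = b a l" if "a \<in> I" for a l
    using that by (simp add: lookup_posvec[OF I] lookup_negvec[OF I])
  have w_diff: "w (posvec I b l) - w (negvec I b l) = sgn \<delta> * (b p i * b q l - b q i * b p l)" for l
  proof -
    have "w u - w v = sgn \<delta> * (b p i * (lookup u q - lookup v q) - b q i * (lookup u p - lookup v p))" for u v
      by (simp add: w_def algebra_simps)
    then show ?thesis by (simp only: pn p(1) q(1))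
  qed
  have wi: "w (posvec I b i) = w (negvec I b i)" using w_diff[of i] by simp
  have "w (posvec I b j) - w (negvec I b j) = \<bar>\<delta>\<bar>" using w_diff[of j] by (simp add: \<delta>_def abs_sgn mult.commute)
  then have wj: "w (negvec I b j) < w (posvec I b j)" using q(2) by (simp add: \<delta>_def)
  have hom: "part w a (exch I b i * r) = exch I b i * part w (a - w (negvec I b i)) r" for a and r :: "'a laurent"
    by (rule part_homogeneous_mult[OF add]) (use exch_keys[of _ I b i] wi in fastforce)
  have dvd_part: "dvd_in (lau K I) (exch I b i) (part w a r)"
    if "dvd_in (lau K I) (exch I b i) r" for a r
    using that unfolding dvd_in_def by (auto simp: hom intro!: lau_part K)
  \<comment> \<open>Induction on the number of weights in \<open>g\<close>: its lowest part is
    divisible, since the lowest part of \<open>f_j\<close> is a unit, and is then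
    subtracted.\<close>
  show "dvd_in (lau K I) (exch I b i) g"
    using g dvd
  proof (induction "card (w ` keys g)" arbitrary: g rule: less_induct)
    case less
    show ?case
    proof (cases "g = 0")
      case True
      then show ?thesis by (simp add: dvd_in_0 L)
    next
      case False
      let ?a = "low w g" and ?g = "part w (low w g) g"
      have g_lau: "?g \<in> lau K I" using less.prems(1) by (rule lau_part[OF K])
      have "part w (w (negvec I b j) + ?a) (exch I b j * g) = part w (w (negvec I b j)) (exch I b j) * ?g"
        by (rule part_mult_lowest[OF add]) (use exch_keys[of _ I b j] wj low_le in \<open>force+\<close>)
      also have "part w (w (negvec I b j)) (exch I b j) = (mon (negvec I b j) :: 'a laurent)"
        using wj by (simp add: exch_def part_add part_single)
      finally have "dvd_in (lau K I) (exch I b i) (mon (negvec I b j) * ?g)"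
        using dvd_part[OF less.prems(2)] by metis
      then have "dvd_in (lau K I) (exch I b i) (mon (- negvec I b j) * (mon (negvec I b j) * ?g))"
        by (rule dvd_in_mult2[OF L]) (use keys_negvec[OF I, of b j] in \<open>auto intro!: mon_lau K\<close>)
      then have g1: "dvd_in (lau K I) (exch I b i) ?g" by simp
      have keys: "w ` keys (g - ?g) = w ` keys g - {?a}"
      proof -
        have "keys (g - ?g) = {e \<in> keys g. w e \<noteq> ?a}"
          by (auto simp: in_keys_iff lookup_minus lookup_part split: if_splits)
        then show ?thesis by auto
      qed
      have "?a \<in> w ` keys g" unfolding low_def using False by (intro Min_in) auto
      then have "card (w ` keys (g - ?g)) < card (w ` keys g)"
        unfolding keys by (intro psubset_card_mono) auto
      moreover have "g - ?g \<in> lau K I" using less.prems(1) g_lau by (rule is_subringD(3)[OF L])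
      moreover have "dvd_in (lau K I) (exch I b i) (exch I b j * (g - ?g))"
        unfolding right_diff_distrib
        by (intro dvd_in_diff[OF L] less.prems(2) dvd_in_mult2[OF L g1] exch_lau K I)
      ultimately have "dvd_in (lau K I) (exch I b i) (g - ?g)" by (rule less.hyps)
      from dvd_in_add[OF L this g1] show ?thesis by simp
    qed
  qed
qed

section \<open>The upper bound is invariant under mutation of generic seeds\<close>

lemma lower_alg_mon:
  "is_subring K \<Longrightarrow> keys s \<subseteq> I \<Longrightarrow> (\<And>j. j \<in> E \<Longrightarrow> 0 \<le> lookup s j) \<Longrightarrow> mon s \<in> lower_alg K I E g"
  by (rule lower_alg_single) (auto simp: is_subringD)

lemma lower_alg_quotient:
  assumes K: "is_subring K" and I: "finite I" and k: "k \<in> I"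
  shows "mon (single k (-1)) * exch I b k \<in> lower_alg K I {j} (exch I b)"
proof (cases "k = j")
  case True
  have "single (single k (-1)) 1 * (\<Prod>j\<in>{j}. exch I b j ^ 1) \<in> lower_alg K I {j} (exch I b)"
    by (rule lower_alg_term) (use K k True in \<open>auto simp: is_subringD\<close>)
  then show ?thesis using True by simp
next
  case False
  show ?thesis
    by (rule lower_alg_mult[OF K lower_alg_mon[OF K] exch_lower_alg[OF K I]])
      (use k False in \<open>auto simp: lookup_single when_def\<close>)
qed

text \<open>Two indices cannot form an oriented cycle because the signs are opposite; hence the
  acyclic theorem is available for pairs in every seed.\<close>

lemma acyclic_on_pair:
  assumes "skew_signs b {i, j}"
  shows "acyclic_on b {i, j}"
  unfolding acyclic_on_def
proof (intro allI impI)
  fix D assume D: "D \<subseteq> {i, j}" "D \<noteq> {}"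
  have diag: "b i i = 0" "b j j = 0" using skew_signs_diag[OF assms] by auto
  have "b i j \<le> 0 \<or> b j i \<le> 0"
    using skew_signs_nonneg[OF assms, of i j] skew_signs_nonneg[OF assms, of j i] skew_signsD[OF assms, of i j]
    by (auto simp: sgn_if split: if_splits)
  moreover have "D = {i} \<or> D = {j} \<or> D = {i, j}" using D by blast
  ultimately show "\<exists>e\<in>D. \<forall>k\<in>D. b k e \<le> 0"
    using diag by auto
qed

lemma exch_uminus: "exch I (\<lambda>k l. - b k l) j = exch I b j"
  by (simp add: exch_def posvec_def negvec_def add.commute)

lemma exch_cong: "(\<And>k. k \<in> I \<Longrightarrow> b k j = b' k j) \<Longrightarrow> exch I b j = exch I b' j"
  unfolding exch_def posvec_def negvec_def expvec_def by simp

context eval_seed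
begin

abbreviation "b1 \<equiv> mutate_matrix k b"
abbreviation "f1 \<equiv> (exch I b1 :: nat \<Rightarrow> 'a laurent)"
abbreviation "y \<equiv> (mon (single k (-1)) * f k :: 'a laurent)"

lemma f1_k: "f1 k = f k"
proof -
  have "f1 k = exch I (\<lambda>k l. - b k l) k"
    by (rule exch_cong) (simp add: mutate_matrix_alt)
  then show ?thesis by (simp add: exch_uminus)
qed

text \<open>Write \<open>f k = S + N\<close>, where \<open>N\<close> contains \<open>x_j\<close>,
  and \<open>f j = P * x_k ^ c + Q\<close>. Up to the monomial \<mu>, the new exchange polynomial at
  \<open>j\<close> has the value \<open>P * S ^ c + y ^ c * Q\<close> with
  \<open>y = f k / x_k\<close>. This equals \<open>y ^ c * f j - P * N * H\<close>, where
  \<open>N * H = (S + N) ^ c - S ^ c\<close>. On division by \<open>x_j\<close>, the first term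
  contains the generator \<open>f j / x_j\<close>, and in the second one \<open>N\<close> absorbs
  the division.\<close>

lemma new_variable_nonneg:
  assumes j: "j \<in> I" "j \<noteq> k" and bjj: "b j j = 0" and sign: "0 < b k j" "b j k < 0"
  shows "\<exists>q \<in> lower_alg K I {j} f \<inter> lower_alg K I {k} f. ev x q = ev x1 (mon (single j (-1)) * f1 j)"
proof -
  define c where "c = nat (b k j)"
  \<comment> \<open>The cancellation that occurs when the entries of the mutated column are split
    into positive and negative parts; it affects both monomials equally.\<close>
  define \<mu> where "\<mu> = negvec I b1 j - single k (int c) - negvec I b j"
  define P where "P = posvec I b j - single k (int c)"
  have c: "int c = b k j" using sign by (simp add: c_def)
  have b1: "b1 l j = (if l = k then - b k j else b l j + max 0 (b l k) * b k j)" for l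
    using j(2) sign(1) by (simp add: mutate_matrix_alt)
  have b1jj: "b1 j j = 0" using j(2) bjj sign by (simp add: b1)
  note lk = lookup_posvec[OF I] lookup_negvec[OF I] lookup_minus lookup_add lookup_single
  obtain t where t: "(mon (posvec I b k) :: 'a laurent) ^ c = mon t" "\<And>l. lookup t l = int c * lookup (posvec I b k) l"
    using mon_power_obtain by blast
  have t_k: "lookup t k = 0" and t_j: "lookup t j = 0"
    using bkk sign by (simp_all add: t(2) lk)
  have pos1: "posvec I b1 j = \<mu> + P + t"
  proof (rule poly_mapping_eqI)
    fix l
    show "lookup (posvec I b1 j) l = lookup (\<mu> + P + t) l"
    proof (cases "l = k")
      case True
      then show ?thesis using k c sign bkk
        unfolding \<mu>_def P_def lookup_add t(2) by (simp add: lk b1)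
    next
      case False
      have "max 0 u = max 0 (- u) - max 0 (- v) + max 0 v + (u - v)" for u v :: int
        by (auto simp: max_def)
      from this[of "b l j + max 0 (b l k) * b k j" "b l j"] show ?thesis
        using False c unfolding \<mu>_def P_def lookup_add t(2) by (simp add: lk b1 when_def)
    qed
  qed
  have neg1: "negvec I b1 j - single k (int c) = \<mu> + negvec I b j"
    by (simp add: \<mu>_def)
  have \<mu>k: "lookup \<mu> k = 0" using k c sign by (simp add: \<mu>_def lk b1)
  have \<mu>j: "lookup \<mu> j = 0" using j(2) b1jj bjj by (simp add: \<mu>_def lk when_def)
  have Pk: "lookup P k = 0" using k c sign by (simp add: P_def lk)
  have Pj: "lookup P j = 0" using j(2) bjj by (simp add: P_def lk when_def)
  have keys_\<mu>: "keys \<mu> \<subseteq> I" and keys_P: "keys P \<subseteq> I"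
    using k by (auto simp: \<mu>_def P_def in_keys_iff lk when_def split: if_splits)
  define S where "S = (mon (posvec I b k) :: 'a laurent)"
  define N where "N = (mon (negvec I b k) :: 'a laurent)"
  define N' where "N' = (mon (negvec I b k - single j 1) :: 'a laurent)"
  define Q where "Q = (mon (negvec I b j) :: 'a laurent)"
  define H where "H = (\<Sum>i<c. S ^ (c - Suc i) * (S + N) ^ i)"
  have fj: "f j = mon P * mon (single k (int c)) + Q"
    by (simp add: exch_def Q_def P_def mon_mult)
  have fk: "f k = S + N" by (simp add: exch_def S_def N_def)
  have N_N': "mon (single j (-1)) * N = N'"
    by (simp add: N_def N'_def mon_mult) (simp add: single_uminus)
  have xk_pow: "mon (single k 1) ^ i = (mon (single k (int i)) :: 'a laurent)" for i
    by (induction i) (auto simp: mult_single simp flip: single_add)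
  have xk_y: "mon (single k 1) * y = S + N"
    unfolding fk by (simp add: mult_single flip: mult.assoc single_add)
  have "mon (single k (int c)) * y ^ c = (S + N) ^ c"
    unfolding xk_pow[symmetric] power_mult_distrib[symmetric] xk_y ..
  moreover have "(S + N) ^ c - S ^ c = N * H"
    using power_diff_sumr2[of "S + N" c S] by (simp add: H_def mult.commute)
  ultimately have ident: "mon P * S ^ c + y ^ c * Q = y ^ c * f j - mon P * N * H"
    unfolding fj by (simp add: algebra_simps)
  define q where "q = mon \<mu> * (y ^ c * (mon (single j (-1)) * f j) - mon P * N' * H)"
  have "ev x1 (f1 j) = mono_eval x1 (posvec I b1 j) + mono_eval x1 (negvec I b1 j)"
    by (simp add: exch_def ev_add ev_mon)
  also have "mono_eval x1 (posvec I b1 j) = ev x (mon \<mu> * (mon P * S ^ c))"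
  proof -
    have "ev x1 (mon (posvec I b1 j)) = ev x (mon (posvec I b1 j))"
      by (rule ev_x1_free) (simp add: pos1 lookup_add \<mu>k Pk t_k)
    then have "mono_eval x1 (posvec I b1 j) = ev x (mon (posvec I b1 j))" by (simp only: ev_mon)
    also have "mon (posvec I b1 j) = mon \<mu> * (mon P * S ^ c)"
      by (simp add: pos1 S_def t(1) mult_single add.assoc)
    finally show ?thesis .
  qed
  also have "mono_eval x1 (negvec I b1 j) = ev x (mon \<mu> * (y ^ c * Q))"
  proof -
    have lk_neg: "lookup (negvec I b1 j) k = int c" using k c sign by (simp add: lk b1)
    have "mono_eval x1 (negvec I b1 j) = ev x (mon (\<mu> + negvec I b j) * y ^ c)"
      using mono_x1[of "negvec I b1 j"] unfolding lk_neg neg1 by simp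
    also have "mon (\<mu> + negvec I b j) * y ^ c = mon \<mu> * (y ^ c * Q)"
      by (simp add: Q_def mult_ac flip: mon_mult)
    finally show ?thesis .
  qed
  also have "ev x (mon \<mu> * (mon P * S ^ c)) + ev x (mon \<mu> * (y ^ c * Q)) =
      ev x (mon \<mu> * (y ^ c * f j - mon P * N * H))"
    unfolding ident[symmetric] by (simp add: ev_add distrib_left)
  finally have "ev x1 (f1 j) = ev x (mon \<mu> * (y ^ c * f j - mon P * N * H))" .
  moreover have "ev x1 (mon (single j (-1))) = ev x (mon (single j (-1)))"
    by (rule ev_x1_free) (use j(2) in \<open>auto simp: lookup_single when_def split: if_splits\<close>)
  ultimately have "ev x1 (mon (single j (-1)) * f1 j) =
      ev x (mon (single j (-1)) * (mon \<mu> * (y ^ c * f j - mon P * N * H)))"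
    by (simp add: ev_mult)
  also have "mon (single j (-1)) * (mon \<mu> * (y ^ c * f j - mon P * N * H)) = q"
    unfolding q_def N_N'[symmetric] by (simp add: algebra_simps)
  finally have ev_q: "ev x q = ev x1 (mon (single j (-1)) * f1 j)" by simp
  have nonneg: "0 \<le> lookup (posvec I b l) i" "0 \<le> lookup (negvec I b l) i" for l i
    by (simp_all add: lk)
  have "q \<in> lower_alg K I {i} f" if i: "i \<in> {j, k}" for i
  proof -
    note R = is_subring_lower_alg[OF K, of I "{i}" f]
    have "mon \<mu> \<in> lower_alg K I {i} f" "mon P \<in> lower_alg K I {i} f"
      using i \<mu>k \<mu>j Pk Pj keys_\<mu> keys_P by (auto intro!: lower_alg_mon K)
    moreover have "S \<in> lower_alg K I {i} f" "N \<in> lower_alg K I {i} f"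
      unfolding S_def N_def by (intro lower_alg_mon K keys_posvec keys_negvec I nonneg)+
    moreover have "N' \<in> lower_alg K I {i} f"
      unfolding N'_def
    proof (rule lower_alg_mon[OF K])
      show "keys (negvec I b k - single j 1) \<subseteq> I"
        using j(1) by (auto simp: in_keys_iff lk when_def split: if_splits)
      show "0 \<le> lookup (negvec I b k - single j 1) l" if "l \<in> {i}" for l
        using that i j sign by (auto simp: lk when_def)
    qed
    moreover have "y \<in> lower_alg K I {i} f" "mon (single j (-1)) * f j \<in> lower_alg K I {i} f"
      using lower_alg_quotient[OF K I] j k by blast+
    moreover have "m * (u ^ c * v - p * r * (\<Sum>i<c. s ^ (c - Suc i) * (s + t) ^ i)) \<in> lower_alg K I {i} f"
      if "m \<in> lower_alg K I {i} f" "p \<in> lower_alg K I {i} f" "s \<in> lower_alg K I {i} f"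
        "t \<in> lower_alg K I {i} f" "r \<in> lower_alg K I {i} f" "u \<in> lower_alg K I {i} f"
        "v \<in> lower_alg K I {i} f" for m p s t r u v
      using that
      by (intro is_subringD(3,6)[OF R] is_subring_power[OF R] is_subring_sum[OF R] is_subringD(5)[OF R])
    ultimately show ?thesis
      unfolding q_def H_def by blast
  qed
  then show ?thesis using ev_q by blast
qed

end

lemma eval_seed_uminus:
  "eval_seed h K I x b k \<Longrightarrow> eval_seed h K I x (\<lambda>k l. - b k l) k"
  unfolding eval_seed_def eval_seed_axioms_def by simp

context eval_seed
begin

text \<open>If \<open>b k j < 0\<close>, the matrix is replaced by its negative, which swaps the
  monomials of all exchange polynomials and commutes with mutation.\<close>

lemma new_variable:
  assumes j: "j \<in> I" "j \<noteq> k" and skew: "skew_signs b {j, k}"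
  shows "\<exists>q \<in> lower_alg K I {j} f \<inter> lower_alg K I {k} f. ev x q = ev x1 (mon (single j (-1)) * f1 j)"
proof -
  have bjj: "b j j = 0" using skew_signs_diag[OF skew] by simp
  consider "b k j = 0" "b j k = 0" | "0 < b k j" "b j k < 0" | "b k j < 0" "0 < b j k"
    using skew_signsD[OF skew, of k j] by (auto simp: sgn_if split: if_splits)
  then show ?thesis
  proof cases
    case 1
    have fj: "f1 j = f j"
      by (rule exch_cong) (use 1 j in \<open>simp add: mutate_matrix_alt\<close>)
    have "ev x1 (f j) = ev x (f j)"
      by (rule ev_x1_free) (rule exch_homogeneous[OF I], use 1 in auto)
    moreover have "ev x1 (mon (single j (-1))) = ev x (mon (single j (-1)))"
      by (rule ev_x1_free) (use j(2) in \<open>auto simp: lookup_single when_def split: if_splits\<close>)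
    ultimately show ?thesis unfolding fj
      using lower_alg_quotient[OF K I j(1)] by (intro bexI[of _ "mon (single j (-1)) * f j"]) (auto simp: ev_mult)
  next
    case 2
    then show ?thesis using new_variable_nonneg j bjj by blast
  next
    case 3
    define b' where "b' = (\<lambda>k l. - b k l)"
    interpret neg: eval_seed h K I x b' k
      unfolding b'_def by (rule eval_seed_uminus) (rule eval_seed_axioms)
    have f': "exch I b' = f" by (rule ext) (simp add: b'_def exch_uminus)
    have "exch I (mutate_matrix k b') j = exch I (\<lambda>l m. - mutate_matrix k b l m) j"
      by (rule exch_cong) (simp add: b'_def mutate_matrix_uminus)
    then have f1': "exch I (mutate_matrix k b') j = f1 j" by (simp add: exch_uminus)
    have "neg.x1 = x1" by (simp add: neg.x1_def x1_def neg.F_def F_def f')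
    moreover have "b' j j = 0" "0 < b' k j" "b' j k < 0" using 3 bjj by (simp_all add: b'_def)
    ultimately show ?thesis using neg.new_variable_nonneg[OF j] unfolding f' f1' by simp
  qed
qed

text \<open>For each \<open>j\<close> the rank-two theorem at the mutated seed expresses
  \<open>p\<close> through the generators for the pair \<open>k\<close>, \<open>j\<close>, and each
  of these is the value of an element of the old algebras for \<open>j\<close> and \<open>k\<close>.
  Independence identifies the elements obtained for different \<open>j\<close>.\<close>

theorem upper_bound_mutation:
  assumes E: "E \<subseteq> I" "k \<in> E" and skew: "skew_signs b E" and skew1: "skew_signs b1 E"
    and cop1: "coprime_exch K I b1 E"
    and p: "p \<in> lau K I" "\<And>j. j \<in> E \<Longrightarrow> p \<in> lower_alg K I {j} f1"
  shows "\<exists>q\<in>lau K I. (\<forall>j\<in>E. q \<in> lower_alg K I {j} f) \<and> ev x q = ev x1 p"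
proof -
  have step: "\<exists>q \<in> lower_alg K I {j} f \<inter> lower_alg K I {k} f. ev x q = ev x1 p" if j: "j \<in> E" for j
  proof -
    let ?L = "lower_alg K I {j} f \<inter> lower_alg K I {k} f"
    let ?D = "{k, j}"
    have D: "?D \<subseteq> E" "?D \<subseteq> I" using E j by auto
    note R = is_subring_lower_alg[OF K, of I _ f]
    have L: "is_subring ?L" using R[of "{j}"] R[of "{k}"] unfolding is_subring_def by blast
    have T: "is_subring (ev x ` ?L)"
      unfolding is_subring_def
    proof (intro conjI ballI)
      show "1 \<in> ev x ` ?L" using is_subringD(1)[OF L] by (intro image_eqI[of _ _ 1]) auto
      fix u v assume "u \<in> ev x ` ?L" "v \<in> ev x ` ?L"
      then obtain u' v' where uv: "u' \<in> ?L" "v' \<in> ?L" "u = ev x u'" "v = ev x v'" by blast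
      show "u - v \<in> ev x ` ?L" unfolding uv(3,4) ev_diff[symmetric]
        by (rule imageI) (rule is_subringD(3)[OF L uv(1,2)])
      show "u * v \<in> ev x ` ?L" unfolding uv(3,4) ev_mult[symmetric]
        by (rule imageI) (rule is_subringD(6)[OF L uv(1,2)])
    qed
    have "p \<in> lower_alg K I ?D f1"
    proof (rule upper_bound_subset_lower_alg[OF K I D(2)])
      show sk: "skew_signs b1 ?D" by (rule skew_signs_subset[OF skew1 D(1)])
      show "acyclic_on b1 ?D" by (rule acyclic_on_pair[OF sk])
      show "coprime_exch K I b1 ?D" by (rule coprime_exch_subset[OF cop1 D(1)])
    qed (use p D in auto)
    have both: "mon s \<in> ?L" if "keys s \<subseteq> I" "0 \<le> lookup s j" "0 \<le> lookup s k" for s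
      using that by (auto intro!: lower_alg_mon K)
    have single_L: "mon (single l a) \<in> ?L" if "l \<in> I" "l \<notin> ?D \<or> 0 \<le> a" for l a
      by (rule both) (use that in \<open>auto simp: lookup_single when_def split: if_splits\<close>)
    have free: "ev x1 (mon (single l a)) = ev x (mon (single l a))" if "l \<noteq> k" for l a
      by (rule ev_x1_free) (use that in \<open>auto simp: lookup_single when_def split: if_splits\<close>)
    have F: "ev x1 (mon (single k a)) = (F / x k) powi a" for a
      using mono_eval_single[of x1 k a] x1_nz[OF k] by (simp add: ev_mon x1_def)
    have xk: "ev x (mon (single k a)) = x k powi a" for a
      using mono_eval_single[of x k a] x_nz[OF k] by (simp add: ev_mon)
    have "ev x1 p \<in> ev x ` ?L"
    proof (rule lower_alg_image[OF T D(2) I ev_add ev_mult ev_1 _ _ _ \<open>p \<in> lower_alg K I ?D f1\<close>])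
      fix c assume "c \<in> K"
      then have "single 0 c \<in> ?L" by (auto intro!: lower_alg_single)
      then show "ev x1 (single 0 c) \<in> ev x ` ?L" by (intro image_eqI[of _ _ "single 0 c"]) (auto simp: ev_single)
    next
      fix l assume "l \<in> I - ?D"
      then show "ev x1 (mon (single l 1)) \<in> ev x ` ?L \<and> ev x1 (mon (single l (- 1))) \<in> ev x ` ?L"
        using free[of l] single_L[of l] by auto
    next
      fix i assume i: "i \<in> ?D"
      show "ev x1 (mon (single i 1)) \<in> ev x ` ?L \<and> ev x1 (mon (single i (- 1)) * f1 i) \<in> ev x ` ?L"
      proof (cases "i = k")
        case True
        \<comment> \<open>At \<open>k\<close> mutation exchanges the two generators
          \<open>x_k\<close> and \<open>f k / x_k\<close>.\<close>
        have "ev x1 (mon (single k 1)) = ev x y"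
          unfolding F ev_mult xk by (simp add: F_def power_int_minus divide_inverse mult.commute)
        moreover have "y \<in> ?L" using lower_alg_quotient[OF K I k] by blast
        moreover have "ev x1 (mon (single k (-1)) * f1 k) = ev x (mon (single k 1))"
          unfolding f1_k ev_mult F xk using ev_x1_free[OF f_free] F_nz
          by (simp add: power_int_minus F_def)
        moreover have "mon (single k 1) \<in> ?L" using single_L[OF k] by simp
        ultimately show ?thesis unfolding True by (metis image_eqI)
      next
        case False
        then have i: "i = j" "i \<in> I" "j \<noteq> k" using i D by auto
        have "skew_signs b {i, k}" using skew_signs_subset[OF skew, of "{i, k}"] E(2) j i by auto
        from new_variable[OF i(2) False this] obtain q where
          "q \<in> ?L" "ev x q = ev x1 (mon (single i (-1)) * f1 i)" unfolding i(1) by blast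
        moreover have "ev x1 (mon (single i 1)) = ev x (mon (single i 1))" by (rule free[OF False])
        moreover have "mon (single i 1) \<in> ?L" using single_L[OF i(2)] by simp
        ultimately show ?thesis by (metis image_eqI)
      qed
    qed
    then show ?thesis by auto
  qed
  obtain q where q: "q \<in> lower_alg K I {k} f" "ev x q = ev x1 p" using step[OF E(2)] by auto
  have sub: "lower_alg K I {j} f \<subseteq> lau K I" for j
    by (rule lower_alg_subset_lau[OF K]) (rule exch_lau[OF K I])
  have "q \<in> lower_alg K I {j} f" if j: "j \<in> E" for j
  proof -
    obtain q' where q': "q' \<in> lower_alg K I {j} f" "ev x q' = ev x1 p" using step[OF j] by auto
    then have "q' = q" using indep_inj[OF K ind, of q' q] q sub by auto
    then show ?thesis using q' by simp
  qed
  then show ?thesis using q sub by blast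
qed

end

section \<open>The Laurent phenomenon\<close>

lemma mono_eval_posvec:
  assumes "finite I" "\<And>k. k \<in> I \<Longrightarrow> x k \<noteq> 0"
  shows "mono_eval x (posvec I b i) = (\<Prod>j\<in>{j\<in>I. b j i > 0}. x j ^ nat (b j i))"
proof -
  have "mono_eval x (posvec I b i) = (\<Prod>j\<in>I. if b j i > 0 then x j ^ nat (b j i) else 1)"
    unfolding posvec_def mono_eval_expvec[OF assms(1)]
    by (rule prod.cong) (auto simp: assms(2) power_int_def max_def)
  then show ?thesis using assms(1) by (simp add: prod.inter_filter)
qed

lemma mono_eval_negvec:
  assumes "finite I" "\<And>k. k \<in> I \<Longrightarrow> x k \<noteq> 0"
  shows "mono_eval x (negvec I b i) = (\<Prod>j\<in>{j\<in>I. b j i < 0}. x j ^ nat (- b j i))"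
  using mono_eval_posvec[OF assms, where b = "\<lambda>k l. - b k l" and i = i] by (simp add: posvec_def negvec_def)

lemma (in coeff_hom) ev_exch:
  assumes "\<And>k. k \<in> {1..n+m} \<Longrightarrow> x k \<noteq> 0"
  shows "ev x (exch {1..n+m} b i) =
    (\<Prod>j \<in> {j \<in> {1..n+m}. b j i > 0}. x j ^ nat (b j i)) +
    (\<Prod>j \<in> {j \<in> {1..n+m}. b j i < 0}. x j ^ nat (- b j i))"
  unfolding exch_def ev_add ev_mon
  using mono_eval_posvec[of "{1..n+m}" x b i] mono_eval_negvec[of "{1..n+m}" x b i] assms by simp

lemma reachable_indep:
  fixes h :: "'a::{idom,ring_char_0} \<Rightarrow> 'g::field_char_0"
  assumes h: "coeff_hom h" and K: "is_subring K"
    and x0: "coeff_hom.indep h K {1..n+m} x0" and b0: "exchange_matrix n b0"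
    and reach: "mutation_reachable n m x0 b0 x b"
  shows "coeff_hom.indep h K {1..n+m} x \<and> exchange_matrix n b"
  using reach
proof induction
  case refl
  then show ?case using x0 b0 by simp
next
  case (step x b i)
  interpret coeff_hom h by (rule h)
  have "b i i = 0"
    using skew_signs_diag[OF exchange_matrix_skew_signs] step by blast
  then interpret eval_seed h K "{1..n+m}" x b i
    using step K by unfold_locales auto
  have "mutate_vars n m i x b = x1"
    unfolding mutate_vars_def x1_def F_def exchange_poly_def using ev_exch[OF x_nz] by simp
  then show ?case using indep_x1 exchange_matrix_mutate step by simp
qed

text \<open>The invariant concerns whole upper bounds rather than cluster variables, as this is what
  a mutation transports. Full rank is carried along because it provides coprimality at every seed on
  the way.\<close>

theorem laurent_phenomenon:
  fixes h :: "'a::{idom,ring_char_0} \<Rightarrow> 'g::field_char_0"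
  assumes h: "coeff_hom h" and K: "is_subring K"
    and x0: "coeff_hom.indep h K {1..n+m} x0" and b0: "exchange_matrix n b0"
    and rank: "full_rank n {1..n+m} b0"
    and reach: "mutation_reachable n m x0 b0 x b"
  shows "full_rank n {1..n+m} b \<and> (\<forall>p\<in>lau K {1..n+m}.
    (\<forall>j\<in>{1..n}. p \<in> lower_alg K {1..n+m} {j} (exch {1..n+m} b)) \<longrightarrow>
    (\<exists>q\<in>lau K {1..n+m}. (\<forall>j\<in>{1..n}. q \<in> lower_alg K {1..n+m} {j} (exch {1..n+m} b0)) \<and>
      laurent_eval h x0 q = laurent_eval h x p))"
  using reach
proof induction
  case refl
  then show ?case using rank by blast
next
  case (step x b i)
  interpret coeff_hom h by (rule h)
  have ind: "indep K {1..n+m} x" and ex: "exchange_matrix n b"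
    using reachable_indep[OF h K x0 b0 step(1)] by auto
  note sk = exchange_matrix_skew_signs[OF ex]
  have bii: "b i i = 0" using skew_signs_diag[OF sk step(2)] .
  interpret eval_seed h K "{1..n+m}" x b i
    using step(2) K ind bii by unfold_locales auto
  have mv: "mutate_vars n m i x b = x1"
    unfolding mutate_vars_def x1_def F_def exchange_poly_def using ev_exch[OF x_nz] by simp
  have rank': "full_rank n {1..n+m} (mutate_matrix i b)"
    by (rule full_rank_mutate) (use step bii in auto)
  show ?case
  proof (intro conjI ballI impI rank')
    fix p assume p: "p \<in> lau K {1..n+m}"
      "\<forall>j\<in>{1..n}. p \<in> lower_alg K {1..n+m} {j} (exch {1..n+m} (mutate_matrix i b))"
    have sub: "{1..n} \<subseteq> {1..n+m}" by auto
    obtain q where q: "q \<in> lau K {1..n+m}" "\<forall>j\<in>{1..n}. q \<in> lower_alg K {1..n+m} {j} (exch {1..n+m} b)"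
      "ev x q = ev x1 p"
      using upper_bound_mutation[OF sub step(2) sk exchange_matrix_skew_signs[OF exchange_matrix_mutate[OF ex step(2)]]
          coprime_exch_full_rank[OF K I rank'] p(1)] p(2) by blast
    then show "\<exists>q\<in>lau K {1..n + m}. (\<forall>j\<in>{1..n}. q \<in> lower_alg K {1..n + m} {j} (exch {1..n + m} b0)) \<and>
        ev x0 q = ev (mutate_vars n m i x b) p"
      using step(3) mv by metis
  qed
qed

instance fract :: ("{idom,ring_char_0}") ring_char_0
proof
  show "inj (of_nat :: nat \<Rightarrow> 'a fract)"
    by (rule injI) (simp add: Fract_of_nat_eq[symmetric] eq_fract)
qed

instance fract :: ("{idom,ring_char_0}") field_char_0 ..

text \<open>For these variables evaluation is the canonical embedding of the integral Laurent ring
  into its fraction field, so independence is immediate.\<close>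

definition generic_var :: "nat \<Rightarrow> int laurent fract" where
  "generic_var k = Fract (mon (single k 1)) 1"

lemma coeff_hom_of_int: "coeff_hom (of_int :: int \<Rightarrow> 'g::field)"
  by unfold_locales auto

lemma generic_eval: "laurent_eval of_int generic_var p = Fract p 1"
proof -
  have nz: "generic_var k \<noteq> 0" for k
    by (simp add: generic_var_def Zero_fract_def eq_fract)
  have powi: "generic_var k powi a = Fract (mon (single k a)) 1" for k a
  proof -
    have pow: "generic_var k ^ i = Fract (mon (single k (int i))) 1" for i
      by (induction i) (auto simp: generic_var_def One_fract_def mult_single simp flip: single_add)
    show ?thesis
    proof (cases "a \<ge> 0")
      case True
      then show ?thesis using pow[of "nat a"] by (simp add: power_int_def)
    next
      case False
      then have "generic_var k powi a = inverse (Fract (mon (single k (- a))) 1)"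
        using pow[of "nat (- a)"] by (simp add: power_int_def power_inverse)
      also have "\<dots> = Fract (mon (single k a)) 1"
        by (simp add: eq_fract mult_single flip: single_add)
      finally show ?thesis .
    qed
  qed
  have mon: "mono_eval generic_var e = Fract (mon e) 1" for e
  proof -
    have prod: "(\<Prod>k\<in>A. Fract (mon (g k)) 1) = (Fract (mon (\<Sum>k\<in>A. g k)) 1 :: int laurent fract)" for A and g :: "nat \<Rightarrow> _"
      by (induction A rule: infinite_finite_induct) (auto simp: One_fract_def mon_mult)
    have "mono_eval generic_var e = (\<Prod>k\<in>keys e. Fract (mon (single k (lookup e k))) 1)"
      unfolding mono_eval_def using nz by (simp add: powi)
    also have "\<dots> = Fract (mon e) 1"
      unfolding prod laurent_sum_single[of e, symmetric] ..
    finally show ?thesis .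
  qed
  have of_int: "of_int c = (Fract (single 0 c) 1 :: int laurent fract)" for c
  proof -
    have "of_int c = (Fract (of_int c) 1 :: int laurent fract)"
      by (cases c rule: int_diff_cases) (simp flip: Fract_of_nat_eq)
    then show ?thesis by (metis of_int_eq_id id_apply single_of_int)
  qed
  have "laurent_eval of_int generic_var p = (\<Sum>e\<in>keys p. Fract (single e (lookup p e)) 1)"
    unfolding laurent_eval_def mon of_int by (simp add: mult_single)
  also have "\<dots> = Fract (\<Sum>e\<in>keys p. single e (lookup p e)) 1"
  proof -
    have "(\<Sum>e\<in>A. Fract (g e) 1) = Fract (\<Sum>e\<in>A. g e) 1" for A and g :: "(nat \<Rightarrow>\<^sub>0 int) \<Rightarrow> int laurent"
      by (induction A rule: infinite_finite_induct) (auto simp: Zero_fract_def)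
    then show ?thesis .
  qed
  finally show ?thesis by (simp flip: laurent_sum_single)
qed

lemma generic_indep: "coeff_hom.indep of_int UNIV I generic_var"
  unfolding coeff_hom.indep_def[OF coeff_hom_of_int] generic_eval
  by (auto simp: Zero_fract_def eq_fract)

text \<open>A seed becomes generic of full rank when one frozen variable per exchangeable index is
  added; setting the new frozen variables to \<open>1\<close> recovers the original seed.\<close>

definition extended_matrix :: "nat \<Rightarrow> (nat \<Rightarrow> nat \<Rightarrow> int) \<Rightarrow> nat \<Rightarrow> nat \<Rightarrow> int" where
  "extended_matrix N b k l = (if k \<le> N then b k l else if k = N + l then 1 else 0)"

text \<open>The rows of the added frozen variables form an identity matrix.\<close>

lemma full_rank_extended: "full_rank n {1..n + (m + n)} (extended_matrix (n + m) b)"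
  unfolding full_rank_def
proof (intro allI impI ballI)
  fix c l assume c: "\<forall>k\<in>{1..n + (m + n)}. (\<Sum>l\<in>{1..n}. extended_matrix (n + m) b k l * c l) = 0"
    and l: "l \<in> {1..n}"
  have "0 = (\<Sum>k\<in>{1..n}. extended_matrix (n + m) b (n + m + l) k * c k)"
    using c l by auto
  also have "\<dots> = (\<Sum>k\<in>{1..n}. if k = l then c k else 0)"
    using l by (intro sum.cong) (auto simp: extended_matrix_def)
  also have "\<dots> = c l" using l by simp
  finally show "c l = 0" by simp
qed

lemma exchange_matrix_extended: "exchange_matrix n b \<Longrightarrow> exchange_matrix n (extended_matrix (n + m) b)"
  by (simp add: exchange_matrix_def extended_matrix_def)

locale seed_ext =
  fixes K :: "'f::field_char_0 set" and n m :: nat and x0 :: "nat \<Rightarrow> 'f" and b0 :: "nat \<Rightarrow> nat \<Rightarrow> int"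
  assumes K: "is_subring K" and ind: "coeff_hom.indep (\<lambda>c. c) K {1..n+m} x0" and b0: "exchange_matrix n b0"
begin

abbreviation "N \<equiv> n + m"
abbreviation "J \<equiv> {1..n + (m + n)}"
abbreviation "bt \<equiv> extended_matrix N b0"
abbreviation "ft \<equiv> (exch J bt :: nat \<Rightarrow> int laurent)"

definition "xs k = (if k \<in> {1..N} then x0 k else 1)"

abbreviation "\<phi> \<equiv> laurent_eval (of_int :: int \<Rightarrow> 'f) xs"

definition "gen_upper = {p :: int laurent. p \<in> lau UNIV J \<and> (\<forall>j\<in>{1..n}. p \<in> lower_alg UNIV J {j} ft)}"

lemma K': "is_subring (UNIV :: int set)"
  by (simp add: is_subring_def)

sublocale I: coeff_hom "of_int :: int \<Rightarrow> 'f" by (rule coeff_hom_of_int)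
sublocale G: coeff_hom "of_int :: int \<Rightarrow> int laurent fract" by (rule coeff_hom_of_int)
sublocale C: coeff_hom "\<lambda>c. c :: 'f" by unfold_locales auto

text \<open>The same mutations are run on the generic extended seed. The substitution cannot be
  applied to fractions, so every generic variable is represented by an integral Laurent polynomial
  in the initial variables, and these polynomials are compared with the actual variables.\<close>

lemma specialize_reachable:
  assumes "mutation_reachable n m x0 b0 x b"
  shows "\<exists>xt bt'. mutation_reachable n (m + n) generic_var bt xt bt' \<and>
    (\<forall>k\<in>{1..N}. \<forall>l\<in>{1..n}. bt' k l = b k l) \<and>
    (\<forall>i\<in>J. \<exists>p\<in>gen_upper. G.ev generic_var p = xt i \<and> \<phi> p = (if i \<le> N then x i else 1))"
  using assms
proof induction
  case refl
  have "mon (single i 1) \<in> gen_upper" if "i \<in> J" for i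
    using that unfolding gen_upper_def
    by (auto intro!: mon_lau lower_alg_mon K' simp: lookup_single when_def split: if_splits)
  moreover have "\<phi> (mon (single i 1)) = (if i \<le> N then x0 i else 1)" if "i \<in> J" for i
    using that C.indep_nonzero[OF K ind, of i] mono_eval_single[of xs i 1]
    by (auto simp: I.ev_mon xs_def)
  moreover have "G.ev generic_var (mon (single i 1)) = generic_var i" for i
    by (simp add: generic_eval generic_var_def)
  ultimately have "\<forall>i\<in>J. \<exists>p\<in>gen_upper. G.ev generic_var p = generic_var i \<and> \<phi> p = (if i \<le> N then x0 i else 1)"
    by blast
  moreover have "\<forall>k\<in>{1..N}. \<forall>l\<in>{1..n}. bt k l = b0 k l" by (simp add: extended_matrix_def)
  ultimately show ?case using mutation_reachable.refl by blast
next
  case (step x b i)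
  obtain xt bt' where IH: "mutation_reachable n (m + n) generic_var bt xt bt'"
    "\<And>k l. k \<in> {1..N} \<Longrightarrow> l \<in> {1..n} \<Longrightarrow> bt' k l = b k l"
    "\<forall>i\<in>J. \<exists>p\<in>gen_upper. G.ev generic_var p = xt i \<and> \<phi> p = (if i \<le> N then x i else 1)"
    using step(3) by blast
  obtain P where P: "\<And>i. i \<in> J \<Longrightarrow> P i \<in> gen_upper" "\<And>i. i \<in> J \<Longrightarrow> G.ev generic_var (P i) = xt i"
    "\<And>i. i \<in> J \<Longrightarrow> \<phi> (P i) = (if i \<le> N then x i else 1)"
    using bchoice[OF IH(3)[unfolded Bex_def]] by metis
  have iJ: "i \<in> J" "i \<in> {1..N}" "i \<le> N" using step(2) by auto
  let ?xt = "mutate_vars n (m + n) i xt bt'" and ?bt = "mutate_matrix i bt'"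
  have reach: "mutation_reachable n (m + n) generic_var bt ?xt ?bt"
    by (rule mutation_reachable.step[OF IH(1) step(2)])
  note gen = generic_indep[of J] exchange_matrix_extended[OF b0, of m]
  have indt: "G.indep UNIV J xt" "G.indep UNIV J ?xt"
    using reachable_indep[OF G.coeff_hom_axioms K' gen IH(1)] reachable_indep[OF G.coeff_hom_axioms K' gen reach]
    by auto
  have ind_x: "C.indep K {1..N} x"
    using reachable_indep[OF C.coeff_hom_axioms K ind b0 step(1)] by simp
  have xi: "x i \<noteq> 0" using C.indep_nonzero[OF K ind_x iJ(2)] .
  have nz: "xt i \<noteq> 0" "?xt i \<noteq> 0"
    using G.indep_nonzero[OF K' indt(1) iJ(1)] G.indep_nonzero[OF K' indt(2) iJ(1)] by auto
  have "mon (single i 1) \<in> lau (UNIV :: int set) J"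
    "\<forall>j\<in>{1..n}. mon (single i 1) \<in> lower_alg (UNIV :: int set) J {j} (exch J ?bt)"
    using iJ(1) by (auto intro!: mon_lau lower_alg_mon K' simp: lookup_single when_def split: if_splits)
  \<comment> \<open>By the Laurent phenomenon the new generic variable again has a representative in
    the initial upper bound.\<close>
  then obtain q where q: "q \<in> gen_upper" "G.ev generic_var q = G.ev ?xt (mon (single i 1))"
    using laurent_phenomenon[OF G.coeff_hom_axioms K' gen full_rank_extended reach] unfolding gen_upper_def by blast
  have q_ev: "G.ev generic_var q = ?xt i"
    using q(2) nz(2) mono_eval_single[of ?xt i 1] by (simp add: G.ev_mon)
  define Q where "Q = (\<Prod>j \<in> {j \<in> J. bt' j i > 0}. P j ^ nat (bt' j i)) +
     (\<Prod>j \<in> {j \<in> J. bt' j i < 0}. P j ^ nat (- bt' j i))"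
  have "G.ev generic_var Q = exchange_poly n (m + n) xt bt' i"
    unfolding Q_def exchange_poly_def G.ev_add G.ev_prod G.ev_power using P(2)
    by (intro arg_cong2[of _ _ _ _ "(+)"] prod.cong) auto
  \<comment> \<open>The exchange relation is read without division, as an identity of Laurent
    polynomials; only after the substitution one divides by \<open>x i\<close>, which is
    nonzero.\<close>
  then have "G.ev generic_var (q * P i) = G.ev generic_var Q"
    using nz(1) P(2)[OF iJ(1)] by (simp add: G.ev_mult q_ev mutate_vars_def)
  then have eq: "q * P i = Q" by (simp add: generic_eval eq_fract)
  \<comment> \<open>The added frozen variables have value 1 and drop out of the products;
    \<open>R\<close> and \<open>s\<close> allow both monomials to be treated at once.\<close>
  have prod_J: "(\<Prod>j\<in>{j \<in> J. R (bt' j i)}. \<phi> (P j) ^ nat (s * bt' j i)) =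
      (\<Prod>j\<in>{j \<in> {1..N}. R (b j i)}. x j ^ nat (s * b j i))" for R and s :: int
  proof -
    have "(\<Prod>j\<in>{j \<in> J. R (bt' j i)}. \<phi> (P j) ^ nat (s * bt' j i)) =
        (\<Prod>j\<in>{j \<in> {1..N}. R (bt' j i)}. \<phi> (P j) ^ nat (s * bt' j i))"
      by (rule prod.mono_neutral_right) (auto simp: P(3))
    also have "\<dots> = (\<Prod>j\<in>{j \<in> {1..N}. R (b j i)}. x j ^ nat (s * b j i))"
      using IH(2)[OF _ step(2)] P(3) by (intro prod.cong) auto
    finally show ?thesis .
  qed
  have "\<phi> Q = exchange_poly n m x b i"
    using prod_J[where R = "\<lambda>u. u > 0" and s = 1] prod_J[where R = "\<lambda>u. u < 0" and s = "-1"]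
    by (simp add: Q_def exchange_poly_def I.ev_add I.ev_prod I.ev_power)
  then have "\<phi> q * x i = exchange_poly n m x b i"
    using arg_cong[OF eq, of \<phi>] P(3)[OF iJ(1)] iJ(3) by (simp add: I.ev_mult)
  then have \<phi>q: "\<phi> q = mutate_vars n m i x b i"
    using xi by (simp add: mutate_vars_def field_simps)
  have "\<exists>p\<in>gen_upper. G.ev generic_var p = ?xt l \<and> \<phi> p = (if l \<le> N then mutate_vars n m i x b l else 1)"
    if l: "l \<in> J" for l
  proof (cases "l = i")
    case True
    then show ?thesis using q(1) q_ev \<phi>q iJ(3) by auto
  next
    case False
    then show ?thesis using P[OF l] by (intro bexI[of _ "P l"]) (auto simp: mutate_vars_def)
  qed
  moreover have "?bt k l = mutate_matrix i b k l" if kl: "k \<in> {1..N}" "l \<in> {1..n}" for k l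
  proof -
    have "bt' k l = b k l" "bt' k i = b k i" "bt' i l = b i l"
      using IH(2) kl step(2) iJ by auto
    then show ?thesis by (simp add: mutate_matrix_def)
  qed
  ultimately show ?case using reach by blast
qed

lemma of_int_K: "of_int c \<in> K"
proof -
  have nat: "of_nat k \<in> K" for k by (induction k) (auto simp: is_subringD[OF K])
  show ?thesis by (cases c) (use nat is_subringD(4)[OF K] in \<open>auto simp flip: of_nat_Suc simp del: of_nat_Suc\<close>)
qed

text \<open>The rank-two theorem is applied before the substitution, where the exchange polynomials
  are coprime; its spanning form then passes to the original seed even if coprimality is lost there.
  The case \<open>i = j\<close> is included and gives the condition at a single index.\<close>

lemma specialize_lower:
  assumes ij: "i \<in> {1..n}" "j \<in> {1..n}" and p: "p \<in> gen_upper"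
  shows "\<phi> p \<in> C.ev x0 ` lower_alg K {1..N} {i, j} (exch {1..N} b0)"
proof -
  let ?L = "lower_alg K {1..N} {i, j} (exch {1..N} b0)"
  have L: "is_subring ?L" by (rule is_subring_lower_alg[OF K])
  have T: "is_subring (C.ev x0 ` ?L)"
    unfolding is_subring_def
  proof (intro conjI ballI)
    show "1 \<in> C.ev x0 ` ?L" using is_subringD(1)[OF L] by (intro image_eqI[of _ _ 1]) auto
    fix u v assume "u \<in> C.ev x0 ` ?L" "v \<in> C.ev x0 ` ?L"
    then obtain u' v' where uv: "u' \<in> ?L" "v' \<in> ?L" "u = C.ev x0 u'" "v = C.ev x0 v'" by blast
    show "u - v \<in> C.ev x0 ` ?L" unfolding uv(3,4) C.ev_diff[symmetric]
      by (rule imageI) (rule is_subringD(3)[OF L uv(1,2)])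
    show "u * v \<in> C.ev x0 ` ?L" unfolding uv(3,4) C.ev_mult[symmetric]
      by (rule imageI) (rule is_subringD(6)[OF L uv(1,2)])
  qed
  have D: "{i, j} \<subseteq> {1..n}" "{i, j} \<subseteq> J" using ij by auto
  note sk = skew_signs_subset[OF exchange_matrix_skew_signs[OF exchange_matrix_extended[OF b0, of m]] D(1)]
  have lower: "p \<in> lower_alg UNIV J {i, j} ft"
  proof (rule upper_bound_subset_lower_alg[OF K' _ D(2) sk acyclic_on_pair[OF sk]])
    show "coprime_exch (UNIV :: int set) J bt {i, j}"
      using coprime_exch_subset[OF coprime_exch_full_rank[OF K' _ full_rank_extended[of n m b0]] D(1)] by simp
  qed (use p ij in \<open>auto simp: gen_upper_def\<close>)
  have x0_nz: "x0 k \<noteq> 0" if "k \<in> {1..N}" for k using C.indep_nonzero[OF K ind that] .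
  have xs_nz: "xs k \<noteq> 0" for k by (auto simp: xs_def x0_nz)
  have \<phi>_mon: "\<phi> (mon (single k a)) = (if k \<in> {1..N} then C.ev x0 (mon (single k a)) else 1)" for k a
    using mono_eval_single[of xs k a, OF xs_nz] mono_eval_single[of x0 k a] x0_nz[of k]
    by (auto simp: I.ev_mon C.ev_mon xs_def)
  have \<phi>_ft: "\<phi> (ft k) = C.ev x0 (exch {1..N} b0 k)" for k
  proof -
    have prod_J: "(\<Prod>j\<in>{j \<in> J. R (bt j k)}. xs j ^ nat (s * bt j k)) =
        (\<Prod>j\<in>{j \<in> {1..N}. R (b0 j k)}. x0 j ^ nat (s * b0 j k))" for R and s :: int
    proof -
      have "(\<Prod>j\<in>{j \<in> J. R (bt j k)}. xs j ^ nat (s * bt j k)) =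
          (\<Prod>j\<in>{j \<in> {1..N}. R (bt j k)}. xs j ^ nat (s * bt j k))"
        by (rule prod.mono_neutral_right) (auto simp: xs_def)
      also have "\<dots> = (\<Prod>j\<in>{j \<in> {1..N}. R (b0 j k)}. x0 j ^ nat (s * b0 j k))"
        by (intro prod.cong) (auto simp: xs_def extended_matrix_def)
      finally show ?thesis .
    qed
    show ?thesis
      using I.ev_exch[of n "m + n" xs bt k, OF xs_nz] C.ev_exch[of n m x0 b0 k, OF x0_nz] prod_J[where R = "\<lambda>u. u > 0" and s = 1] prod_J[where R = "\<lambda>u. u < 0" and s = "-1"] by simp
  qed
  have L_single: "mon (single l a) \<in> ?L" if "l \<in> {1..N}" "l \<notin> {i, j} \<or> 0 \<le> a" for l a
    by (rule lower_alg_mon[OF K]) (use that in \<open>auto simp: lookup_single when_def split: if_splits\<close>)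
  have one: "1 \<in> C.ev x0 ` ?L" using is_subringD(1)[OF T] .
  show ?thesis
  proof (rule lower_alg_image[OF T D(2) _ I.ev_add I.ev_mult I.ev_1 _ _ _ lower])
    fix c :: int
    have "single 0 (of_int c) \<in> ?L" by (rule lower_alg_single) (auto simp: of_int_K)
    moreover have "\<phi> (single 0 c) = C.ev x0 (single 0 (of_int c))"
      by (simp only: I.ev_single C.ev_single mono_eval_0)
    ultimately show "\<phi> (single 0 c) \<in> C.ev x0 ` ?L" by blast
  next
    fix l assume "l \<in> J - {i, j}"
    then show "\<phi> (mon (single l 1)) \<in> C.ev x0 ` ?L \<and> \<phi> (mon (single l (- 1))) \<in> C.ev x0 ` ?L"
      unfolding \<phi>_mon using L_single[of l] one by auto
  next
    fix k assume k: "k \<in> {i, j}"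
    then have kN: "k \<in> {1..N}" using D(1) by auto
    have "single (single k (-1)) 1 * (\<Prod>l\<in>{i, j}. exch {1..N} b0 l ^ (if l = k then 1 else 0)) \<in> ?L"
      by (rule lower_alg_term) (use kN K in \<open>auto simp: is_subringD lookup_single when_def\<close>)
    also have "(\<Prod>l\<in>{i, j}. exch {1..N} b0 l ^ (if l = k then 1 else 0)) = (exch {1..N} b0 k :: 'f laurent)"
      using k by (cases "i = j") auto
    finally have "mon (single k (-1)) * exch {1..N} b0 k \<in> ?L" .
    then show "\<phi> (mon (single k 1)) \<in> C.ev x0 ` ?L \<and> \<phi> (mon (single k (- 1)) * ft k) \<in> C.ev x0 ` ?L"
      unfolding I.ev_mult \<phi>_mon \<phi>_ft using L_single[of k 1] kN
      by (auto simp flip: C.ev_mult)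
  qed simp
qed

theorem cluster_variable_lower:
  assumes "z \<in> cluster_variables n m x0 b0" "i \<in> {1..n}" "j \<in> {1..n}"
  shows "z \<in> C.ev x0 ` lower_alg K {1..N} {i, j} (exch {1..N} b0)"
proof -
  obtain x b k where z: "z = x k" "mutation_reachable n m x0 b0 x b" "k \<in> {1..n}"
    using assms(1) by (auto simp: cluster_variables_def)
  have "k \<in> J" "k \<le> N" using z(3) by auto
  then obtain p where "p \<in> gen_upper" "\<phi> p = x k"
    using specialize_reachable[OF z(2)] by (metis (no_types, lifting))
  then show ?thesis using specialize_lower[OF assms(2,3)] z(1) by metis
qed

end

section \<open>The upper bound is factorial when the exchange polynomials are prime\<close>

lemma low_single: "low d (single s c) = d s" if "c \<noteq> 0"
  using that by (simp add: low_def)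

text \<open>For each variable the lowest degrees of the two factors add up to 0, and so do the
  highest, so each factor has a single exponent vector.\<close>

lemma laurent_unit:
  fixes p q :: "'a::idom laurent"
  assumes pq: "p * q = 1"
  obtains s c c' where "p = single s c" "q = single (- s) c'" "c * c' = 1"
proof -
  have nz: "p \<noteq> 0" "q \<noteq> 0" using pq by auto
  have one_key: "\<exists>s c. r = single s c \<and> c \<noteq> 0" if rt: "r * t = 1" "r \<noteq> 0" "t \<noteq> 0" for r t :: "'a laurent"
  proof -
    have const: "lookup e k = low (deg k) r" if e: "e \<in> keys r" for e k
    proof -
      let ?d = "\<lambda>e. - lookup e k"
      have add': "additive_fun ?d" by (simp add: additive_fun_def lookup_add)
      have "low (deg k) r + low (deg k) t = 0" "low ?d r + low ?d t = 0"
        using low_mult(1)[OF additive_deg rt(2,3), of k] low_mult(1)[OF add' rt(2,3)]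
          low_single[of "1 :: 'a" "deg k" 0] low_single[of "1 :: 'a" ?d 0] rt(1) by simp_all
      moreover obtain e' where "e' \<in> keys t" using rt(3) keys_eq_empty[of t] by (meson all_not_in_conv)
      ultimately show ?thesis
        using low_le[OF e, of "deg k"] low_le[OF e, of ?d] low_le[of e' t "deg k"] low_le[of e' t ?d] by simp
    qed
    obtain s where s: "s \<in> keys r" using rt(2) keys_eq_empty[of r] by (meson all_not_in_conv)
    have "e = s" if "e \<in> keys r" for e
      by (rule poly_mapping_eqI) (simp add: const[OF that] const[OF s])
    with s have "keys r = {s}" by blast
    then have "r = single s (lookup r s)"
      by (intro poly_mapping_eqI) (metis in_keys_iff lookup_single_eq lookup_single_not_eq singletonD)
    then show ?thesis using s by (auto simp: in_keys_iff)
  qed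
  obtain s c where p: "p = single s c" "c \<noteq> 0" using one_key[OF pq nz] by blast
  obtain t c' where q: "q = single t c'" "c' \<noteq> 0" using one_key[of q p] pq nz by (auto simp: mult.commute)
  have eq: "single (s + t) (c * c') = single 0 (1::'a)" using pq p q by (simp add: mult_single)
  have "s + t = 0"
    using arg_cong[OF eq, of "\<lambda>r. lookup r (s + t)"] p q by (auto simp: lookup_single when_def lookup_one split: if_splits)
  then have "t = - s" "c * c' = 1"
    using arg_cong[OF eq, of "\<lambda>r. lookup r 0"] by (auto simp: eq_neg_iff_add_eq_0 add.commute)
  then show thesis using that p q by blast
qed

text \<open>The exchange polynomials enter only through being prime and free of their own
  variable.\<close>

locale prime_exchange =
  fixes K :: "'a::idom set" and I E :: "nat set" and f :: "nat \<Rightarrow> 'a laurent"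
  assumes K: "is_subring K" and I: "finite I" and EI: "E \<subseteq> I"
    and f_free: "\<And>j e. j \<in> E \<Longrightarrow> e \<in> keys (f j) \<Longrightarrow> lookup e j = 0"
    and f_prime: "\<And>j. j \<in> E \<Longrightarrow> prime_in (lau K I) (f j)"
    and fact: "prime_factorial (lau K I)"
begin

abbreviation "L \<equiv> lau K I"
abbreviation "A j \<equiv> lower_alg K I {j} f"
abbreviation xs :: "nat \<Rightarrow> int \<Rightarrow> 'a laurent" where "xs j a \<equiv> mon (single j a)"

definition "U = {p \<in> L. \<forall>j\<in>E. p \<in> A j}"

lemmas L = is_subring_lau[OF K, of I]

lemma A: "is_subring (A j)"
  by (rule is_subring_lower_alg[OF K])

lemma f_L: "j \<in> E \<Longrightarrow> f j \<in> L"
  using prime_inD(1)[OF f_prime] .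

lemma A_L: "j \<in> E \<Longrightarrow> A j \<subseteq> L"
  by (rule lower_alg_subset_lau[OF K]) (use f_L in auto)

lemma A_iff: "j \<in> E \<Longrightarrow> p \<in> A j \<longleftrightarrow> p \<in> L \<and> (\<forall>k::nat. dvd_in L (f j ^ k) (part (deg j) (- int k) p))"
  using lower_alg_one_iff[where g = f and j = j, OF K f_L f_free] by blast

lemma U: "is_subring U"
  using A L unfolding U_def is_subring_def by auto

lemma one_dvd: "c \<in> L \<Longrightarrow> dvd_in L 1 c"
  by (rule dvd_inI) simp_all

lemma xs_mult: "xs j a * xs j b = xs j (a + b)"
  by (simp add: mult_single single_add)

lemma xs_mult': "xs j a * (xs j b * p) = xs j (a + b) * p"
  by (simp add: xs_mult flip: mult.assoc)

lemma xs_L: "j \<in> E \<Longrightarrow> xs j a \<in> L"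
  using EI by (intro mon_lau K) auto

lemma dvd_mon_iff:
  assumes "keys s \<subseteq> I"
  shows "dvd_in L g (mon s * p) \<longleftrightarrow> dvd_in L g p"
proof
  have "mon (- s) \<in> L" "mon s \<in> L" using assms by (auto intro!: mon_lau K)
  then show "dvd_in L g p \<Longrightarrow> dvd_in L g (mon s * p)" "dvd_in L g (mon s * p) \<Longrightarrow> dvd_in L g p"
    using dvd_in_mult2[OF L, of g p "mon s"] dvd_in_mult2[OF L, of g "mon s * p" "mon (- s)"] by auto
qed

lemma part_xs: "part (deg j) k (xs j a * p) = xs j a * part (deg j) (k - a) p"
  by (simp add: part_single_mult)

lemma xs_A_iff:
  assumes j: "j \<in> E" and p: "p \<in> L"
  shows "xs j a * p \<in> A j \<longleftrightarrow> (\<forall>k::nat. dvd_in L (f j ^ k) (part (deg j) (- int k - a) p))"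
proof -
  have "xs j a * p \<in> L" using xs_L[OF j] p is_subringD(6)[OF L] by blast
  then show ?thesis
    unfolding A_iff[OF j] part_xs using dvd_mon_iff[of "single j a"] j EI by (auto split: if_splits)
qed

text \<open>Dividing by \<open>x_j\<close> shifts the grading by one, so one extra power of
  \<open>f j\<close> is demanded in every degree \<open>\<le> 0\<close>; the condition in degree 1
  has exponent 0 and is void.\<close>

lemma xs_inv_A_iff:
  assumes j: "j \<in> E" and p: "p \<in> L"
  shows "xs j (-1) * p \<in> A j \<longleftrightarrow> (\<forall>k::nat. dvd_in L (f j ^ Suc k) (part (deg j) (- int k) p))"
  unfolding xs_A_iff[OF assms]
proof
  assume *: "\<forall>k. dvd_in L (f j ^ k) (part (deg j) (- int k - - 1) p)"
  show "\<forall>k. dvd_in L (f j ^ Suc k) (part (deg j) (- int k) p)"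
    using *[rule_format, of "Suc _"] by simp
next
  assume *: "\<forall>k. dvd_in L (f j ^ Suc k) (part (deg j) (- int k) p)"
  show "\<forall>k. dvd_in L (f j ^ k) (part (deg j) (- int k - - 1) p)"
  proof
    fix k :: nat
    show "dvd_in L (f j ^ k) (part (deg j) (- int k - - 1) p)"
    proof (cases k)
      case 0
      then show ?thesis using lau_part[OF K p] by (simp add: one_dvd)
    next
      case (Suc l)
      then show ?thesis using *[rule_format, of l] by simp
    qed
  qed
qed

text \<open>\<open>x\<^sub>j\<close> is prime in \<open>A j\<close>: the lowest parts that fail to be divisible by one more power of the
  prime \<open>f\<^sub>j\<close> multiply to a part of the same kind.\<close>

lemma xs_prime_A:
  assumes j: "j \<in> E" and p: "p \<in> A j" "xs j (-1) * p \<notin> A j" and q: "q \<in> A j" "xs j (-1) * q \<notin> A j"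
  shows "xs j (-1) * (p * q) \<notin> A j"
proof
  assume contr: "xs j (-1) * (p * q) \<in> A j"
  let ?f = "f j"
  note fL = f_L[OF j]
  have pL: "p \<in> L" "q \<in> L" using p q A_L[OF j] by auto
  \<comment> \<open>The pole order \<open>k\<close> is maximal among those where the extra power of
    \<open>f j\<close> is missing; it exists because only finitely many degrees have a nonzero
    part.\<close>
  have last: "\<exists>k. \<not> dvd_in L (?f ^ Suc k) (part (deg j) (- int k) p) \<and>
      (\<forall>l>k. dvd_in L (?f ^ Suc l) (part (deg j) (- int l) p))"
    if "p \<in> L" "xs j (-1) * p \<notin> A j" for p
  proof -
    define Z where "Z = {k. \<not> dvd_in L (?f ^ Suc k) (part (deg j) (- int k) p)}"
    have "Z \<noteq> {}" using that(2) xs_inv_A_iff[OF j that(1)] by (auto simp: Z_def)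
    moreover have "Z \<subseteq> (\<lambda>a. nat (- a)) ` deg j ` keys p"
    proof
      fix k assume "k \<in> Z"
      then have "part (deg j) (- int k) p \<noteq> 0" using dvd_in_0[OF L] by (auto simp: Z_def)
      then obtain e where "e \<in> keys p" "lookup e j = - int k" by (auto simp: part_eq_0_iff)
      then show "k \<in> (\<lambda>a. nat (- a)) ` deg j ` keys p" by force
    qed
    then have "finite Z" by (rule finite_subset) simp
    ultimately have max: "Max Z \<in> Z" "l > Max Z \<Longrightarrow> l \<notin> Z" for l
      using Max_in Max_ge[of Z l] by auto
    have "\<not> dvd_in L (?f ^ Suc (Max Z)) (part (deg j) (- int (Max Z)) p)"
      using max(1) unfolding Z_def by blast
    moreover have "\<forall>l>Max Z. dvd_in L (?f ^ Suc l) (part (deg j) (- int l) p)"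
      using max(2) unfolding Z_def by blast
    ultimately show ?thesis by blast
  qed
  obtain k where k: "\<not> dvd_in L (?f ^ Suc k) (part (deg j) (- int k) p)"
    "\<And>l. l > k \<Longrightarrow> dvd_in L (?f ^ Suc l) (part (deg j) (- int l) p)" using last[OF pL(1) p(2)] by blast
  obtain l where l: "\<not> dvd_in L (?f ^ Suc l) (part (deg j) (- int l) q)"
    "\<And>i. i > l \<Longrightarrow> dvd_in L (?f ^ Suc i) (part (deg j) (- int i) q)" using last[OF pL(2) q(2)] by blast
  \<comment> \<open>Positive degrees carry no condition, as \<open>nat (- c)\<close> is 0
    there.\<close>
  have weak: "dvd_in L (?f ^ nat (- c)) (part (deg j) c r)" if "r \<in> A j" for c r
  proof (cases "c \<le> 0")
    case True
    then show ?thesis using that unfolding A_iff[OF j] by (metis add.inverse_inverse nat_0_le neg_0_le_iff_le)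
  next
    case False
    then show ?thesis using that A_L[OF j] lau_part[OF K, of r I] by (auto intro!: one_dvd)
  qed
  have strong_p: "dvd_in L (?f ^ Suc (nat (- c))) (part (deg j) c p)" if "c < - int k" for c
    using k(2)[of "nat (- c)"] that by (simp add: zless_nat_eq_int_zless)
  have strong_q: "dvd_in L (?f ^ Suc (nat (- c))) (part (deg j) c q)" if "c < - int l" for c
    using l(2)[of "nat (- c)"] that by (simp add: zless_nat_eq_int_zless)
  define Z where "Z = insert (- int k) (deg j ` keys p)"
  have Z: "finite Z" "- int k \<in> Z" by (auto simp: Z_def)
  let ?t = "\<lambda>c. part (deg j) c p * part (deg j) (- int (k + l) - c) q"
  have "part (deg j) (- int (k + l)) (p * q) = (\<Sum>c\<in>Z. ?t c)"
    by (rule part_mult) (auto simp: Z_def)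
  also have "\<dots> = part (deg j) (- int k) p * part (deg j) (- int l) q + (\<Sum>c\<in>Z - {- int k}. ?t c)"
    using sum.remove[OF Z, of ?t] by simp
  finally have eq: "part (deg j) (- int k) p * part (deg j) (- int l) q =
      part (deg j) (- int (k + l)) (p * q) - (\<Sum>c\<in>Z - {- int k}. ?t c)" by simp
  have "dvd_in L (?f ^ Suc (k + l)) (part (deg j) (- int k) p * part (deg j) (- int l) q)"
    unfolding eq
  proof (rule dvd_in_diff[OF L])
    show "dvd_in L (?f ^ Suc (k + l)) (part (deg j) (- int (k + l)) (p * q))"
      using contr xs_inv_A_iff[OF j is_subringD(6)[OF L pL]] by blast
    show "dvd_in L (?f ^ Suc (k + l)) (\<Sum>c\<in>Z - {- int k}. ?t c)"
    proof (rule dvd_in_sum[OF L])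
      fix c assume c: "c \<in> Z - {- int k}"
      let ?d = "- int (k + l) - c"
      have le: "Suc (k + l) \<le> Suc (nat (- c)) + nat (- ?d)" "Suc (k + l) \<le> nat (- c) + Suc (nat (- ?d))"
        by linarith+
      have trans: "dvd_in L (?f ^ Suc (k + l)) r" if "dvd_in L (?f ^ i) r" "Suc (k + l) \<le> i" for i r
        using dvd_in_trans[OF L dvd_in_power_le[OF L fL that(2)] that(1)] .
      from c consider "c < - int k" | "?d < - int l" by force
      then show "dvd_in L (?f ^ Suc (k + l)) (?t c)"
      proof cases
        case 1
        show ?thesis
          by (rule trans[OF _ le(1)]) (simp only: power_add, rule dvd_in_mult_mono[OF L strong_p[OF 1] weak[OF q(1)]])
      next
        case 2
        show ?thesis
          by (rule trans[OF _ le(2)]) (simp only: power_add, rule dvd_in_mult_mono[OF L weak[OF p(1)] strong_q[OF 2]])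
      qed
    qed
  qed
  moreover obtain p' where p': "p' \<in> L" "part (deg j) (- int k) p = ?f ^ k * p'"
    using weak[OF p(1), of "- int k"] by (auto simp: dvd_in_def)
  moreover obtain q' where q': "q' \<in> L" "part (deg j) (- int l) q = ?f ^ l * q'"
    using weak[OF q(1), of "- int l"] by (auto simp: dvd_in_def)
  ultimately have "dvd_in L (?f ^ (k + l) * ?f) (?f ^ (k + l) * (p' * q'))"
    by (simp add: power_add mult_ac)
  then have "dvd_in L ?f (p' * q')"
    by (rule dvd_in_cancel) (use prime_inD(2)[OF f_prime[OF j]] in simp)
  then have "dvd_in L ?f p' \<or> dvd_in L ?f q'"
    using prime_inD(4)[OF f_prime[OF j] p'(1) q'(1)] by blast
  then show False
  proof
    assume "dvd_in L ?f p'"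
    then have "dvd_in L (?f ^ k * ?f) (?f ^ k * p')"
      by (intro dvd_in_mult_mono L dvd_in_refl)
    then show False using k(1) p'(2) by (simp add: mult.commute)
  next
    assume "dvd_in L ?f q'"
    then have "dvd_in L (?f ^ l * ?f) (?f ^ l * q')"
      by (intro dvd_in_mult_mono L dvd_in_refl)
    then show False using l(1) q'(2) by (simp add: mult.commute)
  qed
qed

text \<open>Each factor \<open>g\<close> of the power is associated to one of the primes in
  \<open>ps\<close>, which is thereby used up.\<close>

lemma prime_power_bound:
  assumes g: "prime_in L g" and ps: "\<And>p. p \<in> set ps \<Longrightarrow> prime_in L p" and u: "unit_in L u"
    and dvd: "dvd_in L (g ^ k) (u * prod_list ps)"
  shows "k \<le> length ps"
  using ps u dvd
proof (induction k arbitrary: u ps)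
  case (Suc k)
  have psL: "set ps \<subseteq> L" using Suc.prems(1) prime_inD(1) by blast
  have gL: "g \<in> L" "g \<noteq> 0" using prime_inD[OF g] by auto
  obtain c where c: "c \<in> L" "u * prod_list ps = g ^ Suc k * c" using Suc.prems(3) by (auto simp: dvd_in_def)
  have "g ^ k * c \<in> L" using gL c by (intro is_subringD(6)[OF L] is_subring_power[OF L])
  then have "dvd_in L g (u * prod_list ps)" unfolding c(2) by (auto intro!: dvd_inI simp: mult.assoc)
  then have "dvd_in L g (prod_list ps)"
    using prime_inD(4)[OF g, of u "prod_list ps"] prime_dvd_unit[OF L g Suc.prems(2)]
      Suc.prems(2) is_subring_prod_list[OF L psL] by (auto simp: unit_in_def)
  then obtain r where r: "r \<in> set ps" "dvd_in L g r" using prime_dvd_prod_list[OF L g psL] by blast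
  obtain w where w: "unit_in L w" "r = g * w" using prime_dvd_prime[OF L g Suc.prems(1)[OF r(1)] r(2)] by blast
  have "g * (u * w * prod_list (remove1 r ps)) = g * (g ^ k * c)"
    using c(2) unfolding prod_list_remove1[OF r(1)] w(2) by (simp add: mult_ac)
  then have "u * w * prod_list (remove1 r ps) = g ^ k * c" using gL by simp
  then have "dvd_in L (g ^ k) (u * w * prod_list (remove1 r ps))" using c(1) by (auto intro: dvd_inI)
  moreover have "prime_in L p" if "p \<in> set (remove1 r ps)" for p
    by (rule Suc.prems(1)) (rule subsetD[OF set_remove1_subset that])
  ultimately have "k \<le> length (remove1 r ps)"
    using Suc.IH[of "remove1 r ps" "u * w"] unit_in_mult[OF L Suc.prems(2) w(1)] by blast
  moreover have "length ps > 0" using r(1) by (cases ps) auto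
  ultimately show ?case using r(1) by (cases "length ps") (auto simp: length_remove1)
qed simp

text \<open>A high power of \<open>x_j\<close> removes all poles, and a low one fails because a
  nonzero coefficient is divisible by only finitely many powers of the prime \<open>f j\<close>; in
  between lies a last exponent that still works.\<close>

lemma xs_extremal:
  assumes j: "j \<in> E" and p: "p \<in> L" "p \<noteq> 0"
  shows "\<exists>a. xs j a * p \<in> A j \<and> xs j (-1) * (xs j a * p) \<notin> A j"
proof -
  define M where "M = nat (- low (deg j) p)"
  have start: "xs j (int M) * p \<in> A j"
    unfolding xs_A_iff[OF j p(1)]
  proof
    fix k :: nat
    show "dvd_in L (f j ^ k) (part (deg j) (- int k - int M) p)"
    proof (cases "k = 0")
      case True
      then show ?thesis using lau_part[OF K p(1)] by (simp add: one_dvd)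
    next
      case False
      then have "part (deg j) (- int k - int M) p = 0"
        by (intro part_below_low) (simp add: M_def)
      then show ?thesis by (simp add: dvd_in_0 L)
    qed
  qed
  obtain e where e: "e \<in> keys p" using p(2) keys_eq_empty[of p] by (meson all_not_in_conv)
  define a where "a = part (deg j) (lookup e j) p"
  have a: "a \<in> L" "a \<noteq> 0" using e lau_part[OF K p(1)] by (auto simp: a_def part_eq_0_iff)
  obtain u ps where ups: "unit_in L u" "\<And>p. p \<in> set ps \<Longrightarrow> prime_in L p" "a = u * prod_list ps"
    using fact a unfolding prime_factorial_def by metis
  define k where "k = Suc (length ps)"
  have nd: "\<not> dvd_in L (f j ^ k) a"
  proof
    assume "dvd_in L (f j ^ k) a"
    from prime_power_bound[OF f_prime[OF j] ups(2,1) this[unfolded ups(3)]]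
    show False by (simp add: k_def)
  qed
  \<comment> \<open>Moves the monomial \<open>e\<close> to degree at most \<open>- k\<close>, where
    divisibility by \<open>f j ^ k\<close> would be demanded.\<close>
  define t0 where "t0 = nat (int M + int k + \<bar>lookup e j\<bar>)"
  have "xs j (int M - int t0) * p \<notin> A j"
  proof
    assume *: "xs j (int M - int t0) * p \<in> A j"
    define i where "i = nat (int t0 - int M - lookup e j)"
    have t0: "int t0 = int M + int k + \<bar>lookup e j\<bar>" by (simp add: t0_def)
    then have i: "- int i - (int M - int t0) = lookup e j" and ki: "k \<le> i" by (simp_all add: i_def)
    have "dvd_in L (f j ^ i) (part (deg j) (- int i - (int M - int t0)) p)"
      using *[unfolded xs_A_iff[OF j p(1)]] by blast
    then have "dvd_in L (f j ^ i) a" unfolding i a_def .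
    then show False using nd dvd_in_trans[OF L dvd_in_power_le[OF L f_L[OF j] ki]] by blast
  qed
  then obtain t where t: "xs j (int M - int t) * p \<notin> A j" "\<And>t'. t' < t \<Longrightarrow> xs j (int M - int t') * p \<in> A j"
    using exists_least_iff[of "\<lambda>t. xs j (int M - int t) * p \<notin> A j"] by blast
  have "t \<noteq> 0" using t(1) start by (intro notI) simp
  then have "xs j (int M - int (t - 1)) * p \<in> A j" by (intro t(2)) simp
  moreover have "xs j (-1) * (xs j (int M - int (t - 1)) * p) = xs j (int M - int t) * p"
  proof -
    have "-1 + (int M - int (t - 1)) = int M - int t" using \<open>t \<noteq> 0\<close> by simp
    then show ?thesis by (simp only: xs_mult')
  qed
  ultimately show ?thesis using t(1) by metis
qed

lemma mon_A_iff:
  assumes "keys s \<subseteq> I" "lookup s j = 0"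
  shows "mon s * p \<in> A j \<longleftrightarrow> p \<in> A j"
proof -
  have s: "mon s \<in> A j" "mon (- s) \<in> A j"
    using assms by (auto intro!: lower_alg_mon K)
  then show ?thesis
    using is_subringD(6)[OF A s(1), of p] is_subringD(6)[OF A s(2), of "mon s * p"] by auto
qed

text \<open>Elements of \<open>U\<close> divisible by none of the \<open>x_j\<close>. They represent
  the nonzero Laurent polynomials up to monomials in the exchangeable variables.\<close>

definition normal :: "'a laurent \<Rightarrow> bool" where
  "normal q \<longleftrightarrow> q \<in> U \<and> q \<noteq> 0 \<and> (\<forall>j\<in>E. xs j (-1) * q \<notin> A j)"

lemma normalize:
  assumes "q \<in> L" "q \<noteq> 0"
  shows "\<exists>s. keys s \<subseteq> E \<and> normal (mon s * q)"
proof -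
  have finE: "finite E" using EI I finite_subset by blast
  obtain a where a: "\<And>j. j \<in> E \<Longrightarrow> xs j (a j) * q \<in> A j" "\<And>j. j \<in> E \<Longrightarrow> xs j (-1) * (xs j (a j) * q) \<notin> A j"
    using xs_extremal[OF _ assms] by metis
  define s where "s = expvec E a"
  have keys_s: "keys s \<subseteq> E" unfolding s_def by (rule keys_expvec[OF finE])
  then have sI: "keys s \<subseteq> I" using EI by auto
  have rest: "keys (s - single j (a j)) \<subseteq> I" "lookup (s - single j (a j)) j = 0"
      "mon s * q = mon (s - single j (a j)) * (xs j (a j) * q)" if "j \<in> E" for j
  proof -
    show "keys (s - single j (a j)) \<subseteq> I"
      using keys_diff[of s "single j (a j)"] sI that EI by (auto split: if_splits)
    show "lookup (s - single j (a j)) j = 0"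
      using that by (simp add: s_def lookup_minus lookup_expvec[OF finE])
    show "mon s * q = mon (s - single j (a j)) * (xs j (a j) * q)"
      by (simp add: mult_single flip: mult.assoc)
  qed
  have "mon s * q \<in> L" using sI assms by (intro is_subringD(6)[OF L] mon_lau K)
  moreover have "mon s * q \<in> A j" if j: "j \<in> E" for j
    unfolding rest(3)[OF j] using mon_A_iff[OF rest(1,2)[OF j]] a(1)[OF j] by blast
  moreover have "xs j (-1) * (mon s * q) \<notin> A j" if j: "j \<in> E" for j
    unfolding rest(3)[OF j] mult.left_commute[of "xs j (-1)" "mon (s - single j (a j))" "xs j (a j) * q"]
    using mon_A_iff[OF rest(1,2)[OF j], of "xs j (-1) * (xs j (a j) * q)"] a(2)[OF j] by metis
  moreover have "mon s * q \<noteq> 0" using assms by simp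
  ultimately have "normal (mon s * q)" unfolding normal_def U_def by blast
  with keys_s show ?thesis by blast
qed

lemma normal_mult: "normal p \<Longrightarrow> normal q \<Longrightarrow> normal (p * q)"
  using xs_prime_A is_subringD(6)[OF U] by (auto simp: normal_def U_def)

lemma normal_1: "normal 1"
proof -
  have "xs j (-1) * 1 \<notin> A j" if j: "j \<in> E" for j
  proof
    assume "xs j (-1) * 1 \<in> A j"
    then have "dvd_in L (f j ^ Suc 0) (part (deg j) (- int 0) 1)"
      using xs_inv_A_iff[OF j is_subringD(1)[OF L]] by blast
    then have "dvd_in L (f j) 1" by simp
    then show False using prime_dvd_unit[OF L f_prime[OF j] unit_in_one[OF L]] by blast
  qed
  then show ?thesis using is_subringD(1)[OF U] by (auto simp: normal_def)
qed

text \<open>If the quotient \<open>c\<close> had a pole at \<open>j\<close> repaired only by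
  \<open>x_j ^ t\<close> with \<open>t > 0\<close>, then \<open>p\<close> and
  \<open>x_j ^ t * c\<close> would be two elements not divisible by \<open>x_j\<close> whose product
  is divisible by it.\<close>

lemma normal_dvd:
  assumes p: "normal p" and a: "a \<in> U" and dvd: "dvd_in L p a"
  shows "dvd_in U p a"
proof (cases "a = 0")
  case False
  obtain c where c: "c \<in> L" "a = p * c" using dvd by (auto simp: dvd_in_def)
  have c0: "c \<noteq> 0" using c False by auto
  have "c \<in> A j" if j: "j \<in> E" for j
  proof -
    obtain t where t: "xs j t * c \<in> A j" "xs j (-1) * (xs j t * c) \<notin> A j"
      using xs_extremal[OF j c(1) c0] by blast
    have nonneg: "xs j k \<in> A j" if "k \<ge> 0" for k
      using that j EI by (intro lower_alg_mon K) auto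
    have "t \<le> 0"
    proof (rule ccontr)
      assume "\<not> t \<le> 0"
      then have "xs j (t - 1) * a \<in> A j"
        using a j nonneg[of "t - 1"] by (intro is_subringD(6)[OF A]) (auto simp: U_def)
      also have "xs j (t - 1) * a = xs j (-1) * (p * (xs j t * c))"
        unfolding c(2) mult.left_commute[of p "xs j t"] xs_mult' by (simp add: add.commute)
      finally show False using xs_prime_A[OF j _ _ t] p j by (auto simp: normal_def U_def)
    qed
    then have "xs j (- t) * (xs j t * c) \<in> A j"
      using is_subringD(6)[OF A nonneg[of "- t"] t(1)] by simp
    then show ?thesis by (simp add: xs_mult')
  qed
  then show ?thesis using c by (auto simp: U_def intro: dvd_inI)
qed (use dvd_in_0[OF U] in simp)

lemma U_L: "U \<subseteq> L"
  by (auto simp: U_def)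

lemma normal_unit:
  assumes "normal u" "unit_in L u"
  shows "unit_in U u"
proof -
  have "dvd_in L u 1" using assms(2) by (auto simp: unit_in_def dvd_in_def)
  then have "dvd_in U u 1" using normal_dvd[OF assms(1) is_subringD(1)[OF U]] by blast
  then show ?thesis using assms(1) by (auto simp: unit_in_def dvd_in_def normal_def)
qed

lemma normal_prime:
  assumes p: "normal p" "prime_in L p"
  shows "prime_in U p"
  unfolding prime_in_def
proof (intro conjI ballI impI)
  show "p \<in> U" "p \<noteq> 0" using p(1) by (auto simp: normal_def)
  show "\<not> unit_in U p" using unit_in_mono[OF _ U_L] prime_inD(3)[OF p(2)] by blast
  fix a b assume ab: "a \<in> U" "b \<in> U" "dvd_in U p (a * b)"
  then have "dvd_in L p (a * b)" using U_L by (auto simp: dvd_in_def)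
  then have "dvd_in L p a \<or> dvd_in L p b" using prime_inD(4)[OF p(2), of a b] ab U_L by blast
  then show "dvd_in U p a \<or> dvd_in U p b" using normal_dvd[OF p(1)] ab by blast
qed

lemma xs_U: "j \<in> E \<Longrightarrow> xs j 1 \<in> U"
  unfolding U_def using EI xs_L[of j 1] by (auto intro!: lower_alg_mon K simp: lookup_single when_def)

lemma xs_inv_U_iff:
  assumes j: "j \<in> E" and a: "a \<in> U"
  shows "dvd_in U (xs j 1) a \<longleftrightarrow> xs j (-1) * a \<in> A j"
proof
  assume "dvd_in U (xs j 1) a"
  then obtain c where "c \<in> U" "a = xs j 1 * c" by (auto simp: dvd_in_def)
  then show "xs j (-1) * a \<in> A j" using j by (simp add: xs_mult' U_def)
next
  assume *: "xs j (-1) * a \<in> A j"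
  have "xs j (-1) * a \<in> A l" if l: "l \<in> E" for l
  proof (cases "l = j")
    case False
    then show ?thesis using mon_A_iff[of "single j (-1)" l a] a l j EI
      by (auto simp: U_def lookup_single when_def)
  qed (use * in simp)
  moreover have "xs j (-1) * a \<in> L" using * A_L[OF j] by auto
  ultimately show "dvd_in U (xs j 1) a"
    by (intro dvd_inI[of "xs j (-1) * a"]) (auto simp: U_def xs_mult')
qed

lemma xs_prime_U:
  assumes j: "j \<in> E"
  shows "prime_in U (xs j 1)"
  unfolding prime_in_def
proof (intro conjI ballI impI)
  show "xs j 1 \<in> U" by (rule xs_U[OF j])
  show "xs j 1 \<noteq> 0" by simp
  show "\<not> unit_in U (xs j 1)"
  proof
    assume "unit_in U (xs j 1)"
    then have "dvd_in U (xs j 1) 1" by (auto simp: unit_in_def dvd_in_def)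
    then show False using xs_inv_U_iff[OF j is_subringD(1)[OF U]] normal_1 j by (auto simp: normal_def)
  qed
  fix a b assume ab: "a \<in> U" "b \<in> U" "dvd_in U (xs j 1) (a * b)"
  then have "xs j (-1) * (a * b) \<in> A j"
    using xs_inv_U_iff[OF j is_subringD(6)[OF U ab(1,2)]] by simp
  then show "dvd_in U (xs j 1) a \<or> dvd_in U (xs j 1) b"
    using xs_prime_A[OF j, of a b] xs_inv_U_iff[OF j] ab j by (auto simp: U_def)
qed

definition factors :: "'a laurent \<Rightarrow> bool" where
  "factors a \<longleftrightarrow> (\<exists>u ps. unit_in U u \<and> (\<forall>p\<in>set ps. prime_in U p) \<and> a = u * prod_list ps)"

lemma factors_mult: "factors a \<Longrightarrow> factors b \<Longrightarrow> factors (a * b)"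
proof -
  assume "factors a" "factors b"
  then obtain u ps v qs where "unit_in U u" "\<forall>p\<in>set ps. prime_in U p" "a = u * prod_list ps"
    "unit_in U v" "\<forall>p\<in>set qs. prime_in U p" "b = v * prod_list qs"
    unfolding factors_def by blast
  then show ?thesis unfolding factors_def using unit_in_mult[OF U]
    by (intro exI[of _ "u * v"] exI[of _ "ps @ qs"]) (auto simp: mult_ac)
qed

lemma factors_unit: "unit_in U u \<Longrightarrow> factors u"
  unfolding factors_def by (intro exI[of _ u] exI[of _ "[]"]) simp

lemma factors_prime: "prime_in U p \<Longrightarrow> factors p"
  unfolding factors_def using unit_in_one[OF U] by (intro exI[of _ 1] exI[of _ "[p]"]) simp

lemma factors_prod: "(\<And>z. z \<in> Z \<Longrightarrow> factors (g z)) \<Longrightarrow> factors (prod g Z)"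
  using factors_mult factors_unit[OF unit_in_one[OF U]]
  by (induction Z rule: infinite_finite_induct) auto

lemma factors_power: "factors a \<Longrightarrow> factors (a ^ k)"
  using factors_mult factors_unit[OF unit_in_one[OF U]] by (induction k) auto

text \<open>Factor in the Laurent ring and make the unit and each prime normal; the monomial left
  over is a product of the primes \<open>x_j\<close>.\<close>

theorem prime_factorial_U: "prime_factorial U"
proof -
  have finE: "finite E" using EI I finite_subset by blast
  have "factors a" if a: "a \<in> U" "a \<noteq> 0" for a
  proof -
    obtain u ps where ups: "unit_in L u" "\<And>p. p \<in> set ps \<Longrightarrow> prime_in L p" "a = u * prod_list ps"
      using fact a U_L unfolding prime_factorial_def by (metis subsetD)
    have primes: "\<exists>s b. keys s \<subseteq> E \<and> prod_list ps = mon s * b \<and> normal b \<and> factors b"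
      if "\<And>p. p \<in> set ps \<Longrightarrow> prime_in L p" for ps
      using that
    proof (induction ps)
      case Nil
      then show ?case
        using normal_1 factors_unit[OF unit_in_one[OF U]] by (intro exI[of _ 0] exI[of _ 1]) simp
    next
      case (Cons p ps)
      have p: "prime_in L p" using Cons.prems by simp
      obtain s b where sb: "keys s \<subseteq> E" "prod_list ps = mon s * b" "normal b" "factors b"
        using Cons by auto
      obtain t where t: "keys t \<subseteq> E" "normal (mon t * p)" using normalize prime_inD(1,2)[OF p] by blast
      have "prime_in L (mon t * p)"
      proof -
        have tI: "keys t \<subseteq> I" "keys (- t) \<subseteq> I" using t(1) EI by auto
        have dvd: "dvd_in L (mon t * p) c \<longleftrightarrow> dvd_in L p c" for c
        proof
          assume "dvd_in L (mon t * p) c"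
          then show "dvd_in L p c"
            using dvd_in_trans[OF L _ , of p "mon t * p" c] dvd_in_mult2[OF L dvd_in_refl[OF L] mon_lau[OF K tI(1)]] by blast
        next
          assume "dvd_in L p c"
          moreover have "dvd_in L (mon t * p) p"
            by (rule dvd_inI[OF mon_lau[OF K tI(2)]]) (simp add: mult_ac flip: mult.assoc)
          ultimately show "dvd_in L (mon t * p) c" using dvd_in_trans[OF L] by blast
        qed
        have "\<not> unit_in L (mon t * p)"
          using unit_in_factor[OF L prime_inD(1)[OF p] mon_lau[OF K tI(1)]] prime_inD(3)[OF p] by (auto simp: mult.commute)
        then show ?thesis
          using p dvd mon_lau[OF K tI(1)] is_subringD(6)[OF L] by (auto simp: prime_in_def)
      qed
      then have "factors (mon t * p)" using normal_prime[OF t(2)] factors_prime by blast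
      moreover have "prod_list (p # ps) = mon (s - t) * ((mon t * p) * b)"
      proof -
        have "mon (s - t) * ((mon t * p) * b) = (mon (s - t) * mon t) * (p * b)" by (simp only: mult_ac)
        also have "mon (s - t) * mon t = (mon s :: 'a laurent)" by (simp add: mult_single)
        finally show ?thesis by (simp only: sb(2) mult.left_commute[of p] prod_list.Cons)
      qed
      moreover have "keys (s - t) \<subseteq> E" using keys_diff[of s t] sb(1) t(1) by auto
      ultimately show ?case using normal_mult[OF t(2) sb(3)] factors_mult sb(4) by blast
    qed
    obtain s b where sb: "keys s \<subseteq> E" "prod_list ps = mon s * b" "normal b" "factors b"
      using primes[of ps] ups(2) by blast
    have u0: "u \<in> L" "u \<noteq> 0" using ups(1) by (auto simp: unit_in_def)
    obtain t where t: "keys t \<subseteq> E" "normal (mon t * u)" using normalize[OF u0] by blast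
    have tI: "keys t \<subseteq> I" using t(1) EI by auto
    have "unit_in L (mon t)"
      unfolding unit_in_def using mon_lau[OF K tI] mon_lau[of K "- t" I, OF K] tI
      by (auto intro!: bexI[of _ "mon (- t)"])
    then have "unit_in U (mon t * u)" using normal_unit[OF t(2)] unit_in_mult[OF L _ ups(1)] by blast
    then have c: "normal ((mon t * u) * b)" "factors ((mon t * u) * b)"
      using normal_mult[OF t(2) sb(3)] factors_mult[OF factors_unit sb(4)] by auto
    define r where "r = s - t"
    have rE: "keys r \<subseteq> E" unfolding r_def using keys_diff[of s t] sb(1) t(1) by auto
    have a_eq: "a = mon r * ((mon t * u) * b)"
    proof -
      have "mon r * ((mon t * u) * b) = (mon r * mon t) * (u * b)" by (simp only: mult_ac)
      also have "mon r * mon t = (mon s :: 'a laurent)" by (simp add: r_def mult_single)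
      finally show ?thesis by (simp only: ups(3) sb(2) mult.left_commute[of u])
    qed
    \<comment> \<open>A negative exponent would make the normal cofactor of \<open>mon r\<close>
      divisible by \<open>x_j\<close>.\<close>
    have r_nonneg: "0 \<le> lookup r j" if j: "j \<in> E" for j
    proof (rule ccontr)
      assume neg: "\<not> 0 \<le> lookup r j"
      define r' where "r' = single j (lookup r j) - r"
      have r': "keys r' \<subseteq> I" "lookup r' j = 0"
        using keys_diff[of "single j (lookup r j)" r] rE j EI by (auto simp: r'_def lookup_minus split: if_splits)
      have "xs j (- lookup r j - 1) * (mon r' * a) \<in> A j"
      proof (rule is_subringD(6)[OF A])
        show "xs j (- lookup r j - 1) \<in> A j"
          using neg j EI by (intro lower_alg_mon K) (auto split: if_splits)
        show "mon r' * a \<in> A j" using mon_A_iff[OF r'] a(1) j by (auto simp: U_def)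
      qed
      also have "xs j (- lookup r j - 1) * (mon r' * a) = xs j (-1) * ((mon t * u) * b)"
      proof -
        have "single j (- lookup r j - 1) + (r' + r) = single j (-1)"
          by (simp add: r'_def flip: single_add)
        then have cancel: "xs j (- lookup r j - 1) * (mon r' * mon r) = (xs j (-1) :: 'a laurent)"
          by (simp add: mult_single)
        have "xs j (- lookup r j - 1) * (mon r' * a) =
            (xs j (- lookup r j - 1) * (mon r' * mon r)) * ((mon t * u) * b)"
          unfolding a_eq by (simp only: mult.assoc)
        then show ?thesis by (simp only: cancel)
      qed
      finally show False using c(1) j by (auto simp: normal_def)
    qed
    have "mon r = (\<Prod>j\<in>E. xs j 1 ^ nat (lookup r j))"
    proof -
      have xs_pow: "xs j 1 ^ k = xs j (int k)" for j k
        by (induction k) (auto simp: xs_mult)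
      have mon_sum: "mon (sum g Z) = (\<Prod>z\<in>Z. mon (g z) :: 'a laurent)" for g and Z :: "nat set"
        by (induction Z rule: infinite_finite_induct) (auto simp flip: mon_mult)
      have "r = (\<Sum>j\<in>keys r. single j (lookup r j))" by (rule laurent_sum_single)
      also have "\<dots> = (\<Sum>j\<in>E. single j (lookup r j))"
        using rE finE by (intro sum.mono_neutral_left) (auto simp: in_keys_iff)
      finally have "mon r = (\<Prod>j\<in>E. xs j (lookup r j))" using mon_sum by metis
      also have "\<dots> = (\<Prod>j\<in>E. xs j 1 ^ nat (lookup r j))"
        by (rule prod.cong) (auto simp: xs_pow r_nonneg)
      finally show ?thesis .
    qed
    then have "factors (mon r)"
      by (simp add: factors_prod factors_power factors_prime xs_prime_U)
    then show ?thesis unfolding a_eq using factors_mult c(2) by blast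
  qed
  then show ?thesis unfolding prime_factorial_def factors_def by blast
qed

end

section \<open>Factorial subrings of a field\<close>

lemma ring_on_simps [simp]:
  fixes S :: "'f::field set"
  shows "carrier (ring_on S) = S" "monoid.mult (ring_on S) a b = a * b" "monoid.one (ring_on S) = 1"
    "ring.zero (ring_on S) = 0" "ring.add (ring_on S) a b = a + b"
  by (simp_all add: ring_of_type_algebra_def)

lemma ring_of_type_algebra_simps [simp]:
  "carrier (ring_of_type_algebra :: 'f::field ring) = UNIV"
  "monoid.mult (ring_of_type_algebra :: 'f ring) = (*)" "monoid.one (ring_of_type_algebra :: 'f ring) = 1"
  "ring.zero (ring_of_type_algebra :: 'f ring) = 0" "ring.add (ring_of_type_algebra :: 'f ring) = (+)"
  by (auto simp: ring_of_type_algebra_def)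

lemma a_inv_type_algebra [simp]: "a_inv (ring_of_type_algebra :: 'f::field ring) a = - a"
proof -
  interpret R: field "ring_of_type_algebra :: 'f ring" by (rule field_from_type_algebra)
  have "ring.add (ring_of_type_algebra :: 'f ring) (- a) a = ring.zero ring_of_type_algebra" by simp
  then show ?thesis by (intro R.minus_equality) simp_all
qed

lemma subring_type_algebra_iff:
  fixes S :: "'f::field set"
  shows "subring S (ring_of_type_algebra :: 'f ring) \<longleftrightarrow> is_subring S"
proof
  interpret R: field "ring_of_type_algebra :: 'f ring" by (rule field_from_type_algebra)
  assume S: "subring S (ring_of_type_algebra :: 'f ring)"
  have mult: "a * b \<in> S" and add: "a + b \<in> S" and um: "- a \<in> S" and one: "1 \<in> S" if "a \<in> S" "b \<in> S" for a b
    using subringE[OF S] that by simp_all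
  have "1 \<in> S" using subringE(3)[OF S] by simp
  moreover have "a - b \<in> S" if "a \<in> S" "b \<in> S" for a b
    using add[OF that(1) um[OF that(2,1)]] um[OF that(2,1)] by simp
  ultimately show "is_subring S" using mult by (simp add: is_subring_def)
next
  interpret R: field "ring_of_type_algebra :: 'f ring" by (rule field_from_type_algebra)
  assume "is_subring S"
  note S = is_subringD[OF this]
  show "subring S (ring_of_type_algebra :: 'f ring)"
    by (rule R.subringI) (use S in simp_all)
qed

lemma is_subring_generate_ring:
  "is_subring (generate_ring (ring_of_type_algebra :: 'f::field ring) H)"
proof -
  interpret R: field "ring_of_type_algebra :: 'f ring" by (rule field_from_type_algebra)
  show ?thesis using R.generate_ring_is_subring[of H] by (simp add: subring_type_algebra_iff)
qed

lemma generate_ring_minimal: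
  assumes "is_subring S" "H \<subseteq> S"
  shows "generate_ring (ring_of_type_algebra :: 'f::field ring) H \<subseteq> S"
proof -
  interpret R: field "ring_of_type_algebra :: 'f ring" by (rule field_from_type_algebra)
  show ?thesis using R.generate_ring_min_subring1[of H S] assms by (simp add: subring_type_algebra_iff)
qed

lemma Units_ring_on: "u \<in> Units (ring_on S) \<longleftrightarrow> unit_in S u" for S :: "'f::field set"
  unfolding Units_def unit_in_def by (auto simp: mult.commute)

lemma divides_ring_on: "a divides\<^bsub>ring_on S\<^esub> b \<longleftrightarrow> dvd_in S a b" for S :: "'f::field set"
  by (auto simp: factor_def dvd_in_def)

lemma ring_prime_ring_on:
  "p \<in> S \<Longrightarrow> ring_prime\<^bsub>ring_on S\<^esub> p \<longleftrightarrow> prime_in S p" for S :: "'f::field set"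
  by (auto simp: ring_prime_def Divisibility.prime_def prime_in_def Units_ring_on divides_ring_on)

lemma domain_ring_on:
  fixes S :: "'f::field set"
  assumes "is_subring S"
  shows "domain (ring_on S)"
proof -
  interpret R: field "ring_of_type_algebra :: 'f ring" by (rule field_from_type_algebra)
  show ?thesis using R.subring_is_domain assms by (simp add: subring_type_algebra_iff)
qed

text \<open>An irreducible element is associated to the first prime of its factorisation, hence
  prime itself; uniqueness of factorisations in the multiplicative monoid follows from this.\<close>

lemma factorial_domain_ring_on:
  fixes S :: "'f::field set"
  assumes S: "is_subring S" and fact: "prime_factorial S"
  shows "factorial_domain (ring_on S)"
proof -
  interpret D: domain "ring_on S" by (rule domain_ring_on[OF S])
  let ?G = "mult_of (ring_on S)"
  have carr: "carrier ?G = S - {0}" and mult: "monoid.mult ?G a b = a * b" and one: "monoid.one ?G = 1" for a b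
    by (simp_all add: mult_of_def)
  have units: "u \<in> Units ?G \<longleftrightarrow> unit_in S u" for u
    unfolding Units_def unit_in_def carr mult one by (auto simp: mult.commute)
  have dvd: "a divides\<^bsub>?G\<^esub> b \<longleftrightarrow> dvd_in S a b" if "b \<noteq> 0" for a b
    using that unfolding factor_def dvd_in_def carr mult by auto
  have prime: "Divisibility.prime ?G p" if "prime_in S p" for p
    using prime_inD[OF that] unfolding Divisibility.prime_def units carr mult by (auto simp: dvd)
  have factor: "\<exists>u ps. unit_in S u \<and> (\<forall>p\<in>set ps. prime_in S p) \<and> a = u * prod_list ps" if "a \<in> S - {0}" for a
    using fact that unfolding prime_factorial_def by blast
  have "primeness_condition_monoid ?G"
  proof
    fix a assume a: "a \<in> carrier ?G" "Divisibility.irreducible ?G a"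
    obtain u ps where ups: "unit_in S u" "\<forall>p\<in>set ps. prime_in S p" "a = u * prod_list ps"
      using factor a(1) carr by blast
    have "ps \<noteq> []" using a(2) ups units unfolding Divisibility.irreducible_def by auto
    then obtain p qs where ps: "ps = p # qs" by (cases ps) auto
    have p: "prime_in S p" using ups ps by simp
    have pG: "p \<in> carrier ?G" using prime_inD(1,2)[OF p] carr by simp
    have "prod_list qs \<in> S" using ups(2) ps prime_inD(1) by (intro is_subring_prod_list[OF S]) auto
    then have "dvd_in S p a" using ups ps is_subringD(6)[OF S]
      by (intro dvd_inI[of "u * prod_list qs"]) (auto simp: unit_in_def mult_ac)
    then have pa: "p divides\<^bsub>?G\<^esub> a" using dvd a(1) carr by auto
    have "p \<notin> Units ?G" using prime_inD(3)[OF p] units by blast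
    then have "a divides\<^bsub>?G\<^esub> p" using a(2) pa pG unfolding Divisibility.irreducible_def properfactor_def by blast
    then have "p \<sim>\<^bsub>?G\<^esub> a" using pa by (simp add: associated_def)
    then show "Divisibility.prime ?G a" by (rule D.mult_of.prime_cong[OF prime[OF p] _ pG a(1)])
  qed
  then interpret P: primeness_condition_monoid ?G .
  have "factorial_monoid ?G"
  proof (rule D.mult_of.factorial_monoidI)
    fix a assume a: "a \<in> carrier ?G" "a \<notin> Units ?G"
    obtain u ps where ups: "unit_in S u" "\<forall>p\<in>set ps. prime_in S p" "a = u * prod_list ps"
      using factor a(1) carr by blast
    obtain v where v: "v \<in> S" "u * v = 1" using ups(1) by (auto simp: unit_in_def)
    have psG: "set ps \<subseteq> carrier ?G" using ups(2) prime_inD(1,2) carr by blast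
    have foldr: "foldr (monoid.mult ?G) ps (monoid.one ?G) = prod_list ps"
      by (induction ps) (simp_all add: mult one)
    have nz: "a \<noteq> 0" "prod_list ps \<noteq> 0" using a(1) carr ups(3) by auto
    have "dvd_in S (prod_list ps) a" using ups by (intro dvd_inI[of u]) (auto simp: unit_in_def mult.commute)
    moreover have "dvd_in S a (prod_list ps)"
      by (rule dvd_inI[OF v(1)]) (use v(2) in \<open>simp add: ups(3) mult_ac\<close>)
    ultimately have "prod_list ps \<sim>\<^bsub>?G\<^esub> a" using nz by (simp add: associated_def dvd)
    moreover have "Divisibility.irreducible ?G p" if "p \<in> set ps" for p
      using D.mult_of.prime_irreducible[OF prime] ups(2) that by blast
    ultimately show "\<exists>fs. set fs \<subseteq> carrier ?G \<and> wfactors ?G fs a"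
      using psG unfolding wfactors_def foldr[symmetric] by blast
  next
    fix a fs fs'
    assume "a \<in> carrier ?G" "set fs \<subseteq> carrier ?G" "set fs' \<subseteq> carrier ?G" "wfactors ?G fs a" "wfactors ?G fs' a"
    then show "essentially_equal ?G fs fs'" by (intro P.wfactors_unique)
  qed
  then show ?thesis unfolding factorial_domain_def using D.domain_axioms by simp
qed

lemma factorial_domain_prime:
  fixes S :: "'f::field set"
  assumes fd: "factorial_domain (ring_on S)" and a: "a \<in> S" "a \<noteq> 0" "\<not> unit_in S a"
    and irr: "\<And>c d. c \<in> S \<Longrightarrow> d \<in> S \<Longrightarrow> a = c * d \<Longrightarrow> unit_in S c \<or> unit_in S d"
  shows "prime_in S a"
proof -
  interpret D: factorial_domain "ring_on S" by (rule fd)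
  have "ring_irreducible\<^bsub>ring_on S\<^esub> a"
    by (rule D.ring_irreducibleI) (use a irr in \<open>auto simp: Units_ring_on\<close>)
  then have "Divisibility.irreducible (mult_of (ring_on S)) a"
    using D.irreducible_imp_irreducible_mult[of a] a by (simp add: ring_irreducible_def)
  then have "Divisibility.prime (mult_of (ring_on S)) a"
    using D.irreducible_prime[of a] a by simp
  then have "ring_prime\<^bsub>ring_on S\<^esub> a"
    using D.ring_primeI'[of a] a by simp
  then show ?thesis using ring_prime_ring_on[OF a(1)] by simp
qed

text \<open>Carries divisibility, primes and factorisations to the image. It serves for the
  constants inside the Laurent ring and for the evaluation in the ambient field.\<close>

locale ring_embedding =
  fixes h :: "'a::comm_ring_1 \<Rightarrow> 'b::comm_ring_1" and S :: "'a set"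
  assumes S: "is_subring S" and inj: "inj_on h S"
    and mult: "\<And>a b. h (a * b) = h a * h b" and one: "h 1 = 1" and zero: "h 0 = 0"
begin

lemma eq_iff: "a \<in> S \<Longrightarrow> b \<in> S \<Longrightarrow> h a = h b \<longleftrightarrow> a = b"
  using inj by (auto dest: inj_onD)

lemma dvd_image_iff: "a \<in> S \<Longrightarrow> b \<in> S \<Longrightarrow> dvd_in (h ` S) (h a) (h b) \<longleftrightarrow> dvd_in S a b"
  unfolding dvd_in_def by (auto simp: eq_iff is_subringD[OF S] simp flip: mult)

lemma unit_image_iff: "a \<in> S \<Longrightarrow> unit_in (h ` S) (h a) \<longleftrightarrow> unit_in S a"
  using eq_iff[of "a * _" 1] unfolding unit_in_def
  by (auto simp: is_subringD[OF S] one mult[symmetric])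

lemma prime_image_iff: "p \<in> S \<Longrightarrow> prime_in (h ` S) (h p) \<longleftrightarrow> prime_in S p"
  using eq_iff[of p 0] unfolding prime_in_def
  by (auto simp: unit_image_iff dvd_image_iff zero is_subringD[OF S] mult[symmetric])

lemma prime_factorial_image:
  assumes "prime_factorial S"
  shows "prime_factorial (h ` S)"
  unfolding prime_factorial_def
proof (intro ballI impI)
  fix a' assume "a' \<in> h ` S" "a' \<noteq> 0"
  then obtain a where a: "a \<in> S" "a' = h a" "a \<noteq> 0" using zero by auto
  obtain u ps where ups: "unit_in S u" "\<forall>p\<in>set ps. prime_in S p" "a = u * prod_list ps"
    using assms a unfolding prime_factorial_def by blast
  have "h (prod_list ps) = prod_list (map h ps)" for ps by (induction ps) (simp_all add: one mult)
  then have "a' = h u * prod_list (map h ps)" using a(2) ups(3) mult by simp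
  moreover have "unit_in (h ` S) (h u)" using ups(1) unit_image_iff by (auto simp: unit_in_def)
  moreover have "\<forall>p\<in>set (map h ps). prime_in (h ` S) p"
    using ups(2) prime_image_iff prime_inD(1) by auto
  ultimately show "\<exists>u ps. unit_in (h ` S) u \<and> (\<forall>p\<in>set ps. prime_in (h ` S) p) \<and> a' = u * prod_list ps"
    by blast
qed

lemma is_subring_image:
  assumes "\<And>a b. h (a - b) = h a - h b"
  shows "is_subring (h ` S)"
  unfolding is_subring_def
proof (intro conjI ballI)
  show "1 \<in> h ` S" using is_subringD(1)[OF S] one by (metis imageI)
  fix u v assume "u \<in> h ` S" "v \<in> h ` S"
  then obtain a b where ab: "a \<in> S" "b \<in> S" "u = h a" "v = h b" by blast
  show "u - v \<in> h ` S" unfolding ab(3,4) assms[symmetric] by (rule imageI) (rule is_subringD(3)[OF S ab(1,2)])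
  show "u * v \<in> h ` S" unfolding ab(3,4) mult[symmetric] by (rule imageI) (rule is_subringD(6)[OF S ab(1,2)])
qed

end

section \<open>The base ring and algebraic independence\<close>

lemma base_ring_subring: "base_ring K \<Longrightarrow> is_subring K"
  using subfieldE(1)[of K ring_of_type_algebra]
  by (auto simp: base_ring_def subring_type_algebra_iff) (auto simp: is_subring_def)

lemma prime_factorial_int: "prime_factorial (\<int> :: 'f::field_char_0 set)"
  unfolding prime_factorial_def
proof (intro ballI impI)
  fix a :: 'f assume "a \<in> \<int>" "a \<noteq> 0"
  then obtain z where z: "a = of_int z" "z \<noteq> 0" by (auto elim: Ints_cases)
  have dvd: "dvd_in \<int> (of_int p) (of_int q :: 'f) \<longleftrightarrow> p dvd q" for p q
    unfolding dvd_in_def dvd_def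
    by (auto elim!: Ints_cases simp flip: of_int_mult) (metis Ints_of_int of_int_mult)
  have unit: "unit_in \<int> (of_int u :: 'f) \<longleftrightarrow> u dvd 1" for u
    using dvd[of u 1] by (auto simp: unit_in_def dvd_in_def)
  have prime: "prime_in \<int> (of_int p :: 'f)" if "Factorial_Ring.prime p" for p
    unfolding prime_in_def
  proof (intro conjI ballI impI)
    show "\<not> unit_in \<int> (of_int p :: 'f)" using that unit not_prime_unit by blast
    fix a b :: 'f assume "a \<in> \<int>" "b \<in> \<int>" "dvd_in \<int> (of_int p) (a * b)"
    then show "dvd_in \<int> (of_int p) a \<or> dvd_in \<int> (of_int p) b"
      by (auto elim!: Ints_cases simp: dvd prime_dvd_mult_iff[OF that] simp flip: of_int_mult)
  qed (use that in auto)
  obtain ps where ps: "mset ps = prime_factorization z" using ex_mset by blast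
  have prod: "prod_list ps = normalize z"
    using prod_mset_prime_factorization[OF z(2)] ps by (simp flip: prod_mset_prod_list)
  have "prod_list (map of_int ps) = (of_int (prod_list ps) :: 'f)" by (induction ps) auto
  then have "a = of_int (unit_factor z) * prod_list (map of_int ps)"
    using z(1) unit_factor_mult_normalize[of z] prod by (metis of_int_mult)
  moreover have "unit_in \<int> (of_int (unit_factor z) :: 'f)"
    using unit unit_factor_is_unit[OF z(2)] by blast
  moreover have "\<forall>p\<in>set (map of_int ps). prime_in \<int> (p :: 'f)"
    using ps prime by (auto simp flip: set_mset_mset)
  ultimately show "\<exists>u ps. unit_in \<int> u \<and> (\<forall>p\<in>set ps. prime_in \<int> p) \<and> a = u * prod_list ps" by blast
qed

lemma prime_factorial_subfield:
  assumes "subfield K (ring_of_type_algebra :: 'f::field ring)"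
  shows "prime_factorial K"
proof -
  interpret R: field "ring_of_type_algebra :: 'f ring" by (rule field_from_type_algebra)
  have "unit_in K a" if "a \<in> K" "a \<noteq> 0" for a
    using R.subfield_m_inv(1,2)[OF assms, of a] that by (auto simp: unit_in_def)
  then show ?thesis unfolding prime_factorial_def
    by (intro ballI impI, rule_tac x = a in exI, rule_tac x = "[]" in exI) simp
qed

lemma prime_factorial_lau_empty:
  fixes K :: "'f::field_char_0 set"
  assumes "base_ring K"
  shows "prime_factorial (lau K {})"
proof -
  note K = base_ring_subring[OF assms]
  have eq: "lau K {} = single 0 ` K"
  proof (intro equalityI subsetI)
    fix p assume p: "p \<in> lau K {}"
    have "e = 0" if "e \<in> keys p" for e using lau_keys[OF p that] keys_eq_empty by auto
    then have "p = single 0 (lookup p 0)"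
      by (intro poly_mapping_eqI) (metis in_keys_iff lookup_single_eq lookup_single_not_eq)
    then show "p \<in> single 0 ` K" using lau_coeff[OF p] by blast
  qed (auto intro: lau_single K)
  interpret ring_embedding "single 0 :: 'f \<Rightarrow> 'f laurent" K
    by unfold_locales (use K in \<open>auto simp: mult_single intro!: inj_onI dest: arg_cong[where f = "\<lambda>p. lookup p 0"]\<close>)
  have "prime_factorial K"
    using assms prime_factorial_int prime_factorial_subfield by (auto simp: base_ring_def)
  then show ?thesis unfolding eq by (rule prime_factorial_image)
qed

text \<open>The polynomial ring, realised inside the Laurent ring so that divisibility in the two
  can be compared directly.\<close>

definition pol :: "'a::comm_ring_1 set \<Rightarrow> nat set \<Rightarrow> 'a laurent set" where
  "pol K I = {p \<in> lau K I. \<forall>e\<in>keys p. \<forall>l. 0 \<le> lookup e l}"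

lemma pol_lau: "pol K I \<subseteq> lau K I"
  by (auto simp: pol_def)

lemma is_subring_pol:
  assumes K: "is_subring K"
  shows "is_subring (pol K I)"
  unfolding is_subring_def
proof (intro conjI ballI)
  note L = is_subring_lau[OF K, of I]
  show "1 \<in> pol K I" using is_subringD(1)[OF L] by (auto simp: pol_def)
  fix p q assume pq: "p \<in> pol K I" "q \<in> pol K I"
  show "p - q \<in> pol K I"
  proof -
    have "e \<in> keys p \<union> keys q" if "e \<in> keys (p - q)" for e
      using that by (auto simp: in_keys_iff lookup_minus)
    then show ?thesis using pq is_subringD(3)[OF L, of p q] by (fastforce simp: pol_def)
  qed
  show "p * q \<in> pol K I"
    using pq is_subringD(6)[OF L, of p q] keys_mult_nonneg[of p _ q] by (auto simp: pol_def)
qed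

lemma clear_denominators:
  assumes K: "is_subring K" and J: "finite J" and g: "g \<in> lau K J"
  shows "\<exists>s. keys s \<subseteq> J \<and> (\<forall>l. 0 \<le> lookup s l) \<and> mon s * g \<in> pol K J"
  using g K
proof (induction rule: lau_induct)
  case zero
  then show ?case using is_subringD(2)[OF is_subring_pol[OF K]] by (intro exI[of _ 0]) auto
next
  case (add e c p)
  obtain t where t: "keys t \<subseteq> J" "\<And>l. 0 \<le> lookup t l" "mon t * p \<in> pol K J" using add by blast
  define s where "s = expvec J (\<lambda>l. \<bar>lookup e l\<bar>)"
  have s: "keys s \<subseteq> J" "\<And>l. 0 \<le> lookup s l" using keys_expvec[OF J] by (auto simp: s_def lookup_expvec[OF J])
  have es: "0 \<le> lookup (s + t + e) l" for l
  proof (cases "l \<in> J")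
    case False
    then have "lookup e l = 0" using add(2) by (auto simp: in_keys_iff)
    then show ?thesis using t(2)[of l] s(2)[of l] by (simp add: lookup_add)
  qed (use t(2)[of l] in \<open>simp add: s_def lookup_add lookup_expvec[OF J]\<close>)
  have single_pol: "single u k \<in> pol K J" if "k \<in> K" "keys u \<subseteq> J" "\<And>l. 0 \<le> lookup u l" for u k
    using that lau_single[OF K, of k u J] by (auto simp: pol_def split: if_splits)
  have "single (s + t + e) c + mon s * (mon t * p) \<in> pol K J"
  proof (rule is_subringD(5)[OF is_subring_pol[OF K]])
    show "single (s + t + e) c \<in> pol K J"
      using add(1,2) s t es by (intro single_pol keys_plus_subset)
    show "mon s * (mon t * p) \<in> pol K J"
      using is_subringD(6)[OF is_subring_pol[OF K] single_pol[OF is_subringD(1)[OF K] s] t(3)] .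
  qed
  also have "single (s + t + e) c + mon s * (mon t * p) = mon (s + t) * (single e c + p)"
    by (simp add: distrib_left mult_single flip: mult.assoc)
  finally show ?case using s t by (intro exI[of _ "s + t"]) (auto simp: lookup_add keys_plus_subset)
qed

text \<open>The hypothesis concerns natural exponents. A Laurent relation is multiplied by a
  monomial, and its exponent vectors are read as natural ones by the map \<open>c\<close>, which is
  injective on nonnegative vectors.\<close>

lemma alg_independent_indep:
  fixes K :: "'f::field_char_0 set"
  assumes K: "is_subring K" and J: "finite J" and ai: "alg_independent K J x"
  shows "coeff_hom.indep (\<lambda>c. c) K J x"
proof -
  interpret C: coeff_hom "\<lambda>c. c :: 'f" by unfold_locales auto
  \<comment> \<open>This comes first because \<open>mono_eval\<close> replaces vanishing values by
    1, whereas \<open>mpoly_eval\<close> does not.\<close>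
  have x_nz: "x k \<noteq> 0" if k: "k \<in> J" for k
  proof
    assume xk: "x k = 0"
    let ?p = "single (single k (1::nat)) (1::'f)"
    have "mpoly_eval x ?p = 0" using xk by (simp add: mpoly_eval_def)
    moreover have "\<forall>e\<in>keys ?p. lookup ?p e \<in> K \<and> keys e \<subseteq> J" using k K by (auto simp: is_subringD split: if_splits)
    ultimately have "?p = 0" using ai unfolding alg_independent_def by blast
    then show False by (metis lookup_single_eq lookup_zero zero_neq_one)
  qed
  have pol0: "p = 0" if p: "p \<in> pol K J" "C.ev x p = 0" for p
  proof -
    define c :: "(nat \<Rightarrow>\<^sub>0 int) \<Rightarrow> (nat \<Rightarrow>\<^sub>0 nat)" where "c = Poly_Mapping.map nat"
    have lc: "lookup (c e) l = nat (lookup e l)" for e l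
      by (simp add: c_def map.rep_eq when_def)
    have nonneg: "0 \<le> lookup e l" if "e \<in> keys p" for e l using p(1) that by (auto simp: pol_def)
    have inj: "inj_on c (keys p)"
    proof (rule inj_onI)
      fix e e' assume ee: "e \<in> keys p" "e' \<in> keys p" "c e = c e'"
      show "e = e'"
      proof (rule poly_mapping_eqI)
        fix l
        have "nat (lookup e l) = nat (lookup e' l)" using ee(3) lc by metis
        then show "lookup e l = lookup e' l" using nonneg ee by (metis eq_nat_nat_iff)
      qed
    qed
    define q where "q = (\<Sum>e\<in>keys p. single (c e) (lookup p e))"
    have lq: "lookup q (c e) = lookup p e" if e: "e \<in> keys p" for e
    proof -
      have "lookup q (c e) = (\<Sum>e'\<in>keys p. if e' = e then lookup p e' else 0)"
        unfolding q_def lookup_sum using inj e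
        by (intro sum.cong) (auto simp: lookup_single when_def dest: inj_onD)
      then show ?thesis using e by simp
    qed
    have keys_q: "keys q = c ` keys p"
    proof (intro equalityI subsetI)
      fix e assume "e \<in> keys q"
      then have "(\<Sum>e'\<in>keys p. lookup (single (c e') (lookup p e')) e) \<noteq> 0"
        by (simp add: q_def lookup_sum in_keys_iff)
      then obtain e' where "e' \<in> keys p" "lookup (single (c e') (lookup p e')) e \<noteq> 0"
        by (meson sum.neutral)
      then show "e \<in> c ` keys p" by (auto simp: lookup_single when_def split: if_splits)
    qed (use lq in \<open>auto simp: in_keys_iff\<close>)
    have keys_c: "keys (c e) = keys e" if "e \<in> keys p" for e
      using nonneg[OF that] by (auto simp: in_keys_iff lc) (metis order_antisym)
    have "mpoly_eval x q = (\<Sum>e\<in>keys p. lookup p e * (\<Prod>i\<in>keys e. x i ^ nat (lookup e i)))"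
      unfolding mpoly_eval_def keys_q using inj by (simp add: sum.reindex lq keys_c lc)
    also have "\<dots> = C.ev x p"
      unfolding laurent_eval_def mono_eval_def
    proof (intro sum.cong arg_cong2[of _ _ _ _ "(*)"] prod.cong)
      fix e k assume "e \<in> keys p" "k \<in> keys e"
      then show "x k ^ nat (lookup e k) = (if x k = 0 then 1 else x k) powi lookup e k"
        using x_nz[of k] nonneg[of e k] p(1) by (auto simp: pol_def lau_def power_int_def)
    qed auto
    finally have "mpoly_eval x q = 0" using p(2) by simp
    moreover have "\<forall>e\<in>keys q. lookup q e \<in> K \<and> keys e \<subseteq> J"
      unfolding keys_q using p(1) lq keys_c by (auto simp: pol_def lau_def)
    ultimately have "q = 0" using ai unfolding alg_independent_def by blast
    then have "keys p = {}" using keys_q by simp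
    then show "p = 0" by simp
  qed
  show ?thesis unfolding C.indep_def
  proof (intro ballI impI)
    fix p assume p: "p \<in> lau K J" "C.ev x p = 0"
    obtain s where "mon s * p \<in> pol K J" using clear_denominators[OF K J p(1)] by blast
    then have "mon s * p = 0" by (rule pol0) (simp add: C.ev_mult p(2))
    then show "p = 0" by simp
  qed
qed

section \<open>Primality of exchange polynomials\<close>

text \<open>A finite acyclic relation is well-founded, and a minimal element of \<open>D\<close> is
  a source.\<close>

lemma acyclic_seed_acyclic_on:
  assumes "acyclic_seed n b"
  shows "acyclic_on b {1..n}"
  unfolding acyclic_on_def
proof (intro allI impI)
  fix D :: "nat set" assume D: "D \<subseteq> {1..n}" "D \<noteq> {}"
  let ?r = "{(i, j). i \<in> {1..n} \<and> j \<in> {1..n} \<and> b i j > 0}"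
  have "finite ?r" by (rule finite_subset[of _ "{1..n} \<times> {1..n}"]) auto
  then have wf: "wf ?r" using assms finite_acyclic_wf by (auto simp: acyclic_seed_def)
  obtain e where e: "e \<in> D" "\<And>j. (j, e) \<in> ?r \<Longrightarrow> j \<notin> D"
  proof -
    obtain d where "d \<in> D" using D(2) by blast
    from wfE_min[OF wf this] show thesis using that by blast
  qed
  have "b j e \<le> 0" if "j \<in> D" for j
  proof (rule ccontr)
    assume "\<not> b j e \<le> 0"
    then have "(j, e) \<in> ?r" using that e(1) D(1) by auto
    then show False using e(2) that by blast
  qed
  then show "\<exists>e\<in>D. \<forall>j\<in>D. b j e \<le> 0" using e(1) by blast
qed

context
  fixes K :: "'a::{idom,ring_char_0} set" and I :: "nat set" and b :: "nat \<Rightarrow> nat \<Rightarrow> int"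
  assumes K: "is_subring K" and I: "finite I"
begin

text \<open>The two monomials have disjoint supports, so no variable divides both.\<close>

lemma exch_low: "low (deg l) (exch I b i :: 'a laurent) = 0"
proof -
  have "\<exists>e\<in>{posvec I b i, negvec I b i}. lookup e l = 0"
    by (auto simp: lookup_posvec[OF I] lookup_negvec[OF I])
  moreover have "posvec I b i \<in> keys (exch I b i :: 'a laurent)" "negvec I b i \<in> keys (exch I b i :: 'a laurent)"
    by (auto simp: exch_def in_keys_iff lookup_add lookup_single when_def)
  ultimately have "\<exists>e\<in>keys (exch I b i :: 'a laurent). lookup e l = 0" by auto
  then show ?thesis
    by (intro low_eqI) (auto simp: part_eq_0_iff exch_nonneg[OF I])
qed

lemma exch_pol: "exch I b i \<in> pol K I"
  using exch_lau[OF K I] exch_nonneg[OF I] by (auto simp: pol_def)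

text \<open>Lowest degrees are additive and vanish for the exchange polynomial in every variable, so
  the quotient has no poles if the dividend has none.\<close>

lemma exch_dvd_pol_iff:
  assumes a: "a \<in> pol K I"
  shows "dvd_in (lau K I) (exch I b i) a \<longleftrightarrow> dvd_in (pol K I) (exch I b i) a"
proof
  assume "dvd_in (lau K I) (exch I b i) a"
  then obtain q where q: "q \<in> lau K I" "a = exch I b i * q" by (auto simp: dvd_in_def)
  show "dvd_in (pol K I) (exch I b i) a"
  proof (cases "q = 0")
    case True
    then show ?thesis using q by (simp add: dvd_in_0 is_subring_pol[OF K])
  next
    case False
    have f0: "exch I b i \<noteq> (0 :: 'a laurent)" by (rule exch_neq_0[OF I])
    have "0 \<le> lookup e l" if e: "e \<in> keys q" for e l
    proof -
      have "low (deg l) a = low (deg l) q"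
        using low_mult(1)[OF additive_deg f0 False, of l] by (simp add: q(2) exch_low)
      moreover have "0 \<le> low (deg l) a"
      proof -
        have "a \<noteq> 0" using q(2) f0 False by simp
        then have "low (deg l) a \<in> deg l ` keys a" unfolding low_def by (intro Min_in) auto
        then show ?thesis using a by (auto simp: pol_def)
      qed
      ultimately show ?thesis using low_le[OF e, of "deg l"] by simp
    qed
    then show ?thesis using q by (auto simp: pol_def intro: dvd_inI)
  qed
next
  assume "dvd_in (pol K I) (exch I b i) a"
  then show "dvd_in (lau K I) (exch I b i) a" using pol_lau by (auto simp: dvd_in_def)
qed

text \<open>Monomials are units of the Laurent ring, and divisibility of polynomials by the exchange
  polynomial is the same in both rings; so denominators of the two factors can be cleared.\<close>

lemma exch_prime_pol_iff: "prime_in (pol K I) (exch I b i) \<longleftrightarrow> prime_in (lau K I) (exch I b i)"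
proof -
  note P = is_subring_pol[OF K, of I] and L = is_subring_lau[OF K, of I]
  let ?f = "exch I b i :: 'a laurent"
  have f: "?f \<in> pol K I" "?f \<in> lau K I" "?f \<noteq> 0" by (rule exch_pol exch_lau[OF K I] exch_neq_0[OF I])+
  have unit: "unit_in (pol K I) ?f \<longleftrightarrow> unit_in (lau K I) ?f"
  proof -
    have "unit_in S ?f \<longleftrightarrow> dvd_in S ?f 1" if "?f \<in> S" for S
      using that by (auto simp: unit_in_def dvd_in_def)
    then show ?thesis using exch_dvd_pol_iff[OF is_subringD(1)[OF P]] f by blast
  qed
  have dvd_mon: "dvd_in (lau K I) g p" if "keys s \<subseteq> I" "dvd_in (lau K I) g (mon s * p)" for g p :: "'a laurent" and s
  proof -
    have "dvd_in (lau K I) g (mon (- s) * (mon s * p))"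
      using that by (intro dvd_in_mult2[OF L that(2)] mon_lau K) auto
    then show ?thesis by simp
  qed
  show ?thesis
  proof
    assume prime: "prime_in (pol K I) ?f"
    show "prime_in (lau K I) ?f"
      unfolding prime_in_def
    proof (intro conjI ballI impI f)
      show "\<not> unit_in (lau K I) ?f" using prime_inD(3)[OF prime] unit by simp
      fix p q assume pq: "p \<in> lau K I" "q \<in> lau K I" "dvd_in (lau K I) ?f (p * q)"
      obtain s where s: "keys s \<subseteq> I" "mon s * p \<in> pol K I" using clear_denominators[OF K I pq(1)] by blast
      obtain t where t: "keys t \<subseteq> I" "mon t * q \<in> pol K I" using clear_denominators[OF K I pq(2)] by blast
      have eq: "mon (s + t) * (p * q) = (mon s * p) * (mon t * q)"
        by (simp add: mult_ac flip: mon_mult)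
      have "dvd_in (lau K I) ?f (mon (s + t) * (p * q))"
        by (rule dvd_in_mult2[OF L pq(3) mon_lau[OF K keys_plus_subset[OF s(1) t(1)]]])
      then have "dvd_in (pol K I) ?f ((mon s * p) * (mon t * q))"
        unfolding eq using exch_dvd_pol_iff is_subringD(6)[OF P s(2) t(2)] by blast
      then have "dvd_in (pol K I) ?f (mon s * p) \<or> dvd_in (pol K I) ?f (mon t * q)"
        using prime_inD(4)[OF prime s(2) t(2)] by blast
      then show "dvd_in (lau K I) ?f p \<or> dvd_in (lau K I) ?f q"
        using exch_dvd_pol_iff[OF s(2)] exch_dvd_pol_iff[OF t(2)] dvd_mon s(1) t(1) by blast
    qed
  next
    assume prime: "prime_in (lau K I) ?f"
    show "prime_in (pol K I) ?f"
      unfolding prime_in_def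
    proof (intro conjI ballI impI f)
      show "\<not> unit_in (pol K I) ?f" using prime_inD(3)[OF prime] unit by simp
      fix p q assume pq: "p \<in> pol K I" "q \<in> pol K I" "dvd_in (pol K I) ?f (p * q)"
      then show "dvd_in (pol K I) ?f p \<or> dvd_in (pol K I) ?f q"
        using prime_inD(4)[OF prime, of p q] exch_dvd_pol_iff[OF is_subringD(6)[OF P pq(1,2)]]
          exch_dvd_pol_iff[OF pq(1)] exch_dvd_pol_iff[OF pq(2)] pol_lau by blast
    qed
  qed
qed

text \<open>A single term forces the two monomials to coincide; having disjoint supports, they are
  then both 1.\<close>

lemma exch_neq_single:
  assumes "keys s \<subseteq> I" "exch I b i = (single s c :: 'a laurent)"
  shows "c = 2 \<and> (\<forall>j\<in>I. b j i = 0)"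
proof -
  have "posvec I b i \<in> keys (exch I b i :: 'a laurent)" "negvec I b i \<in> keys (exch I b i :: 'a laurent)"
    by (auto simp: exch_def in_keys_iff lookup_add lookup_single when_def)
  then have eq: "posvec I b i = s" "negvec I b i = s" unfolding assms(2) by (auto split: if_splits)
  have "b j i = 0" if "j \<in> I" for j
    using lookup_posvec[OF I, of b i j] lookup_negvec[OF I, of b i j] that eq by (auto simp: max_def split: if_splits)
  moreover have "lookup (exch I b i) s = (2 :: 'a)"
    unfolding exch_def eq by (simp only: lookup_add lookup_single_eq one_add_one)
  ultimately show ?thesis using assms(2) by simp
qed

lemma pol_lower_alg: "pol K I \<subseteq> lower_alg K I E g"
proof
  fix p assume p: "p \<in> pol K I"
  have "(\<Sum>e\<in>keys p. single e (lookup p e)) \<in> lower_alg K I E g"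
    using p by (intro is_subring_sum[OF is_subring_lower_alg[OF K]] lower_alg_single)
      (auto simp: pol_def lau_def)
  then show "p \<in> lower_alg K I E g" by (simp flip: laurent_sum_single)
qed

end

text \<open>If \<open>f_i\<close> divides the prime \<open>f_j\<close>, the two differ by a unit,
  that is, by a single term. Lowest degrees exclude a nontrivial monomial, and coefficient sums
  exclude a constant other than 1.\<close>

lemma coprime_of_distinct_primes:
  fixes K :: "'f::field_char_0 set"
  assumes K: "is_subring K" and I: "finite I"
    and prime: "\<And>i. i \<in> E \<Longrightarrow> prime_in (lau K I) (exch I b i)"
    and dist: "\<And>i j. i \<in> E \<Longrightarrow> j \<in> E \<Longrightarrow> i \<noteq> j \<Longrightarrow> exch I b i \<noteq> (exch I b j :: 'f laurent)"
  shows "coprime_exch K I b E"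
  unfolding coprime_exch_def
proof (intro ballI impI)
  note L = is_subring_lau[OF K, of I]
  interpret C: coeff_hom "\<lambda>c. c :: 'f" by unfold_locales auto
  fix i j and g :: "'f laurent"
  assume ij: "i \<in> E" "j \<in> E" "i \<noteq> j" and g: "g \<in> lau K I" and dvd: "dvd_in (lau K I) (exch I b i) (exch I b j * g)"
  have "\<not> dvd_in (lau K I) (exch I b i) (exch I b j :: 'f laurent)"
  proof
    assume "dvd_in (lau K I) (exch I b i) (exch I b j :: 'f laurent)"
    then obtain u where u: "unit_in (lau K I) u" "exch I b j = exch I b i * u"
      using prime_dvd_prime[OF L prime[OF ij(1)] prime[OF ij(2)]] by blast
    then obtain v where "u * v = 1" by (auto simp: unit_in_def)
    then obtain s c c' where sc: "u = single s c" "c * c' = 1" using laurent_unit by metis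
    then have s: "u = single s c" "c \<noteq> 0" by auto
    have "lookup s l = 0" for l
    proof -
      have "low (deg l) (exch I b i * u) = low (deg l) (exch I b i :: 'f laurent) + low (deg l) u"
        by (rule low_mult(1)[OF additive_deg exch_neq_0[OF I]]) (use \<open>u * v = 1\<close> in auto)
      then have "low (deg l) u = 0" unfolding u(2)[symmetric] exch_low[OF K I] by simp
      then show ?thesis unfolding s(1) using low_single[OF s(2), of "deg l" s] by simp
    qed
    then have "s = 0" by (intro poly_mapping_eqI) simp
    \<comment> \<open>comparing the sums of coefficients, which are \<open>2\<close> on both sides\<close>
    have sum2: "C.ev (\<lambda>_. 1) (exch I b i) = 2" for i
      by (simp add: exch_def C.ev_add C.ev_mon mono_eval_def)
    have "C.ev (\<lambda>_. 1) (exch I b j) = C.ev (\<lambda>_. 1) (exch I b i) * c"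
      unfolding u(2) C.ev_mult s(1) C.ev_single \<open>s = 0\<close> by simp
    then have "c = 1" unfolding sum2 by simp
    then have "exch I b j = (exch I b i :: 'f laurent)" using u(2) s(1) \<open>s = 0\<close> by simp
    then show False using dist[OF ij] by simp
  qed
  then show "dvd_in (lau K I) (exch I b i) g"
    using prime_inD(4)[OF prime[OF ij(1)] exch_lau[OF K I] g dvd] by blast
qed

section \<open>The cluster algebra inside the Laurent polynomial ring\<close>

locale acyclic_seed_setup = seed_ext K n m x0 b0 for K :: "'f::field_char_0 set" and n m x0 b0 +
  assumes acyc: "acyclic_seed n b0" and fact0: "prime_factorial (lau K {})"
begin

abbreviation "I \<equiv> {1..N}"
abbreviation "E \<equiv> {1..n}"
abbreviation "f \<equiv> (exch I b0 :: nat \<Rightarrow> 'f laurent)"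
abbreviation "ev \<equiv> laurent_eval (\<lambda>c. c :: 'f) x0"
abbreviation "L \<equiv> lau K I"
abbreviation "Alg \<equiv> cluster_algebra K n m x0 b0"

lemmas L = is_subring_lau[OF K, of I]

lemma EI: "E \<subseteq> I"
  by auto

lemma skew: "skew_signs b0 E"
  by (rule exchange_matrix_skew_signs[OF b0])

lemma f_free: "i \<in> E \<Longrightarrow> e \<in> keys (f i) \<Longrightarrow> lookup e i = 0"
  using exch_homogeneous[of I b0 i i e] skew_signs_diag[OF skew] by auto

lemma f_L: "f i \<in> L"
  by (rule exch_lau[OF K]) simp

lemma f_neq_0: "f i \<noteq> 0"
  by (rule exch_neq_0) simp

lemma x0_nz: "k \<in> I \<Longrightarrow> x0 k \<noteq> 0"
  using C.indep_nonzero[OF K ind] .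

lemma ev_f: "ev (f i) = exchange_poly n m x0 b0 i"
  unfolding exchange_poly_def using C.ev_exch[of n m x0 b0 i, OF x0_nz] by simp

lemma ev_var: "k \<in> I \<Longrightarrow> ev (mon (single k a)) = x0 k powi a"
  using mono_eval_single[of x0 k a] x0_nz by (simp add: C.ev_mon)

lemma emb: "S \<subseteq> L \<Longrightarrow> is_subring S \<Longrightarrow> ring_embedding ev S"
  using C.indep_inj[OF K ind] by unfold_locales (auto simp: C.ev_mult intro!: inj_onI)

lemma factL: "prime_factorial L"
  by (rule prime_factorial_lau[OF K fact0]) simp

lemma lower_L: "lower_alg K I D f \<subseteq> L"
  by (rule lower_alg_subset_lau[OF K]) (rule f_L)

text \<open>When exchange polynomials have a common factor, the conditions at pairs say more than
  those at single indices; the proof that the \<open>f_i\<close> are distinct depends on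
  them.\<close>

definition "W = {q \<in> L. \<forall>i\<in>E. \<forall>j\<in>E. q \<in> lower_alg K I {i, j} f}"

lemma W: "is_subring W"
  using L is_subring_lower_alg[OF K, of I _ f] unfolding W_def is_subring_def by auto

lemma W_single:
  assumes "p \<in> W" "i \<in> E"
  shows "p \<in> lower_alg K I {i} f"
proof -
  have "p \<in> lower_alg K I {i, i} f" using assms unfolding W_def by blast
  then show ?thesis by simp
qed

lemma mon_W: "keys s \<subseteq> I \<Longrightarrow> (\<And>j. j \<in> E \<Longrightarrow> 0 \<le> lookup s j) \<Longrightarrow> mon s \<in> W"
  unfolding W_def by (auto intro!: mon_lau lower_alg_mon K)

lemma Alg_W: "Alg \<subseteq> ev ` W"
  unfolding cluster_algebra_def
proof (rule generate_ring_minimal)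
  interpret W: ring_embedding ev W by (rule emb[OF _ W]) (auto simp: W_def)
  show "is_subring (ev ` W)" by (rule W.is_subring_image) (rule C.ev_diff)
  have "c \<in> ev ` W" if "c \<in> K" for c
  proof -
    have "single 0 c \<in> W" using that unfolding W_def by (auto intro!: lau_single lower_alg_single K)
    then show ?thesis by (intro image_eqI[of _ _ "single 0 c"]) (auto simp: C.ev_single)
  qed
  moreover have "z \<in> ev ` W" if z: "z \<in> cluster_variables n m x0 b0" for z
  proof -
    obtain i where i: "i \<in> E" using z by (auto simp: cluster_variables_def)
    obtain q where q: "q \<in> L" "z = ev q" using cluster_variable_lower[OF z i i] lower_L by blast
    have "q \<in> lower_alg K I {i, j} f" if ij: "i \<in> E" "j \<in> E" for i j
    proof -
      \<comment> \<open>The representatives obtained for different pairs agree because evaluation is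
        injective on \<open>L\<close>.\<close>
      obtain q' where q': "q' \<in> lower_alg K I {i, j} f" "z = ev q'" using cluster_variable_lower[OF z ij] by blast
      then have "q' = q" using C.indep_inj[OF K ind, of q' q] q lower_L by auto
      then show ?thesis using q' by simp
    qed
    then show ?thesis using q by (auto simp: W_def)
  qed
  moreover have "x0 l \<in> ev ` W" "inverse (x0 l) \<in> ev ` W" if l: "l \<in> {n+1..N}" for l
  proof -
    have "mon (single l a) \<in> W" for a
      by (rule mon_W) (use l in \<open>auto simp: lookup_single when_def split: if_splits\<close>)
    from imageI[OF this, of ev] l ev_var[of l] show "x0 l \<in> ev ` W" "inverse (x0 l) \<in> ev ` W"
      by (metis (no_types, lifting) atLeastAtMost_iff le_add2 order_trans power_int_1_right trans_le_add1 add.commute le_add1 power_int_minus1_right)+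
  qed
  ultimately show "K \<union> cluster_variables n m x0 b0 \<union> x0 ` {n+1..N} \<union> (\<lambda>j. inverse (x0 j)) ` {n+1..N} \<subseteq> ev ` W"
    by auto
qed

lemma lower_Alg: "p \<in> lower_alg K I E f \<Longrightarrow> ev p \<in> Alg"
proof (rule lower_alg_image[OF _ EI _ C.ev_add C.ev_mult C.ev_1])
  show "is_subring Alg" unfolding cluster_algebra_def by (rule is_subring_generate_ring)
  have incl: "z \<in> Alg" if "z \<in> K \<union> cluster_variables n m x0 b0 \<union> x0 ` {n+1..N} \<union> (\<lambda>j. inverse (x0 j)) ` {n+1..N}" for z
    unfolding cluster_algebra_def using that by (rule generate_ring.incl)
  show "ev (single 0 c) \<in> Alg" if "c \<in> K" for c
    using incl[of c] that by (simp add: C.ev_single)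
  show "ev (mon (single l 1)) \<in> Alg \<and> ev (mon (single l (-1))) \<in> Alg" if "l \<in> I - E" for l
  proof -
    have "l \<in> I" "l \<in> {n+1..N}" using that by auto
    then show ?thesis
      using incl[of "x0 l"] incl[of "inverse (x0 l)"] ev_var[of l 1] ev_var[of l "-1"]
      by (simp add: power_int_minus del: One_nat_def)
  qed
  show "ev (mon (single j 1)) \<in> Alg \<and> ev (mon (single j (-1)) * f j) \<in> Alg" if j: "j \<in> E" for j
  proof
    have "x0 j \<in> cluster_variables n m x0 b0"
      unfolding cluster_variables_def using j mutation_reachable.refl[of n m x0 b0] by blast
    then show "ev (mon (single j 1)) \<in> Alg" using incl[of "x0 j"] ev_var[of j] EI j by auto
    have "mutate_vars n m j x0 b0 j \<in> cluster_variables n m x0 b0"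
      unfolding cluster_variables_def using j mutation_reachable.step[OF mutation_reachable.refl j] by blast
    moreover have "mutate_vars n m j x0 b0 j = ev (mon (single j (-1)) * f j)"
    proof -
      have "j \<in> I" using EI j by blast
      then show ?thesis
        unfolding C.ev_mult ev_f using ev_var[of j "-1"]
        by (simp add: mutate_vars_def power_int_minus divide_inverse mult.commute del: One_nat_def)
    qed
    ultimately show "ev (mon (single j (-1)) * f j) \<in> Alg" using incl by auto
  qed
qed auto

text \<open>The cluster algebra pulled back to the Laurent ring; nothing is lost, since
  \<open>Alg_W\<close> puts it inside the image of \<open>L\<close>.\<close>

definition "A = {p \<in> L. ev p \<in> Alg}"

lemma A: "is_subring A"
proof -
  have "is_subring Alg" unfolding cluster_algebra_def by (rule is_subring_generate_ring)
  then show ?thesis using L unfolding A_def is_subring_def by (auto simp: C.ev_diff C.ev_mult)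
qed

lemma Alg_eq: "Alg = ev ` A"
  using Alg_W by (auto simp: A_def W_def)

lemma A_W: "A \<subseteq> W"
proof
  fix p assume p: "p \<in> A"
  then obtain q where "q \<in> W" "ev p = ev q" using Alg_W by (auto simp: A_def)
  then have "p = q" using C.indep_inj[OF K ind, of p q] p by (auto simp: A_def W_def)
  then show "p \<in> W" using \<open>q \<in> W\<close> by simp
qed

lemma lower_A: "lower_alg K I E f \<subseteq> A"
  using lower_L lower_Alg by (auto simp: A_def)

lemma mon_A: "keys s \<subseteq> I \<Longrightarrow> (\<And>j. j \<in> E \<Longrightarrow> 0 \<le> lookup s j) \<Longrightarrow> mon s \<in> A"
  using lower_A by (auto intro!: lower_alg_mon K)

sublocale A: ring_embedding ev A
  by (rule emb[OF _ A]) (auto simp: A_def)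

lemma seed_polynomials_eq: "seed_polynomials K n m x0 = ev ` pol K I"
proof
  interpret P: ring_embedding ev "pol K I" by (rule emb[OF pol_lau is_subring_pol[OF K]])
  show "seed_polynomials K n m x0 \<subseteq> ev ` pol K I"
    unfolding seed_polynomials_def
  proof (rule generate_ring_minimal)
    show "is_subring (ev ` pol K I)" by (rule P.is_subring_image) (rule C.ev_diff)
    have "c \<in> ev ` pol K I" if "c \<in> K" for c
      using that lau_single[OF K that, of 0 I]
      by (intro image_eqI[of _ _ "single 0 c"]) (auto simp: C.ev_single pol_def split: if_splits)
    moreover have "x0 l \<in> ev ` pol K I" if "l \<in> I" for l
      using that ev_var[OF that, of 1] mon_lau[OF K, of "single l 1" I]
      by (intro image_eqI[of _ _ "mon (single l 1)"]) (auto simp: pol_def lookup_single when_def)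
    ultimately show "K \<union> x0 ` {1..n + m} \<subseteq> ev ` pol K I" by auto
  qed
  have R: "is_subring (seed_polynomials K n m x0)"
    unfolding seed_polynomials_def by (rule is_subring_generate_ring)
  have incl: "z \<in> seed_polynomials K n m x0" if "z \<in> K \<union> x0 ` {1..n+m}" for z
    unfolding seed_polynomials_def using that by (rule generate_ring.incl)
  show "ev ` pol K I \<subseteq> seed_polynomials K n m x0"
  proof
    fix z assume "z \<in> ev ` pol K I"
    then obtain p where p: "p \<in> pol K I" "z = ev p" by blast
    have "ev p \<in> seed_polynomials K n m x0"
      unfolding laurent_eval_def mono_eval_def
    proof (intro is_subring_sum[OF R] is_subringD(6)[OF R] is_subring_prod[OF R])
      fix e assume e: "e \<in> keys p"
      show "lookup p e \<in> seed_polynomials K n m x0"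
        using p(1) by (intro incl) (auto simp: pol_def lau_def)
      fix k assume k: "k \<in> keys e"
      have "keys e \<subseteq> I" by (rule lau_keys[OF subsetD[OF pol_lau p(1)] e])
      then have "k \<in> I" "0 \<le> lookup e k" using p(1) e k by (auto simp: pol_def)
      then show "(if x0 k = 0 then 1 else x0 k) powi lookup e k \<in> seed_polynomials K n m x0"
        using x0_nz[of k] incl[of "x0 k"] is_subring_power[OF R] by (auto simp: power_int_def)
    qed
    then show "z \<in> seed_polynomials K n m x0" using p(2) by simp
  qed
qed

lemma ring_prime_exchange_iff:
  "ring_prime\<^bsub>ring_on (seed_polynomials K n m x0)\<^esub> (exchange_poly n m x0 b0 i) \<longleftrightarrow> prime_in L (f i)"
proof -
  interpret P: ring_embedding ev "pol K I" by (rule emb[OF pol_lau is_subring_pol[OF K]])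
  have f: "f i \<in> pol K I" by (rule exch_pol[OF K]) simp
  have "ring_prime\<^bsub>ring_on (ev ` pol K I)\<^esub> (ev (f i)) \<longleftrightarrow> prime_in (ev ` pol K I) (ev (f i))"
    using f by (intro ring_prime_ring_on) blast
  also have "\<dots> \<longleftrightarrow> prime_in L (f i)"
    using P.prime_image_iff[OF f] exch_prime_pol_iff[OF K, of I b0 i] by simp
  finally show ?thesis unfolding seed_polynomials_eq ev_f .
qed

lemma exchange_eq_iff: "exchange_poly n m x0 b0 i = exchange_poly n m x0 b0 j \<longleftrightarrow> f i = f j"
  using C.indep_inj[OF K ind f_L f_L] ev_f by metis

text \<open>The lower bound, \<open>A\<close>, \<open>W\<close> and \<open>P.U\<close> form an
  increasing chain, and coprimality puts the last into the first. So all four agree, and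
  \<open>P.U\<close> is factorial.\<close>

theorem factorial_if_primes:
  assumes prime: "\<And>i. i \<in> E \<Longrightarrow> prime_in L (f i)"
    and dist: "\<And>i j. i \<in> E \<Longrightarrow> j \<in> E \<Longrightarrow> i \<noteq> j \<Longrightarrow> f i \<noteq> f j"
  shows "factorial_domain (ring_on Alg)"
proof -
  interpret P: prime_exchange K I E f
    using K f_free prime factL by unfold_locales auto
  have cop: "coprime_exch K I b0 E"
    by (rule coprime_of_distinct_primes[OF K]) (use prime dist in auto)
  have "P.U \<subseteq> lower_alg K I E f"
  proof
    fix p assume "p \<in> P.U"
    then have "p \<in> L" "\<And>j. j \<in> E \<Longrightarrow> p \<in> lower_alg K I {j} f" unfolding P.U_def by blast+
    then show "p \<in> lower_alg K I E f"
      using upper_bound_subset_lower_alg[OF K _ EI skew acyclic_seed_acyclic_on[OF acyc] cop] by simp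
  qed
  moreover have "W \<subseteq> P.U"
  proof
    fix p assume p: "p \<in> W"
    have "p \<in> lower_alg K I {i} f" if "i \<in> E" for i
      using W_single[OF p that] .
    moreover have "p \<in> L" using p unfolding W_def by blast
    ultimately show "p \<in> P.U" unfolding P.U_def by blast
  qed
  ultimately have "A = P.U" using A_W lower_A by blast
  then have "prime_factorial Alg"
    using A.prime_factorial_image P.prime_factorial_U Alg_eq by metis
  moreover have "is_subring Alg" unfolding cluster_algebra_def by (rule is_subring_generate_ring)
  ultimately show ?thesis by (intro factorial_domain_ring_on)
qed

end

text \<open>\<open>nonunit\<close> is the form in which the condition on isolated indices
  enters.\<close>

locale factorial_seed = acyclic_seed_setup +
  assumes fd: "factorial_domain (ring_on (cluster_algebra K n m x0 b0))"
    and nonunit: "\<And>i. i \<in> {1..n} \<Longrightarrow> \<not> unit_in (lau K {1..n+m}) (exch {1..n+m} b0 i)"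
begin

lemma irreducible_prime_A:
  assumes "a \<in> A" "a \<noteq> 0" "\<not> unit_in A a"
    and irr: "\<And>c d. c \<in> A \<Longrightarrow> d \<in> A \<Longrightarrow> a = c * d \<Longrightarrow> unit_in A c \<or> unit_in A d"
  shows "prime_in A a"
proof -
  have "prime_in (ev ` A) (ev a)"
  proof (rule factorial_domain_prime)
    show "factorial_domain (ring_on (ev ` A))" using fd Alg_eq by simp
    show "ev a \<noteq> 0" using A.eq_iff[OF assms(1) is_subringD(2)[OF A]] assms(2) by simp
    show "\<not> unit_in (ev ` A) (ev a)" using A.unit_image_iff assms by blast
    fix c' d' assume "c' \<in> ev ` A" "d' \<in> ev ` A" and eq: "ev a = c' * d'"
    then obtain c d where cd: "c \<in> A" "d \<in> A" "c' = ev c" "d' = ev d" by blast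
    have "ev a = ev (c * d)" using eq cd by (simp add: C.ev_mult)
    then have "a = c * d" using A.eq_iff[OF assms(1) is_subringD(6)[OF A cd(1,2)]] by simp
    then show "unit_in (ev ` A) c' \<or> unit_in (ev ` A) d'"
      using irr[OF cd(1,2)] A.unit_image_iff cd by blast
  qed (use assms in blast)
  then show ?thesis using A.prime_image_iff[OF assms(1)] by simp
qed

lemma A_pole:
  assumes i: "i \<in> E" and p: "p \<in> A"
  shows "dvd_in L (f i ^ k) (part (deg i) (- int k) p)"
proof -
  have "p \<in> lower_alg K I {i} f"
    using W_single[OF subsetD[OF A_W p] i] .
  then show ?thesis using lower_alg_one_iff[where g = f and j = i, OF K f_L f_free[OF i]] by blast
qed

lemma f_not_dvd_unit: "i \<in> E \<Longrightarrow> u * v = 1 \<Longrightarrow> v \<in> L \<Longrightarrow> \<not> dvd_in L (f i) u"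
proof
  assume i: "i \<in> E" and uv: "u * v = 1" "v \<in> L" and "dvd_in L (f i) u"
  then obtain c where c: "c \<in> L" "u = f i * c" by (auto simp: dvd_in_def)
  have "f i * (c * v) = 1" using uv(1) c(2) by (simp add: mult.assoc)
  then have "unit_in L (f i)" using f_L is_subringD(6)[OF L c(1) uv(2)] by (auto simp: unit_in_def)
  then show False using nonunit[OF i] by simp
qed

text \<open>A pole at \<open>j\<close> would make the term divisible by \<open>f j\<close>; but the
  term is a unit of the Laurent ring and \<open>f j\<close> is not.\<close>

lemma single_A_nonneg:
  assumes j: "j \<in> E" and A: "single s c \<in> A" and c: "c * c' = 1" "c' \<in> K"
  shows "0 \<le> lookup s j"
proof (rule ccontr)
  assume neg: "\<not> 0 \<le> lookup s j"
  define k where "k = nat (- lookup s j)"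
  have pow: "dvd_in L (f j ^ k) (single s c)"
    using A_pole[OF j A, of k] neg by (simp add: part_single k_def)
  have "dvd_in L (f j ^ 1) (f j ^ k)"
    by (rule dvd_in_power_le[OF L f_L]) (use neg in \<open>simp add: k_def\<close>)
  from dvd_in_trans[OF L this pow] have "dvd_in L (f j) (single s c)" unfolding power_one_right .
  moreover have "single s c * single (- s) c' = 1" using c(1) by (simp add: mult_single)
  moreover have "single (- s) c' \<in> L"
  proof (rule lau_single[OF K c(2)])
    have "single s c \<in> L" "c \<noteq> 0" using A c(1) by (auto simp: A_def)
    then show "keys (- s) \<subseteq> I" using lau_keys[of "single s c" K I s] by simp
  qed
  ultimately show False using f_not_dvd_unit[OF j, of "single s c" "single (- s) c'"] by blast
qed

text \<open>In a factorisation of \<open>x_i\<close> both factors are single terms with nonnegative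
  exponents at exchangeable indices. These exponents add up to 1 at \<open>i\<close> and to 0
  elsewhere, so one factor has none and is a unit.\<close>

lemma var_prime_A:
  assumes i: "i \<in> E"
  shows "prime_in A (mon (single i 1))"
proof (rule irreducible_prime_A)
  have iI: "i \<in> I" using i EI by auto
  note one = is_subringD(1)[OF K]
  show "mon (single i 1) \<in> A"
    using iI by (intro mon_A) (auto simp: lookup_single when_def)
  show "mon (single i 1) \<noteq> (0 :: 'a laurent)" by simp
  show "\<not> unit_in A (mon (single i 1))"
  proof
    assume "unit_in A (mon (single i 1))"
    then obtain v where v: "v \<in> A" "mon (single i 1) * v = 1" by (auto simp: unit_in_def)
    have "v = mon (- single i 1) * (mon (single i 1) * v)" by simp
    also have "\<dots> = single (- single i 1) 1" unfolding v(2) by simp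
    finally have "single (- single i 1) 1 \<in> A" using v(1) by simp
    from single_A_nonneg[OF i this, of 1] one show False by simp
  qed
  fix c d assume cd: "c \<in> A" "d \<in> A" "mon (single i 1) = c * d"
  have "c * (d * mon (- single i 1)) = 1"
    using cd(3) by (metis mon_mult_uminus(1) mult.assoc)
  then obtain s k k' where s: "c = single s k" "d * mon (- single i 1) = single (- s) k'" "k * k' = 1"
    by (rule laurent_unit)
  define t where "t = single i 1 - s"
  have "d = (d * mon (- single i 1)) * mon (single i 1)" by (simp add: mult.assoc)
  also have "\<dots> = single t k'" unfolding s(2) by (simp add: mult_single t_def)
  finally have d: "d = single t k'" .
  have k: "k \<in> K" "k' \<in> K" "k' * k = 1"
    using lau_coeff[of c K I s] lau_coeff[of d K I t] cd s d by (auto simp: A_def mult.commute)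
  have nz: "k \<noteq> 0" "k' \<noteq> 0" using s(3) by auto
  have keys: "keys s \<subseteq> I" "keys t \<subseteq> I"
    using lau_keys[of c K I s] lau_keys[of d K I t] cd s d nz by (auto simp: A_def)
  have s0: "0 \<le> lookup s j" and t0: "0 \<le> lookup t j" if "j \<in> E" for j
    using single_A_nonneg[OF that _ s(3) k(2)] single_A_nonneg[OF that _ k(3,1)] cd s d by auto
  have unit: "unit_in A (single u l)"
    if "l \<in> K" "l' \<in> K" "l * l' = 1" "keys u \<subseteq> I" "\<And>j. j \<in> E \<Longrightarrow> lookup u j = 0" for u l l'
  proof -
    have "single u l \<in> lower_alg K I E f" "single (- u) l' \<in> lower_alg K I E f"
      by (rule lower_alg_single; use that in simp)+
    then have "single u l \<in> A" "single (- u) l' \<in> A" using lower_A by blast+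
    then show ?thesis using that(3) unfolding unit_in_def by (auto simp: mult_single intro!: bexI[of _ "single (- u) l'"])
  qed
  have st: "lookup s j + lookup t j = (if j = i then 1 else 0)" for j
    by (simp add: t_def lookup_minus lookup_single when_def)
  show "unit_in A c \<or> unit_in A d"
  proof (cases "lookup s i = 0")
    case True
    have "lookup s j = 0" if "j \<in> E" for j
      using st[of j] s0[OF that] t0[OF that] True by (auto split: if_splits)
    then show ?thesis using unit[OF k(1,2) s(3) keys(1)] s(1) by blast
  next
    case False
    then have "lookup t i = 0" using st[of i] s0[OF i] t0[OF i] by auto
    then have "lookup t j = 0" if "j \<in> E" for j
      using st[of j] s0[OF that] t0[OF that] by (auto split: if_splits)
    then show ?thesis using unit[OF k(2,1,3) keys(2)] d by blast
  qed
qed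

text \<open>A relation \<open>p * q = f_i * c\<close> is multiplied by monomials until everything is
  polynomial and thus in \<open>A\<close>, and \<open>f_i\<close> is written as \<open>x_i\<close>
  times \<open>f_i / x_i\<close>. If \<open>x_i\<close> then divides, say, \<open>p\<close>, the
  quotient has a simple pole whose coefficient \<open>p\<close> must be divisible by
  \<open>f_i\<close>. Working without the variable \<open>x_i\<close> keeps \<open>p\<close> in
  degree 0.\<close>

lemma exchange_prime:
  assumes i: "i \<in> E"
  shows "prime_in L (f i)"
proof -
  let ?J = "I - {i}"
  have iI: "i \<in> I" using i EI by auto
  have "prime_factorial (lau K ?J)"
    by (rule prime_factorial_lau[OF K fact0]) simp
  then interpret g: gauss K ?J i using K by unfold_locales auto
  have T: "insert i ?J = I" using iI by auto
  have J: "finite ?J" by simp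
  have fS: "f i \<in> lau K ?J"
    using f_L[of i] f_free[OF i] by (auto simp: lau_def in_keys_iff)
  have S_L: "lau K ?J \<subseteq> L" by (rule lau_mono) auto
  have pol_A: "p \<in> A" if "p \<in> pol K ?J" for p
  proof -
    have "p \<in> pol K I" using that S_L by (auto simp: pol_def)
    then show ?thesis using pol_lower_alg[OF K] lower_A by blast
  qed
  have "prime_in (lau K ?J) (f i)"
    unfolding prime_in_def
  proof (intro conjI ballI impI fS f_neq_0)
    show "\<not> unit_in (lau K ?J) (f i)" using unit_in_mono[OF _ S_L] nonunit[OF i] by blast
    fix p q assume p: "p \<in> lau K ?J" and q: "q \<in> lau K ?J" and dvd: "dvd_in (lau K ?J) (f i) (p * q)"
    obtain c where c: "c \<in> lau K ?J" "p * q = f i * c" using dvd by (auto simp: dvd_in_def)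
    obtain s where s: "keys s \<subseteq> ?J" "\<And>l. 0 \<le> lookup s l" "mon s * p \<in> pol K ?J"
      using clear_denominators[OF K J p] by blast
    obtain t where t: "keys t \<subseteq> ?J" "\<And>l. 0 \<le> lookup t l" "mon t * q \<in> pol K ?J"
      using clear_denominators[OF K J q] by blast
    obtain u where u: "keys u \<subseteq> ?J" "\<And>l. 0 \<le> lookup u l" "mon u * c \<in> pol K ?J"
      using clear_denominators[OF K J c(1)] by blast
    have mon_pol: "mon v \<in> pol K ?J" if "keys v \<subseteq> ?J" "\<And>l. 0 \<le> lookup v l" for v
      using that mon_lau[OF K that(1)] by (auto simp: pol_def split: if_splits)
    note P = is_subring_pol[OF K, of ?J]
    let ?p = "mon u * (mon s * p)" and ?q = "mon t * q"
    have pA: "?p \<in> A" "?q \<in> A" "mon s * (mon t * (mon u * c)) \<in> A"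
      by (rule pol_A[OF is_subringD(6)[OF P mon_pol[OF u(1,2)] s(3)]] pol_A[OF t(3)]
          pol_A[OF is_subringD(6)[OF P mon_pol[OF s(1,2)] is_subringD(6)[OF P mon_pol[OF t(1,2)] u(3)]]])+
    have y: "mon (single i (-1)) * f i \<in> A"
    proof -
      have "single (single i (-1)) 1 * (\<Prod>l\<in>E. f l ^ (if l = i then 1 else 0)) \<in> lower_alg K I E f"
        by (rule lower_alg_term) (use iI K in \<open>auto simp: is_subringD lookup_single when_def\<close>)
      also have "(\<Prod>l\<in>E. f l ^ (if l = i then 1 else 0)) = f i"
        using prod.remove[of E i "\<lambda>l. f l ^ (if l = i then 1 else 0)"] i by simp
      finally show ?thesis using lower_A by blast
    qed
    have "?p * ?q = mon s * (mon t * (mon u * (p * q)))" by (simp only: mult_ac)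
    also have "\<dots> = f i * (mon s * (mon t * (mon u * c)))" unfolding c(2) by (simp only: mult_ac)
    also have "\<dots> = (mon (single i 1) * (mon (single i (-1)) * f i)) * (mon s * (mon t * (mon u * c)))"
      by (simp add: mult_single flip: mult.assoc single_add)
    also have "\<dots> = mon (single i 1) * ((mon (single i (-1)) * f i) * (mon s * (mon t * (mon u * c))))"
      by (simp only: mult.assoc)
    finally have "dvd_in A (mon (single i 1)) (?p * ?q)"
      using is_subringD(6)[OF A y pA(3)] by (auto intro: dvd_inI)
    then have X: "dvd_in A (mon (single i 1)) ?p \<or> dvd_in A (mon (single i 1)) ?q"
      using prime_inD(4)[OF var_prime_A[OF i] pA(1,2)] by blast
    have conv: "dvd_in (lau K ?J) (f i) r"
      if r: "r \<in> lau K ?J" "keys v \<subseteq> ?J" "dvd_in A (mon (single i 1)) (mon v * r)" for r v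
    proof -
      obtain d where d: "d \<in> A" "mon v * r = mon (single i 1) * d" using r(3) by (auto simp: dvd_in_def)
      have "d = mon (single i (-1)) * (mon v * r)"
        unfolding d(2) by (simp add: mult_single flip: mult.assoc single_add)
      moreover have vr: "mon v * r \<in> lau K ?J" using is_subringD(6)[OF g.S] mon_lau[OF K r(2)] r(1) by blast
      then have "part (deg i) 0 (mon v * r) = mon v * r"
        using g.S_deg by (intro poly_mapping_eqI) (auto simp: lookup_part in_keys_iff)
      ultimately have "part (deg i) (- int 1) d = mon (single i (-1)) * (mon v * r)"
        by (simp add: part_single_mult)
      then have "dvd_in L (f i) (mon (single i (-1)) * (mon v * r))"
        using A_pole[OF i d(1), of 1] by simp
      then have "dvd_in L (f i) (mon (single i 1) * (mon (single i (-1)) * (mon v * r)))"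
        by (rule dvd_in_mult2[OF L]) (use iI in \<open>auto intro!: mon_lau K\<close>)
      moreover have "mon (single i 1) * (mon (single i (-1)) * q) = q" for q :: "'a laurent"
        by (simp add: mult_single flip: mult.assoc single_add)
      ultimately have "dvd_in L (f i) (mon v * r)" by (simp only:)
      then have "dvd_in L (f i) (mon (- v) * (mon v * r))"
        by (rule dvd_in_mult2[OF L]) (use r(2) in \<open>auto intro!: mon_lau K\<close>)
      then have "dvd_in L (f i) r" by simp
      \<comment> \<open>As \<open>r\<close> is free of \<open>x_i\<close>, it is its own coefficient
        in degree 0, so divisibility descends to the ring without \<open>x_i\<close>.\<close>
      then have "\<forall>k. dvd_in (lau K ?J) (f i) (g.coef k r)"
        using g.dvd_T_iff[OF fS, of r] r(1) S_L unfolding T by blast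
      then show ?thesis using g.coef_mult_S[OF r(1), of 0 1] g.coef_one by (metis mult.right_neutral)
    qed
    from X show "dvd_in (lau K ?J) (f i) p \<or> dvd_in (lau K ?J) (f i) q"
    proof
      assume "dvd_in A (mon (single i 1)) ?p"
      then have "dvd_in A (mon (single i 1)) (mon (u + s) * p)"
        by (simp add: mult.assoc flip: mon_mult)
      then show ?thesis using conv[OF p, of "u + s"] keys_plus_subset[OF u(1) s(1)] by blast
    qed (use conv[OF q t(1)] in blast)
  qed
  \<comment> \<open>Gauss's lemma reinstates the variable \<open>x_i\<close>.\<close>
  then have "prime_in (lau K (insert i ?J)) (f i)" by (rule g.prime_S_T)
  then show ?thesis unfolding T .
qed

text \<open>\<open>x_i\<close> divides the product of \<open>x_j\<close> and
  \<open>f_j / x_j\<close> in \<open>A\<close>. It does not divide \<open>x_j\<close>, so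
  \<open>f_j / (x_i x_j)\<close> lies in \<open>A\<close>. The pair condition then makes
  \<open>f_j\<close> times a monomial a multiple of \<open>f_i * f_j\<close>, and the nonunit
  \<open>f_i\<close> would divide a monomial.\<close>

lemma exchange_distinct:
  assumes ij: "i \<in> E" "j \<in> E" "i \<noteq> j"
  shows "f i \<noteq> f j"
proof
  assume eq: "f i = f j"
  have I2: "i \<in> I" "j \<in> I" using ij EI by auto
  have y: "mon (single l (-1)) * f l \<in> A" if l: "l \<in> E" for l
  proof -
    have "single (single l (-1)) 1 * (\<Prod>k\<in>E. f k ^ (if k = l then 1 else 0)) \<in> lower_alg K I E f"
      by (rule lower_alg_term) (use l EI K in \<open>auto simp: is_subringD lookup_single when_def\<close>)
    also have "(\<Prod>k\<in>E. f k ^ (if k = l then 1 else 0)) = f l"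
      using prod.remove[of E l "\<lambda>k. f k ^ (if k = l then 1 else 0)"] l by simp
    finally show ?thesis using lower_A by blast
  qed
  have xA: "mon (single l 1) \<in> A" if "l \<in> I" for l
    using that by (intro mon_A) (auto simp: lookup_single when_def)
  have cancel: "mon (single l 1) * (mon (single l (-1)) * p) = p" "mon (single l (-1)) * (mon (single l 1) * p) = p"
    for l and p :: "'a laurent"
    by (simp_all add: mult_single flip: mult.assoc single_add)
  have "dvd_in A (mon (single i 1)) (mon (single j 1) * (mon (single j (-1)) * f j))"
    unfolding cancel eq[symmetric] by (rule dvd_inI[OF y[OF ij(1)]]) (simp only: cancel)
  then have "dvd_in A (mon (single i 1)) (mon (single j 1)) \<or> dvd_in A (mon (single i 1)) (mon (single j (-1)) * f j)"
    using prime_inD(4)[OF var_prime_A[OF ij(1)] xA[OF I2(2)] y[OF ij(2)]] by blast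
  then show False
  proof
    assume "dvd_in A (mon (single i 1)) (mon (single j 1))"
    then obtain d where d: "d \<in> A" "mon (single j 1) = mon (single i 1) * d" by (auto simp: dvd_in_def)
    have "d = mon (single i (-1)) * mon (single j 1)" unfolding d(2) cancel ..
    then have "single (single i (-1) + single j 1) 1 \<in> A" using d(1) by (simp add: mult_single)
    from single_A_nonneg[OF ij(1) this, of 1] ij(3) show False
      using is_subringD(1)[OF K] by (simp add: lookup_add lookup_single)
  next
    assume "dvd_in A (mon (single i 1)) (mon (single j (-1)) * f j)"
    then obtain d where d: "d \<in> A" "mon (single j (-1)) * f j = mon (single i 1) * d" by (auto simp: dvd_in_def)
    have d_eq: "d = mon (single i (-1) + single j (-1)) * f j"
      using cancel(2)[of i d] unfolding d(2)[symmetric] by (simp add: mult.assoc flip: mon_mult)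
    have free: "lookup e k = 0" if "k \<in> {i, j}" "e \<in> keys (f l)" "l \<in> {i, j}" for e k l
      using that f_free ij eq by auto
    have hom: "part (deg k) a (f l * p) = f l * part (deg k) a p" if "k \<in> {i, j}" "l \<in> {i, j}" for k l a p
      using part_homogeneous_mult[OF additive_deg, of "f l" k 0 a p] free[OF that(1) _ that(2)] by auto
    have hom_pow: "part (deg k) a (f l ^ w * p) = f l ^ w * part (deg k) a p" if "k \<in> {i, j}" "l \<in> {i, j}" for k l a p w
      by (induction w) (auto simp: mult.assoc hom[OF that] simp del: One_nat_def)
    \<comment> \<open>the monomials of a standard element with exponent \<open>-1\<close> at \<open>i\<close> and \<open>j\<close> carry a factor \<open>f\<^sub>i f\<^sub>j\<close>\<close>
    have "dvd_in L (f i * f j) (part (deg i) (-1) (part (deg j) (-1) p))" if "p \<in> lower_alg K I {i, j} f" for p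
      using that
    proof induction
      case zero
      then show ?case by (simp add: dvd_in_0[OF L] del: One_nat_def)
    next
      case (step p c s w)
      have prod: "single s c * (\<Prod>k\<in>{i, j}. f k ^ w k) = f i ^ w i * (f j ^ w j * single s c)"
        using ij(3) by (simp add: mult_ac)
      have "dvd_in L (f i * f j) (part (deg i) (-1) (part (deg j) (-1) (single s c * (\<Prod>k\<in>{i, j}. f k ^ w k))))"
      proof (cases "lookup s i = -1 \<and> lookup s j = -1")
        case True
        have "1 \<le> w i" "1 \<le> w j" using step(4)[of i] step(4)[of j] True by auto
        then have "dvd_in L (f i ^ 1 * f j ^ 1) (f i ^ w i * f j ^ w j)"
          by (intro dvd_in_mult_mono[OF L] dvd_in_power_le[OF L f_L])
        then have "dvd_in L (f i * f j) (f i ^ w i * f j ^ w j * single s c)"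
          using dvd_in_mult[OF L] lau_single[OF K step(2,3)] by simp
        then show ?thesis using True by (simp add: prod hom_pow part_single mult.assoc del: One_nat_def)
      next
        case False
        then have "part (deg i) (-1) (part (deg j) (-1) (single s c * (\<Prod>k\<in>{i, j}. f k ^ w k))) = 0"
          unfolding prod by (auto simp: hom_pow part_single simp del: One_nat_def)
        then show ?thesis using dvd_in_0[OF L] by (simp only:)
      qed
      from dvd_in_add[OF L this step(5)] show ?case unfolding part_add .
    qed
    moreover have "d \<in> lower_alg K I {i, j} f" using d(1) A_W ij by (auto simp: W_def)
    ultimately have "dvd_in L (f i * f j) (part (deg i) (-1) (part (deg j) (-1) d))" by blast
    also have "part (deg i) (-1) (part (deg j) (-1) d) = f j * mon (single i (-1) + single j (-1))"
      using ij(3) unfolding d_eq by (subst mult.commute) (simp add: hom part_single lookup_add lookup_single del: One_nat_def)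
    finally have "dvd_in L (f j * f i) (f j * mon (single i (-1) + single j (-1)))"
      by (simp add: mult.commute)
    then have "dvd_in L (f i) (mon (single i (-1) + single j (-1)))"
      by (rule dvd_in_cancel) (rule f_neq_0)
    moreover have "mon (single i (-1) + single j (-1)) * mon (single i 1 + single j 1) = (1 :: 'a laurent)"
      by (simp add: mult_single flip: single_add) (simp add: single_uminus)
    moreover have "mon (single i 1 + single j 1) \<in> L"
      using I2 by (intro mon_lau K keys_plus_subset) auto
    ultimately show False
      using f_not_dvd_unit[OF ij(1), of "mon (single i (-1) + single j (-1))" "mon (single i 1 + single j 1)"] by blast
  qed
qed

end

theorem theorem5p1:
  fixes K :: "'f::field_char_0 set"
    and n m :: nat
    and x :: "nat \<Rightarrow> 'f"
    and b :: "nat \<Rightarrow> nat \<Rightarrow> int"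
  assumes base: "base_ring K"
    and seed: "is_seed K n m x b"
    and ambient: "ambient_field K n m x = UNIV"
    and acyclic: "acyclic_seed n b"
    and no_isolated: "subfield K (ring_of_type_algebra :: 'f ring) \<Longrightarrow>
                      \<forall>i \<in> {1..n}. \<not> isolated_index n m b i"
  shows "factorial_domain (ring_on (cluster_algebra K n m x b)) \<longleftrightarrow>
    (\<forall>i \<in> {1..n}. ring_prime\<^bsub>ring_on (seed_polynomials K n m x)\<^esub> (exchange_poly n m x b i)) \<and>
    (\<forall>i \<in> {1..n}. \<forall>j \<in> {1..n}. i \<noteq> j \<longrightarrow> exchange_poly n m x b i \<noteq> exchange_poly n m x b j)"
proof -
  note K = base_ring_subring[OF base]
  interpret S: acyclic_seed_setup K n m x b
  proof
    show "is_subring K" by (rule K)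
    show "coeff_hom.indep (\<lambda>c. c) K {1..n + m} x"
      by (rule alg_independent_indep[OF K]) (use seed in \<open>auto simp: is_seed_def\<close>)
    show "exchange_matrix n b" using seed by (simp add: is_seed_def)
    show "acyclic_seed n b" by (rule acyclic)
    show "prime_factorial (lau K {})" by (rule prime_factorial_lau_empty[OF base])
  qed
  \<comment> \<open>A unit of the Laurent ring is a single term, and an exchange polynomial is one
    only if the index is isolated and the polynomial is the constant 2. Over a field isolated
    indices are excluded, and over the integers 2 is not invertible.\<close>
  have nonunit: "\<not> unit_in (lau K {1..n+m}) (exch {1..n+m} b i)" if i: "i \<in> {1..n}" for i
  proof
    assume "unit_in (lau K {1..n+m}) (exch {1..n+m} b i)"
    then obtain v where v: "exch {1..n+m} b i \<in> lau K {1..n+m}" "v \<in> lau K {1..n+m}" "exch {1..n+m} b i * v = 1"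
      by (auto simp: unit_in_def)
    obtain s c c' where s: "exch {1..n+m} b i = single s c" "v = single (- s) c'" "c * c' = 1"
      using laurent_unit[OF v(3)] by blast
    have "c \<noteq> 0" using s(3) by auto
    then have "s \<in> keys (exch {1..n+m} b i :: 'f laurent)" unfolding s(1) by simp
    then have "keys s \<subseteq> {1..n+m}" by (rule lau_keys[OF v(1)])
    then have c: "c = 2" "\<forall>j\<in>{1..n+m}. b j i = 0" using exch_neq_single[OF K, of "{1..n+m}" s b i c] s(1) by auto
    have "K = \<int>" using base no_isolated c(2) i unfolding base_ring_def isolated_index_def by blast
    moreover have "c' \<in> K" using lau_coeff[OF v(2), of "- s"] s(2) by simp
    ultimately obtain z where "c' = of_int z" by (auto elim: Ints_cases)
    then have "of_int (2 * z) = (of_int 1 :: 'f)" using s(3) c(1) by simp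
    then have "2 * z = 1" unfolding of_int_eq_iff .
    then show False by presburger
  qed
  show ?thesis (is "?fd \<longleftrightarrow> ?P \<and> ?D")
  proof
    assume ?fd
    then interpret F: factorial_seed K n m x b
      by (intro factorial_seed.intro factorial_seed_axioms.intro S.acyclic_seed_setup_axioms nonunit)
    show "?P \<and> ?D"
      using F.exchange_prime F.exchange_distinct by (auto simp: S.ring_prime_exchange_iff S.exchange_eq_iff)
  next
    assume "?P \<and> ?D"
    then show ?fd
      by (intro S.factorial_if_primes) (auto simp: S.ring_prime_exchange_iff S.exchange_eq_iff)
  qed
qed

end
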